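(* Let $\lambda:\mathrm{Imm}(S^1,\mathbb R^3)\to\mathbb R_{>0}$ be smooth and invariant under reparametrization, assume that $\mathrm{grad}^{G^{\mathrm{id}}}\lambda$ exists, and let $\Omega^\lambda=-d(\lambda\Theta^{\mathrm{id}})$. (a) Let $H:\mathrm{Imm}(S^1,\mathbb R^3)\to\mathbb R$ be a $\mathrm{Diff}^+(S^1)$-invariant Hamiltonian for which $\mathrm{grad}^{G^{\mathrm{id}}}H$ exists. If $3\lambda+\mathcal L_I\lambda\neq0$ on any open subset of $\mathrm{Imm}(S^1,\mathbb R^3)$ (that is, $3\lambda+\mathcal L_I\lambda$ does not vanish identically on any nonempty open subset), then $$\mathrm{hgrad}^{\Omega^\lambda}_cH=-\frac1{3\lambda(c)}\Big\{D_sc\times\mathrm{grad}_c^{G^{\mathrm{id}}}H+\frac{1}{3\lambda(c)+D_{c,c}\lambda(c)}\Big[\big\langle\mathrm{grad}_c^{G^{\mathrm{id}}}\lambda,\,D_sc\times\mathrm{grad}_c^{G^{\mathrm{id}}}H\big\rangle_{L^2_{ds}}\,D_sc\times(D_sc\times c)-\big\langle c,\mathrm{grad}_c^{G^{\mathrm{id}}}H\big\rangle_{L^2_{ds}}\,D_sc\times\mathrm{grad}_c^{G^{\mathrm{id}}}\lambda\Big]\Big\}.$$ (b) Let $H:\mathrm{Imm}(S^1,\mathbb R^3)\to\mathbb R$ be a Hamiltonian for which $\mathrm{grad}^{G^{\mathrm{id}}}H$ exists and which is invariant under $\mathrm{Diff}^+(S^1)$ and under the flows of the scaling vector field $I$ and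 of $\mathrm{hgrad}^{\Omega^{\mathrm{MW}}}\lambda=-D_sc\times\mathrm{grad}^{G^{\mathrm{id}}}\lambda$. If $3\lambda(c)+(\mathcal L_I\lambda)(c)=0$ for all $c$, then $\mathrm{hgrad}^{\Omega^\lambda}_cH$ is the orthogonal projection of $$X^H_c=-\frac1{3\lambda(c)}D_sc\times\mathrm{grad}^{G^{\mathrm{id}}}_cH=\frac1{\lambda(c)}\mathrm{hgrad}^{\Omega^{\mathrm{id}}}_cH$$ to the $G^{\mathrm{id}}_c$-orthogonal complement of the kernel of $\Omega^\lambda$, which is spanned by $I$, $\mathrm{hgrad}^{\Omega^{\mathrm{MW}}}\lambda$ and $\{a\,D_sc:a\in C^\infty(S^1)\}$; namely $$\mathrm{hgrad}^{\Omega^\lambda}_cH=\frac1{3\lambda(c)}\Big(-D_sc\times\mathrm{grad}_c^{G^{\mathrm{id}}}H+a_c\,(1-\mathrm{pr}_c)I_c-b_c\,D_sc\times\mathrm{grad}_c^{G^{\mathrm{id}}}\lambda\Big),$$ where $(a_c,b_c)\in\mathbb R^2$ is given by $$\begin{pmatrix}a_c\\ b_c\end{pmatrix}=\begin{pmatrix}\langle v,v\rangle_{L^2_{ds}}&\langle v,w\rangle_{L^2_{ds}}\\ \langle v,w\rangle_{L^2_{ds}}&\langle w,w\rangle_{L^2_{ds}}\end{pmatrix}^{-1}\begin{pmatrix}\langle u,v\rangle_{L^2_{ds}}\\ \langle u,w\rangle_{L^2_{ds}}\end{pmatrix},$$ with $u=-D_sc\times\mathrm{grad}_c^{G^{\mathrm{id}}}H=\mathrm{hgrad}_c^{\Omega^{\mathrm{MW}}}H$,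 $v=(1-\mathrm{pr}_c)I_c$, $w=-D_sc\times\mathrm{grad}_c^{G^{\mathrm{id}}}\lambda=\mathrm{hgrad}_c^{\Omega^{\mathrm{MW}}}\lambda$; here the matrix is invertible because $v$ and $w$ are linearly independent at every $c\in\mathrm{Imm}(S^1,\mathbb R^3)$.
   Context: $\mathrm{Imm}(S^1,\mathbb R^3)=\{c\in C^\infty(S^1,\mathbb R^3): |c_\theta|\neq 0 \text{ everywhere}\}$ is an open subset of $C^\infty(S^1,\mathbb R^3)$, with tangent spaces $C^\infty(S^1,\mathbb R^3)$. For an immersion $c$, $D_s=\frac1{|c_\theta|}\partial_\theta$, $ds=|c_\theta|\,d\theta$; $\times$ is the cross product on $\mathbb R^3$. $D_{c,h}$ is the directional derivative at $c$ in direction $h$. $I$ is the scaling vector field $I_c=c$, and $\mathcal L$ is the Lie derivative, so $(\mathcal L_I\lambda)(c)=D_{c,c}\lambda(c)$. $\mathrm{Diff}^+(S^1)$ acts by reparametrization. $\mathrm{pr}_ch=\langle D_sc,h\rangle D_sc$ is the pointwise projection to the tangential part. $\langle h,k\rangle_{L^2_{ds}}=G^{\mathrm{id}}_c(h,k)=\int_{S^1}\langle h,k\rangle ds$; $\mathrm{grad}^{G^{\mathrm{id}}}E$ is the vector field with $G^{\mathrm{id}}(\mathrm{grad}^{G^{\mathrm{id}}}E,\cdot)=dE$. $\Theta^{\mathrm{id}}_c(h)=\int_{S^1}\langle c\times D_sc,h\rangle ds$, $\Omega^{\mathrm{id}}_c(h,k)=-d\Theta^{\mathrm{id}}_c(h,k)=3\int_{S^1}\langle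 D_sc\times h,k\rangle ds$, and $\Omega^{\mathrm{MW}}=\frac13\Omega^{\mathrm{id}}$ (the Marsden–Weinstein form). One has $\Omega^\lambda=\lambda\Omega^{\mathrm{id}}+\Theta^{\mathrm{id}}\wedge d\lambda$, with $(\alpha\wedge\beta)(h,k)=\alpha(h)\beta(k)-\alpha(k)\beta(h)$. For $\Omega^{\mathrm{id}}$, $\Omega^{\mathrm{MW}}$, and $\Omega^\lambda$ in case (a), the horizontal Hamiltonian vector field $\mathrm{hgrad}^{\Omega}H$ is the vector field $X$ with $i_X\Omega=dH$ and $\langle X_c,D_sc\rangle=0$ pointwise. In case (b), where the kernel of $\Omega^\lambda$ is larger than $\{a\,D_sc\}$, $\mathrm{hgrad}^{\Omega^\lambda}H$ is the vector field $X$ with $i_X\Omega^\lambda=dH$ chosen $G^{\mathrm{id}}$-orthogonal to the whole kernel of $\Omega^\lambda$.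
   Formalization: In (b) the signs are corrected: hgrad = (1/3λ)(u − a v − b w), as the printed u + a v + b w is not the stated orthogonal projection; in (a) the formula is stated where 3λ(c)+D_{c,c}λ(c) ≠ 0, with uniqueness of hgrad on every open set. *)

theory Defs
  imports "HOL-Analysis.Analysis"
begin

unbundle cross3_syntax

section \<open>Smooth loops and immersions\<close>

text \<open>The directional formulation (each \<open>\<lambda>x. f' x h\<close> is again \<open>C\<^sup>n\<close>) agrees with the usual
  one because the domain is finite dimensional.\<close>

primrec Ck :: "nat \<Rightarrow> ('a::euclidean_space \<Rightarrow> 'b::real_normed_vector) \<Rightarrow> bool" where
  "Ck 0 f \<longleftrightarrow> continuous_on UNIV f"
| "Ck (Suc n) f \<longleftrightarrow> (\<exists>f'. (\<forall>x. (f has_derivative f' x) (at x)) \<and> (\<forall>h. Ck n (\<lambda>x. f' x h)))"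

definition C_inf :: "('a::euclidean_space \<Rightarrow> 'b::real_normed_vector) \<Rightarrow> bool" where
  "C_inf f \<longleftrightarrow> (\<forall>n. Ck n f)"

text \<open>The circle is \<open>\<real> / 2\<pi>\<int>\<close>; functions on it are \<open>2\<pi>\<close>-periodic functions on the line.\<close>

definition loops :: "(real \<Rightarrow> 'a::real_normed_vector) set" where
  "loops = {c. C_inf c \<and> (\<forall>\<theta>. c (\<theta> + 2 * pi) = c \<theta>)}"

type_synonym curve = "real \<Rightarrow> real ^ 3"

definition D_theta :: "(real \<Rightarrow> 'a::real_normed_vector) \<Rightarrow> real \<Rightarrow> 'a" where
  "D_theta c \<theta> = vector_derivative c (at \<theta>)"

definition Imm :: "curve set" where
  "Imm = {c \<in> loops. \<forall>\<theta>. D_theta c \<theta> \<noteq> 0}"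

text \<open>The Frechet topology of \<open>C\<^sup>\<infinity>(S\<^sup>1, \<real>\<^sup>3)\<close>: uniform convergence of all derivatives.\<close>

definition loop_open :: "curve set \<Rightarrow> bool" where
  "loop_open V \<longleftrightarrow> V \<subseteq> loops \<and>
     (\<forall>c\<in>V. \<exists>n. \<exists>\<epsilon>>0. \<forall>d\<in>loops.
        (\<forall>j\<le>n. \<forall>\<theta>. norm ((D_theta ^^ j) d \<theta> - (D_theta ^^ j) c \<theta>) < \<epsilon>) \<longrightarrow> d \<in> V)"

lemma istopology_loop_open: "istopology loop_open"
  unfolding istopology_def
proof (intro conjI allI impI)
  fix S T assume S: "loop_open S" and T: "loop_open T"
  show "loop_open (S \<inter> T)"
    unfolding loop_open_def
  proof (intro conjI ballI)
    show "S \<inter> T \<subseteq> loops"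
      using S by (auto simp: loop_open_def)
    fix c assume c: "c \<in> S \<inter> T"
    from S c obtain n1 e1 where 1: "e1 > 0" "\<And>d. d \<in> loops \<Longrightarrow>
      (\<forall>j\<le>n1. \<forall>\<theta>. norm ((D_theta ^^ j) d \<theta> - (D_theta ^^ j) c \<theta>) < e1) \<Longrightarrow> d \<in> S"
      unfolding loop_open_def by (metis IntE)
    from T c obtain n2 e2 where 2: "e2 > 0" "\<And>d. d \<in> loops \<Longrightarrow>
      (\<forall>j\<le>n2. \<forall>\<theta>. norm ((D_theta ^^ j) d \<theta> - (D_theta ^^ j) c \<theta>) < e2) \<Longrightarrow> d \<in> T"
      unfolding loop_open_def by (metis IntE)
    show "\<exists>n. \<exists>\<epsilon>>0. \<forall>d\<in>loops.
      (\<forall>j\<le>n. \<forall>\<theta>. norm ((D_theta ^^ j) d \<theta> - (D_theta ^^ j) c \<theta>) < \<epsilon>) \<longrightarrow> d \<in> S \<inter> T"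
      using 1 2 by (intro exI[of _ "max n1 n2"] exI[of _ "min e1 e2"]) simp
  qed
next
  fix \<K> assume K: "\<forall>K\<in>\<K>. loop_open K"
  show "loop_open (\<Union>\<K>)"
    unfolding loop_open_def
  proof (intro conjI ballI)
    show "\<Union>\<K> \<subseteq> loops"
      using K by (auto simp: loop_open_def)
    fix c assume "c \<in> \<Union>\<K>"
    then obtain K where "K \<in> \<K>" "c \<in> K" by blast
    then show "\<exists>n. \<exists>\<epsilon>>0. \<forall>d\<in>loops.
      (\<forall>j\<le>n. \<forall>\<theta>. norm ((D_theta ^^ j) d \<theta> - (D_theta ^^ j) c \<theta>) < \<epsilon>) \<longrightarrow> d \<in> \<Union>\<K>"
      using K unfolding loop_open_def by (meson UnionI)
  qed
qed

definition loop_topology :: "curve topology" where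
  "loop_topology = topology loop_open"

lemma openin_loop_topology: "openin loop_topology V \<longleftrightarrow> loop_open V"
  by (simp add: loop_topology_def istopology_loop_open topology_inverse')

section \<open>Calculus on the space of immersions\<close>

text \<open>Smoothness is that of convenient calculus: a map is smooth iff it takes smooth curves to smooth
  curves. On Frechet spaces this coincides with the other usual notions of smoothness. By the
  exponential law, a smooth curve in \<open>C\<^sup>\<infinity>(S\<^sup>1, \<real>\<^sup>3)\<close> is a smooth map \<open>\<real> \<times> S\<^sup>1 \<rightarrow> \<real>\<^sup>3\<close>.\<close>

definition smooth_path :: "(real \<Rightarrow> curve) \<Rightarrow> bool" where
  "smooth_path \<gamma> \<longleftrightarrow> C_inf (\<lambda>(t, \<theta>). \<gamma> t \<theta>) \<and> (\<forall>t. \<gamma> t \<in> loops)"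

definition smooth_functional :: "curve set \<Rightarrow> (curve \<Rightarrow> real) \<Rightarrow> bool" where
  "smooth_functional U f \<longleftrightarrow>
     (\<forall>\<gamma>. smooth_path \<gamma> \<and> (\<forall>t. \<gamma> t \<in> U) \<longrightarrow> C_inf (\<lambda>t. f (\<gamma> t)))"

definition smooth_field :: "curve set \<Rightarrow> (curve \<Rightarrow> curve) \<Rightarrow> bool" where
  "smooth_field U X \<longleftrightarrow> (\<forall>c\<in>U. X c \<in> loops) \<and>
     (\<forall>\<gamma>. smooth_path \<gamma> \<and> (\<forall>t. \<gamma> t \<in> U) \<longrightarrow> smooth_path (\<lambda>t. X (\<gamma> t)))"

definition dir_deriv :: "(curve \<Rightarrow> real) \<Rightarrow> curve \<Rightarrow> curve \<Rightarrow> real" where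
  "dir_deriv f c h = deriv (\<lambda>t. f (\<lambda>\<theta>. c \<theta> + t *\<^sub>R h \<theta>)) 0"

definition lie_deriv :: "(curve \<Rightarrow> curve) \<Rightarrow> (curve \<Rightarrow> real) \<Rightarrow> curve \<Rightarrow> real" where
  "lie_deriv X f c = dir_deriv f c (X c)"

definition scaling :: "curve \<Rightarrow> curve" where
  "scaling c = c"

text \<open>The tangent bundle of the open set \<open>Imm\<close> is trivial, so \<open>h\<close> and \<open>k\<close> extend to constant vector
  fields, whose bracket vanishes; hence there is no bracket term.\<close>

definition ext_deriv ::
    "(curve \<Rightarrow> curve \<Rightarrow> real) \<Rightarrow> curve \<Rightarrow> curve \<Rightarrow> curve \<Rightarrow> real" where
  "ext_deriv \<alpha> c h k = dir_deriv (\<lambda>c. \<alpha> c k) c h - dir_deriv (\<lambda>c. \<alpha> c h) c k"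

text \<open>An orientation preserving diffeomorphism of the circle is represented by its lifts to the line.\<close>

definition Diff_plus :: "(real \<Rightarrow> real) set" where
  "Diff_plus = {\<phi>. C_inf \<phi> \<and> (\<forall>\<theta>. \<phi> (\<theta> + 2 * pi) = \<phi> \<theta> + 2 * pi) \<and> (\<forall>\<theta>. deriv \<phi> \<theta> > 0)}"

definition Diff_invariant :: "(curve \<Rightarrow> real) \<Rightarrow> bool" where
  "Diff_invariant f \<longleftrightarrow> (\<forall>c\<in>Imm. \<forall>\<phi>\<in>Diff_plus. f (c \<circ> \<phi>) = f c)"

text \<open>Flows are local, since a vector field on a Frechet manifold need not have a global one:
  through every \<open>c\<close> there is an integral curve of \<open>X\<close>, for small times, along which \<open>f\<close> is constant.
  Taking \<open>\<gamma>\<close> to be defined for all times is harmless, as only \<open>\<bar>t\<bar> < \<epsilon>\<close> is used.\<close>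

definition flow_invariant :: "(curve \<Rightarrow> curve) \<Rightarrow> (curve \<Rightarrow> real) \<Rightarrow> bool" where
  "flow_invariant X f \<longleftrightarrow>
     (\<forall>c\<in>Imm. \<exists>\<gamma>. \<exists>\<epsilon>>0. smooth_path \<gamma> \<and> (\<forall>t. \<gamma> t \<in> Imm) \<and> \<gamma> 0 = c \<and>
        (\<forall>t. \<bar>t\<bar> < \<epsilon> \<longrightarrow>
           (\<forall>\<theta>. ((\<lambda>s. \<gamma> s \<theta>) has_vector_derivative X (\<gamma> t) \<theta>) (at t)) \<and> f (\<gamma> t) = f c))"

section \<open>Metric, gradient and symplectic forms\<close>

definition D_s :: "curve \<Rightarrow> curve \<Rightarrow> curve" where
  "D_s c f \<theta> = (1 / norm (D_theta c \<theta>)) *\<^sub>R D_theta f \<theta>"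

definition pr :: "curve \<Rightarrow> curve \<Rightarrow> curve" where
  "pr c h \<theta> = (D_s c c \<theta> \<bullet> h \<theta>) *\<^sub>R D_s c c \<theta>"

definition tcross :: "curve \<Rightarrow> curve \<Rightarrow> curve" where
  "tcross c h \<theta> = D_s c c \<theta> \<times> h \<theta>"

definition G_id :: "curve \<Rightarrow> curve \<Rightarrow> curve \<Rightarrow> real" where
  "G_id c h k = integral {0..2 * pi} (\<lambda>\<theta>. (h \<theta> \<bullet> k \<theta>) * norm (D_theta c \<theta>))"

definition is_grad :: "(curve \<Rightarrow> real) \<Rightarrow> (curve \<Rightarrow> curve) \<Rightarrow> bool" where
  "is_grad E g \<longleftrightarrow> smooth_field Imm g \<and>
     (\<forall>c\<in>Imm. \<forall>h\<in>loops. G_id c (g c) h = dir_deriv E c h)"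

definition Theta_id :: "curve \<Rightarrow> curve \<Rightarrow> real" where
  "Theta_id c h = G_id c (\<lambda>\<theta>. c \<theta> \<times> D_s c c \<theta>) h"

definition Omega_id :: "curve \<Rightarrow> curve \<Rightarrow> curve \<Rightarrow> real" where
  "Omega_id c h k = - ext_deriv Theta_id c h k"

definition Omega_MW :: "curve \<Rightarrow> curve \<Rightarrow> curve \<Rightarrow> real" where
  "Omega_MW c h k = (1 / 3) * Omega_id c h k"

definition Omega :: "(curve \<Rightarrow> real) \<Rightarrow> curve \<Rightarrow> curve \<Rightarrow> curve \<Rightarrow> real" where
  "Omega l c h k = - ext_deriv (\<lambda>c h. l c * Theta_id c h) c h k"

definition form_kernel ::
    "(curve \<Rightarrow> curve \<Rightarrow> curve \<Rightarrow> real) \<Rightarrow> curve \<Rightarrow> curve set" where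
  "form_kernel \<omega> c = {h \<in> loops. \<forall>k\<in>loops. \<omega> c h k = 0}"

section \<open>Hamiltonian vector fields\<close>

definition is_hamiltonian_field ::
    "curve set \<Rightarrow> (curve \<Rightarrow> curve \<Rightarrow> curve \<Rightarrow> real) \<Rightarrow> (curve \<Rightarrow> real) \<Rightarrow> (curve \<Rightarrow> curve) \<Rightarrow> bool" where
  "is_hamiltonian_field U \<omega> H X \<longleftrightarrow> smooth_field U X \<and>
     (\<forall>c\<in>U. \<forall>k\<in>loops. \<omega> c (X c) k = dir_deriv H c k)"

definition is_hgrad ::
    "curve set \<Rightarrow> (curve \<Rightarrow> curve \<Rightarrow> curve \<Rightarrow> real) \<Rightarrow> (curve \<Rightarrow> real) \<Rightarrow> (curve \<Rightarrow> curve) \<Rightarrow> bool" where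
  "is_hgrad U \<omega> H X \<longleftrightarrow> is_hamiltonian_field U \<omega> H X \<and>
     (\<forall>c\<in>U. \<forall>\<theta>. X c \<theta> \<bullet> D_s c c \<theta> = 0)"

text \<open>The variant of \<open>is_hgrad\<close> for a form whose kernel is larger than the vertical bundle.\<close>

definition is_hgrad_perp ::
    "curve set \<Rightarrow> (curve \<Rightarrow> curve \<Rightarrow> curve \<Rightarrow> real) \<Rightarrow> (curve \<Rightarrow> real) \<Rightarrow> (curve \<Rightarrow> curve) \<Rightarrow> bool" where
  "is_hgrad_perp U \<omega> H X \<longleftrightarrow> is_hamiltonian_field U \<omega> H X \<and>
     (\<forall>c\<in>U. \<forall>h\<in>form_kernel \<omega> c. G_id c (X c) h = 0)"

definition orth_compl :: "curve \<Rightarrow> curve set \<Rightarrow> curve set" where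
  "orth_compl c K = {h \<in> loops. \<forall>k\<in>K. G_id c h k = 0}"

text \<open>\<open>p\<close> is the \<open>G_id c\<close>-orthogonal projection of \<open>x\<close> to the subspace \<open>P\<close>.\<close>

definition is_orth_proj :: "curve \<Rightarrow> curve set \<Rightarrow> curve \<Rightarrow> curve \<Rightarrow> bool" where
  "is_orth_proj c P x p \<longleftrightarrow> p \<in> P \<and> (\<forall>q\<in>P. G_id c (\<lambda>\<theta>. x \<theta> - p \<theta>) q = 0)"

definition gram2 :: "curve \<Rightarrow> curve \<Rightarrow> curve \<Rightarrow> real ^ 2 ^ 2" where
  "gram2 c v w = vector [vector [G_id c v v, G_id c v w], vector [G_id c v w, G_id c w w]]"

end

theory Submission
  imports Defs
begin

text \<open>Since \<open>D\<^sub>s c ds = c\<^sub>\<theta> d\<theta>\<close>, the one-form \<open>\<Theta>\<close> is polynomial in \<open>c\<close>, and integration by parts gives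
  \<open>\<Omega>\<^sup>\<lambda>(h, k) = 3 \<lambda> \<langle>D\<^sub>s c \<times> h, k\<rangle> + \<Theta>(h) d\<lambda>(k) - \<Theta>(k) d\<lambda>(h)\<close>. Invariance under reparametrization makes
  all gradients normal to \<open>c\<close>, where \<open>J = D\<^sub>s c \<times>\<close> satisfies \<open>J\<^sup>2 = -1\<close>. So \<open>i\<^sub>X \<Omega>\<^sup>\<lambda> = dH\<close> determines the normal
  part of \<open>X\<close> up to the two numbers \<open>\<Theta>(X)\<close> and \<open>d\<lambda>(X)\<close>. Pairing with \<open>c\<close> and \<open>J grad \<lambda>\<close> multiplies these
  numbers by \<open>3 \<lambda> + d\<lambda>(c)\<close>: in case (a) this computes them, in case (b) it exhibits the kernel.

  Smoothness is tested on smooth paths only. Continuity along convergent sequences, which the chain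
  rule and the density argument of case (a) need, comes from the special curve lemma: a fast
  converging sequence of loops lies on a smooth path.\<close>

section \<open>Calculus of smooth maps\<close>

text \<open>Write J for \<open>tcross c\<close> and p for the gradient of \<open>l\<close>. The
  factor 3 l + dl(c) is a scaling weight: \<Theta> is quadratic in the foot point and linear in the
  vector, so it has degree 3 under the flow of \<open>scaling\<close>, and \<Theta>(c) = 0; Cartan's
  formula gives i_c Omega = - (3 l + dl(c)) \<Theta>. Where the factor vanishes, c falls into the
  kernel, and so does - J p. Then i_X Omega = dH forces grad H to be orthogonal to c and to J p,
  which is what the two extra invariances in case (b) supply. Two obstacles shape the statements. In
  (a) the denominator may vanish on a set without interior, so the formula is asserted off that set,
  and across it only uniqueness is available. In (b) the kernel is infinite dimensional inside an
  incomplete inner product space, where projections need not exist; the projection is built by hand,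
  removing the tangential part pointwise and the two remaining directions by a Gram system. Each
  explicit field must also be shown smooth, since Hamiltonian fields are smooth by
  definition.\<close>

lemma Ck_SucI:
  assumes "\<And>x. (f has_derivative f' x) (at x)" and "\<And>h. Ck n (\<lambda>x. f' x h)"
  shows "Ck (Suc n) f"
  using assms by auto

lemma Ck_Suc_imp: "Ck (Suc n) f \<Longrightarrow> Ck n f"
proof (induction n arbitrary: f)
  case 0
  then obtain f' where f': "\<And>x. (f has_derivative f' x) (at x)" unfolding Ck.simps by blast
  show ?case
    using has_derivative_continuous[OF f'] by (simp add: continuous_at_imp_continuous_on)
next
  case (Suc n)
  obtain f' where f': "\<And>x. (f has_derivative f' x) (at x)" "\<And>h. Ck (Suc n) (\<lambda>x. f' x h)"
    using Suc.prems unfolding Ck.simps by blast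
  show ?case by (rule Ck_SucI[OF f'(1) Suc.IH[OF f'(2)]])
qed

lemma Ck_continuous_on: "Ck n f \<Longrightarrow> continuous_on A f"
proof (induction n)
  case 0
  then show ?case using continuous_on_subset by auto
qed (metis Ck_Suc_imp)

lemma Ck_const: "Ck n (\<lambda>x. a)"
proof (induction n arbitrary: a)
  case (Suc n)
  show ?case by (rule Ck_SucI[OF has_derivative_const Suc.IH])
qed simp

lemma Ck_linear:
  assumes "bounded_linear L" and "Ck n f"
  shows "Ck n (\<lambda>x. L (f x))"
  using assms(2)
proof (induction n arbitrary: f)
  case 0
  then show ?case using assms(1) by (auto intro: bounded_linear.continuous_on)
next
  case (Suc n)
  then obtain f' where f: "\<And>x. (f has_derivative f' x) (at x)" "\<And>h. Ck n (\<lambda>x. f' x h)"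
    unfolding Ck.simps by blast
  show ?case
    by (rule Ck_SucI[OF bounded_linear.has_derivative[OF assms(1) f(1)] Suc.IH[OF f(2)]])
qed

lemma Ck_ident: "Ck n (\<lambda>x. x)"
  using Ck_SucI[OF has_derivative_ident Ck_const] by (cases n) (simp_all del: Ck.simps(2))

lemma Ck_add:
  assumes "Ck n f" and "Ck n g"
  shows "Ck n (\<lambda>x. f x + g x)"
  using assms
proof (induction n arbitrary: f g)
  case 0
  then show ?case by (auto intro: continuous_intros)
next
  case (Suc n)
  obtain f' where f: "\<And>x. (f has_derivative f' x) (at x)" "\<And>h. Ck n (\<lambda>x. f' x h)"
    using Suc.prems unfolding Ck.simps by blast
  obtain g' where g: "\<And>x. (g has_derivative g' x) (at x)" "\<And>h. Ck n (\<lambda>x. g' x h)"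
    using Suc.prems unfolding Ck.simps by blast
  show ?case
    by (rule Ck_SucI[OF has_derivative_add[OF f(1) g(1)] Suc.IH[OF f(2) g(2)]])
qed

lemma (in bounded_bilinear) Ck:
  assumes "Ck n f" and "Ck n g"
  shows "Ck n (\<lambda>x. prod (f x) (g x))"
  using assms
proof (induction n arbitrary: f g)
  case 0
  then show ?case by (auto intro: continuous_on)
next
  case (Suc n)
  obtain f' where f: "\<And>x. (f has_derivative f' x) (at x)" "\<And>h. Ck n (\<lambda>x. f' x h)"
    using Suc.prems unfolding Ck.simps by blast
  obtain g' where g: "\<And>x. (g has_derivative g' x) (at x)" "\<And>h. Ck n (\<lambda>x. g' x h)"
    using Suc.prems unfolding Ck.simps by blast
  show ?case
    by (rule Ck_SucI[OF FDERIV[OF f(1) g(1)]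
          Ck_add[OF Suc.IH[OF Suc.prems(1)[THEN Ck_Suc_imp] g(2)]
            Suc.IH[OF f(2) Suc.prems(2)[THEN Ck_Suc_imp]]]])
qed

lemma Ck_sum:
  assumes "\<And>i. i \<in> I \<Longrightarrow> Ck n (f i)"
  shows "Ck n (\<lambda>x. \<Sum>i\<in>I. f i x)"
  using assms
proof (induction I rule: infinite_finite_induct)
  case (insert i I)
  then show ?case by (simp add: Ck_add)
qed (simp_all add: Ck_const)

lemma Ck_Pair:
  assumes "Ck n f" and "Ck n g"
  shows "Ck n (\<lambda>x. (f x, g x))"
proof -
  have "Ck n (\<lambda>x. (f x, 0) + (0, g x))"
    by (intro Ck_add Ck_linear[OF bounded_linear_Pair assms(1)] Ck_linear[OF bounded_linear_Pair assms(2)]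
        bounded_linear_ident bounded_linear_zero)
  then show ?thesis by simp
qed

lemma Ck_compose:
  fixes f :: "'a::euclidean_space \<Rightarrow> 'b::euclidean_space" and g :: "'b \<Rightarrow> 'c::real_normed_vector"
  assumes "Ck n g" and "Ck n f"
  shows "Ck n (\<lambda>x. g (f x))"
  using assms
proof (induction n arbitrary: f g)
  case 0
  then show ?case by (auto intro: continuous_on_compose2)
next
  case (Suc n)
  obtain f' where f: "\<And>x. (f has_derivative f' x) (at x)" "\<And>h. Ck n (\<lambda>x. f' x h)"
    using Suc.prems unfolding Ck.simps by blast
  obtain g' where g: "\<And>x. (g has_derivative g' x) (at x)" "\<And>h. Ck n (\<lambda>x. g' x h)"
    using Suc.prems unfolding Ck.simps by blast
  \<comment> \<open>\<open>Ck\<close> controls \<open>g'\<close> only in fixed directions, whereas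
    the chain rule feeds it the moving direction \<open>f' x h\<close>. Expanding that direction in
    the finite basis moves the dependence on \<open>x\<close> into scalar coefficients.\<close>
  have lin: "g' y k = (\<Sum>b\<in>Basis. (k \<bullet> b) *\<^sub>R g' y b)" for y k
  proof -
    have l: "linear (g' y)" using g(1) by (rule has_derivative_linear)
    have "g' y k = g' y (\<Sum>b\<in>Basis. (k \<bullet> b) *\<^sub>R b)" by (simp add: euclidean_representation)
    then show ?thesis by (simp add: linear_sum[OF l] linear_cmul[OF l])
  qed
  have "((\<lambda>x. g (f x)) has_derivative (\<lambda>h. g' (f x) (f' x h))) (at x)" for x
    using has_derivative_compose[OF f(1) g(1)] .
  moreover have "Ck n (\<lambda>x. g' (f x) (f' x h))" for h
  proof -
    have "Ck n (\<lambda>x. \<Sum>b\<in>Basis. (f' x h \<bullet> b) *\<^sub>R g' (f x) b)"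
      by (intro Ck_sum bounded_bilinear.Ck[OF bounded_bilinear_scaleR] Suc.IH g(2)
          Ck_linear[OF bounded_linear_inner_left] f(2) Ck_Suc_imp[OF Suc.prems(2)])
    then show ?thesis unfolding lin[of "f _" "f' _ h", symmetric] .
  qed
  ultimately show ?case by (intro Ck_SucI)
qed

lemma Ck_inverse:
  fixes f :: "'a::euclidean_space \<Rightarrow> real"
  assumes "Ck n f" and "\<And>x. f x \<noteq> 0"
  shows "Ck n (\<lambda>x. inverse (f x))"
  using assms(1)
proof (induction n)
  case 0
  then show ?case using assms(2) by (auto intro: continuous_intros)
next
  case (Suc n)
  obtain f' where f: "\<And>x. (f has_derivative f' x) (at x)" "\<And>h. Ck n (\<lambda>x. f' x h)"
    using Suc.prems unfolding Ck.simps by blast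
  have I: "Ck n (\<lambda>x. inverse (f x))" using Suc.IH Suc.prems Ck_Suc_imp by blast
  have "Ck n (\<lambda>x. - (inverse (f x) * f' x h * inverse (f x)))" for h
    by (intro Ck_linear[OF bounded_linear_minus[OF bounded_linear_ident]]
        bounded_bilinear.Ck[OF bounded_bilinear_mult] I f(2))
  then show ?case
    by (rule Ck_SucI[OF Deriv.has_derivative_inverse[OF assms(2) f(1)]])
qed

text \<open>The exponent is generalised in the induction because each derivative lowers it by one.
  The case p = 1/2 yields smoothness of the norm away from 0.\<close>

lemma Ck_powr:
  fixes f :: "'a::euclidean_space \<Rightarrow> real"
  assumes "Ck n f" and "\<And>x. f x > 0"
  shows "Ck n (\<lambda>x. f x powr p)"
  using assms(1)
proof (induction n arbitrary: p)
  case 0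
  have "f x \<noteq> 0" for x using assms(2)[of x] by simp
  with 0 show ?case by (simp add: continuous_on_powr)
next
  case (Suc n)
  obtain f' where f: "\<And>x. (f has_derivative f' x) (at x)" "\<And>h. Ck n (\<lambda>x. f' x h)"
    using Suc.prems unfolding Ck.simps by blast
  have "Ck n (\<lambda>x. p * (f' x h * f x powr (p - 1)))" for h
    by (intro bounded_bilinear.Ck[OF bounded_bilinear_mult] Ck_const f(2) Suc.IH Ck_Suc_imp[OF Suc.prems])
  moreover have "((\<lambda>x. f x powr p) has_derivative (\<lambda>h. p * (f' x h * f x powr (p - 1)))) (at x)" for x
  proof -
    have "((\<lambda>y. y powr p) has_field_derivative p * f x powr (p - 1)) (at (f x))"
      using assms(2) by (rule has_real_derivative_powr)
    from has_derivative_compose[OF f(1) this[unfolded has_field_derivative_def]]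
    show ?thesis by (simp add: mult_ac)
  qed
  ultimately show ?case by (intro Ck_SucI)
qed

lemma C_infD: "C_inf f \<Longrightarrow> Ck n f"
  by (simp add: C_inf_def)

lemma C_inf_const: "C_inf (\<lambda>x. a)"
  by (simp add: C_inf_def Ck_const)

lemma C_inf_ident: "C_inf (\<lambda>x. x)"
  by (simp add: C_inf_def Ck_ident)

lemma C_inf_linear: "bounded_linear L \<Longrightarrow> C_inf f \<Longrightarrow> C_inf (\<lambda>x. L (f x))"
  by (simp add: C_inf_def Ck_linear)

lemma C_inf_add: "C_inf f \<Longrightarrow> C_inf g \<Longrightarrow> C_inf (\<lambda>x. f x + g x)"
  by (simp add: C_inf_def Ck_add)

lemma C_inf_minus: "C_inf f \<Longrightarrow> C_inf (\<lambda>x. - f x)"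
  by (intro C_inf_linear[OF bounded_linear_minus[OF bounded_linear_ident]])

lemma C_inf_diff: "C_inf f \<Longrightarrow> C_inf g \<Longrightarrow> C_inf (\<lambda>x. f x - g x)"
  using C_inf_add[OF _ C_inf_minus, of f g] by simp

lemma C_inf_scaleR: "C_inf f \<Longrightarrow> C_inf g \<Longrightarrow> C_inf (\<lambda>x. f x *\<^sub>R g x)"
  by (simp add: C_inf_def bounded_bilinear.Ck[OF bounded_bilinear_scaleR])

lemma C_inf_mult:
  fixes f g :: "_ \<Rightarrow> real"
  shows "C_inf f \<Longrightarrow> C_inf g \<Longrightarrow> C_inf (\<lambda>x. f x * g x)"
  by (simp add: C_inf_def bounded_bilinear.Ck[OF bounded_bilinear_mult])

lemma C_inf_inner: "C_inf f \<Longrightarrow> C_inf g \<Longrightarrow> C_inf (\<lambda>x. f x \<bullet> g x)"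
  by (simp add: C_inf_def bounded_bilinear.Ck[OF bounded_bilinear_inner])

lemma bounded_bilinear_cross3: "bounded_bilinear (\<lambda>x y. x \<times> y)"
  using bilinear_cross bilinear_conv_bounded_bilinear by blast

lemma C_inf_cross: "C_inf f \<Longrightarrow> C_inf g \<Longrightarrow> C_inf (\<lambda>x. f x \<times> g x)"
  by (simp add: C_inf_def bounded_bilinear.Ck[OF bounded_bilinear_cross3])

lemma C_inf_Pair: "C_inf f \<Longrightarrow> C_inf g \<Longrightarrow> C_inf (\<lambda>x. (f x, g x))"
  by (simp add: C_inf_def Ck_Pair)

lemma C_inf_fst: "C_inf f \<Longrightarrow> C_inf (\<lambda>x. fst (f x))"
  by (rule C_inf_linear[OF bounded_linear_fst])

lemma C_inf_snd: "C_inf f \<Longrightarrow> C_inf (\<lambda>x. snd (f x))"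
  by (rule C_inf_linear[OF bounded_linear_snd])

lemma C_inf_compose:
  fixes f :: "'a::euclidean_space \<Rightarrow> 'b::euclidean_space"
  shows "C_inf g \<Longrightarrow> C_inf f \<Longrightarrow> C_inf (\<lambda>x. g (f x))"
  by (simp add: C_inf_def Ck_compose)

lemma C_inf_inverse:
  fixes f :: "'a::euclidean_space \<Rightarrow> real"
  shows "C_inf f \<Longrightarrow> (\<And>x. f x \<noteq> 0) \<Longrightarrow> C_inf (\<lambda>x. inverse (f x))"
  by (simp add: C_inf_def Ck_inverse)

lemma C_inf_divide:
  fixes f :: "'a::euclidean_space \<Rightarrow> real"
  shows "C_inf f \<Longrightarrow> C_inf g \<Longrightarrow> (\<And>x. g x \<noteq> 0) \<Longrightarrow> C_inf (\<lambda>x. f x / g x)"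
  by (simp add: divide_inverse C_inf_mult C_inf_inverse)

lemma C_inf_norm:
  fixes f :: "'a::euclidean_space \<Rightarrow> 'b::real_inner"
  assumes "C_inf f" and "\<And>x. f x \<noteq> 0"
  shows "C_inf (\<lambda>x. norm (f x))"
proof -
  have "C_inf (\<lambda>x. (f x \<bullet> f x) powr (1/2))"
    using C_inf_inner[OF assms(1) assms(1)] assms(2) by (simp add: C_inf_def Ck_powr)
  then show ?thesis by (simp add: powr_half_sqrt norm_eq_sqrt_inner)
qed

lemma C_inf_continuous_on: "C_inf f \<Longrightarrow> continuous_on A f"
  using C_infD Ck_continuous_on by blast

lemmas C_inf_intros = C_inf_const C_inf_ident C_inf_add C_inf_minus C_inf_diff C_inf_scaleR
  C_inf_mult C_inf_inner C_inf_cross C_inf_Pair C_inf_fst C_inf_snd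

section \<open>Derivatives, partial derivatives and parameter integrals of smooth maps\<close>

lemma C_inf_has_derivative:
  assumes "C_inf f"
  obtains f' where "\<And>x. (f has_derivative f' x) (at x)" and "\<And>h. C_inf (\<lambda>x. f' x h)"
proof -
  from assms have "Ck (Suc 0) f" by (simp only: C_inf_def)
  then obtain f' where f': "\<And>x. (f has_derivative f' x) (at x)" unfolding Ck.simps by blast
  have "Ck n (\<lambda>x. f' x h)" for n h
  proof -
    from assms have "Ck (Suc n) f" by (simp only: C_inf_def)
    then obtain g where g: "\<And>x. (f has_derivative g x) (at x)" "\<And>h. Ck n (\<lambda>x. g x h)"
      unfolding Ck.simps by blast
    \<comment> \<open>Every order \<open>n\<close> supplies its own derivative; uniqueness merges
      them into a single \<open>f'\<close> that serves all orders.\<close>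
    have "g = f'" using has_derivative_unique[OF g(1) f'] by blast
    then show ?thesis using g(2) by simp
  qed
  then show thesis using that[OF f'] by (simp only: C_inf_def) blast
qed

lemma C_inf_has_vector_derivative:
  assumes "C_inf f"
  shows "(f has_vector_derivative D_theta f x) (at x)"
proof -
  obtain f' where "(f has_derivative f' x) (at x)"
    using assms C_inf_has_derivative by metis
  then show ?thesis
    unfolding D_theta_def using differentiableI vector_derivative_works by blast
qed

lemma D_theta_eqI: "(f has_vector_derivative y) (at x) \<Longrightarrow> D_theta f x = y"
  by (simp add: D_theta_def vector_derivative_at)

lemma C_inf_D_theta:
  assumes "C_inf f"
  shows "C_inf (D_theta f)"
proof -
  obtain f' where f': "\<And>x. (f has_derivative f' x) (at x)" "\<And>h. C_inf (\<lambda>x. f' x h)"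
    using assms C_inf_has_derivative by blast
  have "D_theta f x = f' x 1" for x
    using has_derivative_unique[OF f'(1) C_inf_has_vector_derivative[OF assms, unfolded has_vector_derivative_def]]
    by simp
  then show ?thesis using f'(2)[of 1] by presburger
qed

lemma C_inf_funpow_D_theta: "C_inf f \<Longrightarrow> C_inf ((D_theta ^^ j) f)"
  by (induction j) (auto intro: C_inf_D_theta)

lemma C_inf_partial_snd:
  fixes f :: "real \<times> real \<Rightarrow> 'a::real_normed_vector"
  assumes "C_inf f"
  shows "C_inf (\<lambda>p. D_theta (\<lambda>\<theta>. f (fst p, \<theta>)) (snd p))"
    and "((\<lambda>\<theta>. f (t, \<theta>)) has_vector_derivative D_theta (\<lambda>\<theta>. f (t, \<theta>)) \<theta>) (at \<theta>)"
proof -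
  obtain f' where f': "\<And>x. (f has_derivative f' x) (at x)" "\<And>h. C_inf (\<lambda>x. f' x h)"
    using assms C_inf_has_derivative by blast
  have *: "((\<lambda>\<theta>. f (t, \<theta>)) has_vector_derivative f' (t, \<theta>) (0, 1)) (at \<theta>)" for t \<theta>
  proof -
    have "((\<lambda>\<theta>. (t, \<theta>)) has_derivative (\<lambda>h. (0, h))) (at \<theta>)"
      by (auto intro!: derivative_eq_intros)
    from has_derivative_compose[OF this f'(1)]
    have "((\<lambda>\<theta>. f (t, \<theta>)) has_derivative (\<lambda>h. f' (t, \<theta>) (0, h))) (at \<theta>)" .
    moreover have "(\<lambda>h. f' (t, \<theta>) (0, h)) = (\<lambda>h. h *\<^sub>R f' (t, \<theta>) (0, 1))"
    proof
      fix h
      show "f' (t, \<theta>) (0, h) = h *\<^sub>R f' (t, \<theta>) (0, 1)"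
        using linear_cmul[OF has_derivative_linear[OF f'(1)], of "(t,\<theta>)" h "(0, 1)"] by simp
    qed
    ultimately show ?thesis unfolding has_vector_derivative_def by (simp only:)
  qed
  then show "((\<lambda>\<theta>. f (t, \<theta>)) has_vector_derivative D_theta (\<lambda>\<theta>. f (t, \<theta>)) \<theta>) (at \<theta>)"
    using D_theta_eqI[OF *] by simp
  have "D_theta (\<lambda>\<theta>. f (fst p, \<theta>)) (snd p) = f' p (0, 1)" for p
    using D_theta_eqI[OF *[of "fst p" "snd p"]] by simp
  then show "C_inf (\<lambda>p. D_theta (\<lambda>\<theta>. f (fst p, \<theta>)) (snd p))"
    using f'(2) by presburger
qed

lemma C_inf_partial_fst:
  fixes f :: "real \<times> real \<Rightarrow> 'a::real_normed_vector"
  assumes "C_inf f"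
  shows "C_inf (\<lambda>p. D_theta (\<lambda>t. f (t, snd p)) (fst p))"
    and "((\<lambda>t. f (t, \<theta>)) has_vector_derivative D_theta (\<lambda>t. f (t, \<theta>)) t) (at t)"
proof -
  have s: "C_inf (\<lambda>p. f (snd p, fst p))"
    by (rule C_inf_compose[OF assms]) (intro C_inf_intros)
  show "((\<lambda>t. f (t, \<theta>)) has_vector_derivative D_theta (\<lambda>t. f (t, \<theta>)) t) (at t)"
    using C_inf_partial_snd(2)[OF s, of \<theta> t] by simp
  have "C_inf (\<lambda>p::real\<times>real. (snd p, fst p))" by (intro C_inf_intros)
  from C_inf_compose[OF C_inf_partial_snd(1)[OF s] this]
  show "C_inf (\<lambda>p. D_theta (\<lambda>t. f (t, snd p)) (fst p))" by simp
qed

lemma Ck_Suc_realI: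
  assumes "\<And>x. (f has_vector_derivative f' x) (at x)" and "Ck n f'"
  shows "Ck (Suc n) f"
  by (rule Ck_SucI[OF assms(1)[unfolded has_vector_derivative_def]
        bounded_bilinear.Ck[OF bounded_bilinear_scaleR Ck_const assms(2)]])

text \<open>By the Leibniz rule the derivative is the integral of the partial derivative in the
  parameter, which is again jointly smooth; hence the induction is generalised over
  \<open>f\<close>.\<close>

lemma Ck_integral:
  fixes f :: "real \<times> real \<Rightarrow> 'a::banach"
  assumes "C_inf f"
  shows "Ck n (\<lambda>t. integral {a..b} (\<lambda>\<theta>. f (t, \<theta>)))"
  using assms
proof (induction n arbitrary: f)
  case 0
  have "continuous_on (SIGMA t:UNIV. cbox a b) (\<lambda>(x, t). f (x, t))"
    using C_inf_continuous_on[OF 0] by auto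
  then show ?case using integral_continuous_on_param[of UNIV a b "\<lambda>t \<theta>. f (t, \<theta>)"] by simp
next
  case (Suc n)
  let ?f' = "\<lambda>p. D_theta (\<lambda>t. f (t, snd p)) (fst p)"
  have f': "C_inf ?f'" by (rule C_inf_partial_fst(1)[OF Suc.prems])
  have slice: "C_inf (\<lambda>\<theta>. f (t, \<theta>))" for t
    by (rule C_inf_compose[OF Suc.prems]) (intro C_inf_intros)
  have "((\<lambda>t. integral (cbox a b) (\<lambda>\<theta>. f (t, \<theta>))) has_vector_derivative
      integral (cbox a b) (\<lambda>\<theta>. D_theta (\<lambda>t. f (t, \<theta>)) t)) (at t within UNIV)" for t
  proof (rule leibniz_rule_vector_derivative)
    show "continuous_on (SIGMA t:UNIV. cbox a b) (\<lambda>(t, \<theta>). D_theta (\<lambda>t. f (t, \<theta>)) t)"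
      using C_inf_continuous_on[OF f'] by (simp add: case_prod_unfold)
    show "(\<lambda>\<theta>. f (t, \<theta>)) integrable_on cbox a b" for t
      using C_inf_continuous_on[OF slice] integrable_continuous by blast
  qed (auto intro: C_inf_partial_fst(2)[OF Suc.prems])
  then show ?case
    by (intro Ck_Suc_realI[OF _ Suc.IH[OF f', simplified]]) simp
qed

lemma C_inf_integral:
  fixes f :: "real \<times> real \<Rightarrow> 'a::banach"
  shows "C_inf f \<Longrightarrow> C_inf (\<lambda>t. integral {a..b} (\<lambda>\<theta>. f (t, \<theta>)))"
  by (simp add: C_inf_def[of "\<lambda>t. integral {a..b} (\<lambda>\<theta>. f (t, \<theta>))"] Ck_integral)

section \<open>Loops and immersions\<close>

lemma loopsI: "C_inf c \<Longrightarrow> (\<And>\<theta>. c (\<theta> + 2 * pi) = c \<theta>) \<Longrightarrow> c \<in> loops"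
  by (simp add: loops_def)

lemma loops_C_inf: "c \<in> loops \<Longrightarrow> C_inf c"
  and loops_periodic: "c \<in> loops \<Longrightarrow> c (\<theta> + 2 * pi) = c \<theta>"
  by (simp_all add: loops_def)

lemma periodic_representative:
  assumes "\<And>\<theta>. f (\<theta> + 2 * pi) = f \<theta>"
  obtains \<theta>' where "\<theta>' \<in> {0..2 * pi}" and "f \<theta> = f \<theta>'"
proof -
  interpret periodic_fun_simple f "2 * pi"
    by unfold_locales (rule assms)
  let ?n = "\<lfloor>\<theta> / (2 * pi)\<rfloor>"
  have "f (\<theta> - of_int ?n * (2 * pi)) = f \<theta>" by (rule minus_of_int)
  moreover have "of_int ?n * (2 * pi) \<le> \<theta>" "\<theta> \<le> (of_int ?n + 1) * (2 * pi)"
    using floor_divide_lower[of "2 * pi" \<theta>] floor_divide_upper[of "2 * pi" \<theta>] by auto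
  ultimately show thesis
    by (intro that[of "\<theta> - of_int ?n * (2 * pi)"]) (auto simp: algebra_simps)
qed

lemma loops_eq_0I:
  assumes "h \<in> loops" and "\<And>\<theta>. \<theta> \<in> {0..2 * pi} \<Longrightarrow> h \<theta> = 0"
  shows "h \<theta> = 0"
  using periodic_representative[of h \<theta>, OF loops_periodic[OF assms(1)]] assms(2) by metis

lemma loops_const [simp]: "(\<lambda>\<theta>. a) \<in> loops"
  by (simp add: loops_def C_inf_const)

lemma loops_add [simp]: "h \<in> loops \<Longrightarrow> k \<in> loops \<Longrightarrow> (\<lambda>\<theta>. h \<theta> + k \<theta>) \<in> loops"
  by (simp add: loops_def C_inf_add)

lemma loops_minus [simp]: "h \<in> loops \<Longrightarrow> (\<lambda>\<theta>. - h \<theta>) \<in> loops"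
  by (simp add: loops_def C_inf_minus)

lemma loops_diff [simp]: "h \<in> loops \<Longrightarrow> k \<in> loops \<Longrightarrow> (\<lambda>\<theta>. h \<theta> - k \<theta>) \<in> loops"
  by (simp add: loops_def C_inf_diff)

lemma loops_scaleR [simp]: "a \<in> loops \<Longrightarrow> h \<in> loops \<Longrightarrow> (\<lambda>\<theta>. a \<theta> *\<^sub>R h \<theta>) \<in> loops"
  by (simp add: loops_def C_inf_scaleR)

lemma loops_mult [simp]:
  fixes a b :: "real \<Rightarrow> real"
  shows "a \<in> loops \<Longrightarrow> b \<in> loops \<Longrightarrow> (\<lambda>\<theta>. a \<theta> * b \<theta>) \<in> loops"
  by (simp add: loops_def C_inf_mult)

lemma loops_inner [simp]: "h \<in> loops \<Longrightarrow> k \<in> loops \<Longrightarrow> (\<lambda>\<theta>. h \<theta> \<bullet> k \<theta>) \<in> loops"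
  by (simp add: loops_def C_inf_inner)

lemma loops_cross [simp]: "h \<in> loops \<Longrightarrow> k \<in> loops \<Longrightarrow> (\<lambda>\<theta>. h \<theta> \<times> k \<theta>) \<in> loops"
  by (simp add: loops_def C_inf_cross)

lemma D_theta_loops [simp]:
  assumes "h \<in> loops"
  shows "D_theta h \<in> loops"
proof (rule loopsI)
  show "C_inf (D_theta h)" using assms by (simp add: loops_C_inf C_inf_D_theta)
  fix \<theta>
  have "((\<lambda>x. x + 2 * pi) has_vector_derivative 1) (at \<theta>)"
    by (auto intro!: derivative_eq_intros)
  from vector_diff_chain_at[OF this C_inf_has_vector_derivative[OF loops_C_inf[OF assms]]]
  have "(h has_vector_derivative D_theta h (\<theta> + 2 * pi)) (at \<theta>)"
    by (simp add: o_def loops_periodic[OF assms])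
  then show "D_theta h (\<theta> + 2 * pi) = D_theta h \<theta>" using D_theta_eqI by metis
qed

lemma D_theta_lincomb:
  assumes "C_inf h" and "C_inf k"
  shows "D_theta (\<lambda>\<theta>. h \<theta> + a *\<^sub>R k \<theta>) = (\<lambda>\<theta>. D_theta h \<theta> + a *\<^sub>R D_theta k \<theta>)"
proof
  fix \<theta>
  show "D_theta (\<lambda>\<theta>. h \<theta> + a *\<^sub>R k \<theta>) \<theta> = D_theta h \<theta> + a *\<^sub>R D_theta k \<theta>"
    using assms[THEN C_inf_has_vector_derivative]
    by (intro D_theta_eqI has_vector_derivative_add
        bounded_linear.has_vector_derivative[OF bounded_linear_scaleR_right]) auto
qed

lemma funpow_D_theta_lincomb:
  assumes "C_inf h" and "C_inf k"
  shows "(D_theta ^^ j) (\<lambda>\<theta>. h \<theta> + a *\<^sub>R k \<theta>) = (\<lambda>\<theta>. (D_theta ^^ j) h \<theta> + a *\<^sub>R (D_theta ^^ j) k \<theta>)"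
  by (induction j) (simp_all add: D_theta_lincomb C_inf_funpow_D_theta assms)

lemma D_theta_Imm_nonzero [simp]: "c \<in> Imm \<Longrightarrow> D_theta c \<theta> \<noteq> 0"
  by (simp add: Imm_def)

lemma Imm_loops [simp]: "c \<in> Imm \<Longrightarrow> c \<in> loops"
  unfolding Imm_def by blast

lemma ImmI: "c \<in> loops \<Longrightarrow> (\<And>\<theta>. D_theta c \<theta> \<noteq> 0) \<Longrightarrow> c \<in> Imm"
  unfolding Imm_def by blast

lemma norm_D_theta_loops [simp]:
  assumes "c \<in> Imm"
  shows "(\<lambda>\<theta>. norm (D_theta c \<theta>)) \<in> loops"
proof (rule loopsI)
  show "C_inf (\<lambda>\<theta>. norm (D_theta c \<theta>))"
    using assms by (intro C_inf_norm) (simp_all add: loops_C_inf)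
  show "norm (D_theta c (\<theta> + 2 * pi)) = norm (D_theta c \<theta>)" for \<theta>
    using assms by (simp add: loops_periodic)
qed

lemma D_s_loops [simp]:
  assumes "c \<in> Imm" and "h \<in> loops"
  shows "D_s c h \<in> loops"
proof -
  have "(\<lambda>\<theta>. inverse (norm (D_theta c \<theta>))) \<in> loops"
  proof (rule loopsI)
    show "C_inf (\<lambda>\<theta>. inverse (norm (D_theta c \<theta>)))"
      using assms by (intro C_inf_inverse) (simp_all add: loops_C_inf)
    show "inverse (norm (D_theta c (\<theta> + 2 * pi))) = inverse (norm (D_theta c \<theta>))" for \<theta>
      using assms by (simp add: loops_periodic)
  qed
  then have "(\<lambda>\<theta>. inverse (norm (D_theta c \<theta>)) *\<^sub>R D_theta h \<theta>) \<in> loops"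
    using assms by simp
  moreover have "D_s c h = (\<lambda>\<theta>. inverse (norm (D_theta c \<theta>)) *\<^sub>R D_theta h \<theta>)"
    by (simp add: D_s_def fun_eq_iff inverse_eq_divide)
  ultimately show ?thesis by simp
qed

lemma tcross_loops [simp]:
  assumes "c \<in> Imm" and "h \<in> loops"
  shows "tcross c h \<in> loops"
proof -
  have "tcross c h = (\<lambda>\<theta>. D_s c c \<theta> \<times> h \<theta>)" by (simp add: fun_eq_iff tcross_def)
  then show ?thesis using assms by simp
qed

lemma D_s_self_unit [simp]: "c \<in> Imm \<Longrightarrow> D_s c c \<theta> \<bullet> D_s c c \<theta> = 1"
  by (simp add: D_s_def power2_norm_eq_inner[symmetric] power2_eq_square)

lemma norm_scaleR_D_s: "norm (D_theta c \<theta>) *\<^sub>R D_s c c \<theta> = D_theta c \<theta>"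
  by (cases "D_theta c \<theta> = 0") (simp_all add: D_s_def)

section \<open>The metric\<close>

lemma G_id_integrable:
  assumes "c \<in> Imm" and "h \<in> loops" and "k \<in> loops"
  shows "(\<lambda>\<theta>. (h \<theta> \<bullet> k \<theta>) * norm (D_theta c \<theta>)) integrable_on {0..2 * pi}"
proof -
  have "(\<lambda>\<theta>. (h \<theta> \<bullet> k \<theta>) * norm (D_theta c \<theta>)) \<in> loops"
    using assms by simp
  then show ?thesis
    by (simp add: integrable_continuous_interval C_inf_continuous_on loops_C_inf)
qed

lemma G_id_commute: "G_id c h k = G_id c k h"
  by (simp add: G_id_def inner_commute)

lemma G_id_add_left:
  assumes "c \<in> Imm" "h \<in> loops" "h' \<in> loops" "k \<in> loops"
  shows "G_id c (\<lambda>\<theta>. h \<theta> + h' \<theta>) k = G_id c h k + G_id c h' k"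
  unfolding G_id_def
  by (simp add: inner_add_left distrib_right Henstock_Kurzweil_Integration.integral_add G_id_integrable assms)

lemma G_id_scaleR_left: "G_id c (\<lambda>\<theta>. a *\<^sub>R h \<theta>) k = a * G_id c h k"
  unfolding G_id_def by (simp add: mult.assoc)

lemma G_id_minus_left: "G_id c (\<lambda>\<theta>. - h \<theta>) k = - G_id c h k"
  using G_id_scaleR_left[of c "-1" h k] by simp

lemma G_id_diff_left:
  assumes "c \<in> Imm" "h \<in> loops" "h' \<in> loops" "k \<in> loops"
  shows "G_id c (\<lambda>\<theta>. h \<theta> - h' \<theta>) k = G_id c h k - G_id c h' k"
  using G_id_add_left[of c h "\<lambda>\<theta>. - h' \<theta>" k] assms by (simp add: G_id_minus_left)

lemma G_id_add_right:
  assumes "c \<in> Imm" "h \<in> loops" "k \<in> loops" "k' \<in> loops"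
  shows "G_id c h (\<lambda>\<theta>. k \<theta> + k' \<theta>) = G_id c h k + G_id c h k'"
  using G_id_add_left[of c k k' h] assms by (simp add: G_id_commute)

lemma G_id_scaleR_right: "G_id c h (\<lambda>\<theta>. a *\<^sub>R k \<theta>) = a * G_id c h k"
  using G_id_scaleR_left G_id_commute by metis

lemma G_id_minus_right: "G_id c h (\<lambda>\<theta>. - k \<theta>) = - G_id c h k"
  using G_id_minus_left G_id_commute by metis

lemma G_id_diff_right:
  assumes "c \<in> Imm" "h \<in> loops" "k \<in> loops" "k' \<in> loops"
  shows "G_id c h (\<lambda>\<theta>. k \<theta> - k' \<theta>) = G_id c h k - G_id c h k'"
  using G_id_diff_left[of c k k' h] assms by (simp add: G_id_commute)

lemmas G_id_simps = G_id_add_left G_id_scaleR_left G_id_minus_left G_id_diff_left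
  G_id_add_right G_id_scaleR_right G_id_minus_right G_id_diff_right

lemma G_id_self_eq_0:
  assumes c: "c \<in> Imm" and h: "h \<in> loops" and 0: "G_id c h h = 0"
  shows "h \<theta> = 0"
proof (rule loops_eq_0I[OF h])
  let ?f = "\<lambda>\<theta>. (h \<theta> \<bullet> h \<theta>) * norm (D_theta c \<theta>)"
  have f: "?f \<in> loops" using c h by simp
  fix \<theta> :: real assume \<theta>: "\<theta> \<in> {0..2 * pi}"
  have "(integral {0..2 * pi} ?f = 0) = (\<forall>\<theta>\<in>{0..2 * pi}. ?f \<theta> = 0)"
    by (rule integral_eq_0_iff) (simp_all add: C_inf_continuous_on[OF loops_C_inf[OF f]])
  then show "h \<theta> = 0"
    using 0 \<theta> c by (auto simp: G_id_def)
qed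

lemma G_id_eqI:
  assumes c: "c \<in> Imm" and h: "h \<in> loops" "h' \<in> loops"
    and eq: "\<And>k. k \<in> loops \<Longrightarrow> G_id c h k = G_id c h' k"
  shows "h = h'"
proof
  fix \<theta>
  have d: "(\<lambda>\<theta>. h \<theta> - h' \<theta>) \<in> loops" using h by simp
  have "G_id c (\<lambda>\<theta>. h \<theta> - h' \<theta>) (\<lambda>\<theta>. h \<theta> - h' \<theta>) = 0"
    using eq[OF d] G_id_diff_left[OF c h d] by simp
  from G_id_self_eq_0[OF c d this, of \<theta>] show "h \<theta> = h' \<theta>" by simp
qed

lemma G_id_cong: "(\<And>\<theta>. h \<theta> \<bullet> k \<theta> = h' \<theta> \<bullet> k' \<theta>) \<Longrightarrow> G_id c h k = G_id c h' k'"
  by (simp add: G_id_def)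

section \<open>Smooth paths, functionals and fields\<close>

lemma smooth_pathI:
  assumes "C_inf (\<lambda>p. \<gamma> (fst p) (snd p))" and "\<And>t \<theta>. \<gamma> t (\<theta> + 2 * pi) = \<gamma> t \<theta>"
  shows "smooth_path \<gamma>"
proof -
  have "C_inf (\<gamma> t)" for t
  proof -
    have "C_inf (\<lambda>\<theta>. (t, \<theta>))" by (intro C_inf_intros)
    from C_inf_compose[OF assms(1) this] show ?thesis by simp
  qed
  then show ?thesis
    using assms by (auto simp: smooth_path_def case_prod_unfold intro: loopsI)
qed

lemma smooth_path_C_inf: "smooth_path \<gamma> \<Longrightarrow> C_inf (\<lambda>p. \<gamma> (fst p) (snd p))"
  by (simp add: smooth_path_def case_prod_unfold)

lemma smooth_path_loops: "smooth_path \<gamma> \<Longrightarrow> \<gamma> t \<in> loops"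
  by (simp add: smooth_path_def)

lemma smooth_path_periodic: "smooth_path \<gamma> \<Longrightarrow> \<gamma> t (\<theta> + 2 * pi) = \<gamma> t \<theta>"
  by (simp add: smooth_path_loops loops_periodic)

lemma smooth_path_D_theta:
  assumes "smooth_path \<gamma>"
  shows "smooth_path (\<lambda>t. D_theta (\<gamma> t))"
  using C_inf_partial_snd(1)[OF smooth_path_C_inf[OF assms]]
  by (intro smooth_pathI) (simp_all add: loops_periodic smooth_path_loops[OF assms])

lemma smooth_path_funpow_D_theta:
  "smooth_path \<gamma> \<Longrightarrow> smooth_path (\<lambda>t. (D_theta ^^ j) (\<gamma> t))"
  by (induction j) (simp_all add: smooth_path_D_theta)

lemma C_inf_fst_compose:
  fixes f :: "real \<Rightarrow> 'b::real_normed_vector"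
  shows "C_inf f \<Longrightarrow> C_inf (\<lambda>p::real \<times> real. f (fst p))"
  by (rule C_inf_compose[OF _ C_inf_fst[OF C_inf_ident]])

lemma C_inf_snd_compose:
  fixes f :: "real \<Rightarrow> 'b::real_normed_vector"
  shows "C_inf f \<Longrightarrow> C_inf (\<lambda>p::real \<times> real. f (snd p))"
  by (rule C_inf_compose[OF _ C_inf_snd[OF C_inf_ident]])

lemma smooth_path_const: "c \<in> loops \<Longrightarrow> smooth_path (\<lambda>t. c)"
  by (intro smooth_pathI C_inf_snd_compose) (simp_all add: loops_C_inf loops_periodic)

lemma smooth_path_add:
  "smooth_path \<gamma> \<Longrightarrow> smooth_path \<delta> \<Longrightarrow> smooth_path (\<lambda>t \<theta>. \<gamma> t \<theta> + \<delta> t \<theta>)"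
  by (intro smooth_pathI C_inf_intros) (simp_all add: smooth_path_C_inf smooth_path_periodic)

lemma smooth_path_scaleR:
  "C_inf f \<Longrightarrow> smooth_path \<gamma> \<Longrightarrow> smooth_path (\<lambda>t \<theta>. f t *\<^sub>R \<gamma> t \<theta>)"
  by (intro smooth_pathI C_inf_intros C_inf_fst_compose) (simp_all add: smooth_path_C_inf smooth_path_periodic)

context
  fixes \<gamma> assumes path: "smooth_path \<gamma>" and Imm: "\<And>t. \<gamma> t \<in> Imm"
begin

lemma C_inf_speed: "C_inf (\<lambda>p. norm (D_theta (\<gamma> (fst p)) (snd p)))"
  using smooth_path_C_inf[OF smooth_path_D_theta[OF path]] Imm by (intro C_inf_norm) simp_all

lemma smooth_path_D_s:
  assumes "smooth_path \<delta>"
  shows "smooth_path (\<lambda>t. D_s (\<gamma> t) (\<delta> t))"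
proof (rule smooth_pathI)
  have "C_inf (\<lambda>p. inverse (norm (D_theta (\<gamma> (fst p)) (snd p))) *\<^sub>R D_theta (\<delta> (fst p)) (snd p))"
    using Imm C_inf_speed smooth_path_C_inf[OF smooth_path_D_theta[OF assms]]
    by (intro C_inf_scaleR C_inf_inverse) simp_all
  then show "C_inf (\<lambda>p. D_s (\<gamma> (fst p)) (\<delta> (fst p)) (snd p))"
    by (simp add: D_s_def inverse_eq_divide)
qed (simp add: loops_periodic Imm smooth_path_loops[OF assms])

lemma smooth_path_tcross:
  assumes "smooth_path \<delta>"
  shows "smooth_path (\<lambda>t. tcross (\<gamma> t) (\<delta> t))"
proof (rule smooth_pathI)
  show "C_inf (\<lambda>p. tcross (\<gamma> (fst p)) (\<delta> (fst p)) (snd p))"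
    unfolding tcross_def
    by (intro C_inf_cross smooth_path_C_inf[OF assms] smooth_path_C_inf[OF smooth_path_D_s[OF path]])
qed (simp add: loops_periodic Imm smooth_path_loops[OF assms])

lemma C_inf_G_id:
  assumes "smooth_path \<delta>" and "smooth_path \<eta>"
  shows "C_inf (\<lambda>t. G_id (\<gamma> t) (\<delta> t) (\<eta> t))"
proof -
  have "C_inf (\<lambda>p. (\<delta> (fst p) (snd p) \<bullet> \<eta> (fst p) (snd p)) * norm (D_theta (\<gamma> (fst p)) (snd p)))"
    by (intro C_inf_intros C_inf_speed smooth_path_C_inf assms)
  from C_inf_integral[OF this, of 0 "2 * pi"] show ?thesis
    by (simp add: G_id_def)
qed

end

lemma smooth_functional_const: "smooth_functional U (\<lambda>c. a)"
  by (simp add: smooth_functional_def C_inf_const)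

lemma smooth_functional_subset: "smooth_functional V f \<Longrightarrow> U \<subseteq> V \<Longrightarrow> smooth_functional U f"
  unfolding smooth_functional_def by blast

lemma smooth_functional_add:
  "smooth_functional U f \<Longrightarrow> smooth_functional U g \<Longrightarrow> smooth_functional U (\<lambda>c. f c + g c)"
  by (simp add: smooth_functional_def C_inf_add)

lemma smooth_functional_diff:
  "smooth_functional U f \<Longrightarrow> smooth_functional U g \<Longrightarrow> smooth_functional U (\<lambda>c. f c - g c)"
  by (simp add: smooth_functional_def C_inf_diff)

lemma smooth_functional_minus: "smooth_functional U f \<Longrightarrow> smooth_functional U (\<lambda>c. - f c)"
  by (simp add: smooth_functional_def C_inf_minus)

lemma smooth_functional_mult:
  "smooth_functional U f \<Longrightarrow> smooth_functional U g \<Longrightarrow> smooth_functional U (\<lambda>c. f c * g c)"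
  by (simp add: smooth_functional_def C_inf_mult)

lemma smooth_functional_divide:
  "smooth_functional U f \<Longrightarrow> smooth_functional U g \<Longrightarrow> (\<And>c. c \<in> U \<Longrightarrow> g c \<noteq> 0) \<Longrightarrow>
    smooth_functional U (\<lambda>c. f c / g c)"
  by (simp add: smooth_functional_def C_inf_divide)

lemma smooth_functional_cong:
  "smooth_functional U f \<Longrightarrow> (\<And>c. c \<in> U \<Longrightarrow> f c = g c) \<Longrightarrow> smooth_functional U g"
  by (simp add: smooth_functional_def)

lemma smooth_functional_G_id:
  "U \<subseteq> Imm \<Longrightarrow> smooth_field U X \<Longrightarrow> smooth_field U Y \<Longrightarrow> smooth_functional U (\<lambda>c. G_id c (X c) (Y c))"
  by (auto simp: smooth_functional_def smooth_field_def subset_eq intro!: C_inf_G_id)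

text \<open>That the values are loops is the special case of constant paths.\<close>

lemma smooth_fieldI:
  assumes "U \<subseteq> Imm"
    and "\<And>\<gamma>. smooth_path \<gamma> \<Longrightarrow> (\<And>t. \<gamma> t \<in> U) \<Longrightarrow> smooth_path (\<lambda>t. X (\<gamma> t))"
  shows "smooth_field U X"
  unfolding smooth_field_def
proof (intro conjI ballI allI impI)
  fix c assume "c \<in> U"
  with assms(1) have "c \<in> loops" by auto
  with \<open>c \<in> U\<close> have "smooth_path (\<lambda>t. X c)"
    by (intro assms(2) smooth_path_const)
  then show "X c \<in> loops" by (rule smooth_path_loops)
qed (use assms(2) in blast)

lemma smooth_field_loops: "smooth_field U X \<Longrightarrow> c \<in> U \<Longrightarrow> X c \<in> loops"
  by (simp add: smooth_field_def)

lemma smooth_field_path: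
  "smooth_field U X \<Longrightarrow> smooth_path \<gamma> \<Longrightarrow> (\<And>t. \<gamma> t \<in> U) \<Longrightarrow> smooth_path (\<lambda>t. X (\<gamma> t))"
  by (simp add: smooth_field_def)

lemma smooth_field_subset: "smooth_field V X \<Longrightarrow> U \<subseteq> V \<Longrightarrow> smooth_field U X"
  unfolding smooth_field_def by blast

lemma smooth_field_cong:
  "smooth_field U X \<Longrightarrow> (\<And>c. c \<in> U \<Longrightarrow> X c = Y c) \<Longrightarrow> smooth_field U Y"
  by (simp add: smooth_field_def)

lemma smooth_field_ident: "U \<subseteq> Imm \<Longrightarrow> smooth_field U (\<lambda>c. c)"
  by (rule smooth_fieldI)

lemma smooth_field_add:
  assumes "U \<subseteq> Imm" and "smooth_field U X" and "smooth_field U Y"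
  shows "smooth_field U (\<lambda>c \<theta>. X c \<theta> + Y c \<theta>)"
  by (rule smooth_fieldI[OF assms(1)])
    (rule smooth_path_add[OF smooth_field_path[OF assms(2)] smooth_field_path[OF assms(3)]])

lemma smooth_field_scaleR:
  assumes "U \<subseteq> Imm" and "smooth_functional U f" and "smooth_field U X"
  shows "smooth_field U (\<lambda>c \<theta>. f c *\<^sub>R X c \<theta>)"
proof (rule smooth_fieldI[OF assms(1)])
  fix \<gamma> assume \<gamma>: "smooth_path \<gamma>" "\<And>t. \<gamma> t \<in> U"
  then have "C_inf (\<lambda>t. f (\<gamma> t))" using assms(2) by (simp add: smooth_functional_def)
  then show "smooth_path (\<lambda>t \<theta>. f (\<gamma> t) *\<^sub>R X (\<gamma> t) \<theta>)"
    by (rule smooth_path_scaleR[OF _ smooth_field_path[OF assms(3) \<gamma>]])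
qed

lemma smooth_field_minus:
  "U \<subseteq> Imm \<Longrightarrow> smooth_field U X \<Longrightarrow> smooth_field U (\<lambda>c \<theta>. - X c \<theta>)"
  using smooth_field_scaleR[OF _ smooth_functional_const, of U X "-1"] by simp

lemma smooth_field_diff:
  "U \<subseteq> Imm \<Longrightarrow> smooth_field U X \<Longrightarrow> smooth_field U Y \<Longrightarrow> smooth_field U (\<lambda>c \<theta>. X c \<theta> - Y c \<theta>)"
  using smooth_field_add[OF _ _ smooth_field_minus, of U X Y] by simp

lemma smooth_field_tcross:
  assumes "U \<subseteq> Imm" and "smooth_field U X"
  shows "smooth_field U (\<lambda>c. tcross c (X c))"
proof (rule smooth_fieldI[OF assms(1)])
  fix \<gamma> assume \<gamma>: "smooth_path \<gamma>" "\<And>t. \<gamma> t \<in> U"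
  then have "\<gamma> t \<in> Imm" for t using assms(1) by blast
  from smooth_path_tcross[OF \<gamma>(1) this smooth_field_path[OF assms(2) \<gamma>]]
  show "smooth_path (\<lambda>t. tcross (\<gamma> t) (X (\<gamma> t)))" .
qed

section \<open>The special curve lemma\<close>

text \<open>The classical flat function is the case k = 0. The factor (1/x)^k is included because
  the linear span of the family is then closed under differentiation.\<close>

definition flat :: "nat \<Rightarrow> real \<Rightarrow> real" where
  "flat k x = (if x > 0 then (1 / x) ^ k * exp (- (1 / x)) else 0)"

lemma flat_tendsto_0: "(flat k \<longlongrightarrow> 0) (at 0)"
proof -
  \<comment> \<open>The substitution of 1/x turns the limit at 0 from the right into exponential
    decay beating a power at infinity.\<close>
  have "((\<lambda>x. flat k (inverse x)) \<longlongrightarrow> 0) at_top"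
  proof (rule Lim_transform_eventually[OF tendsto_power_div_exp_0[of k]])
    show "\<forall>\<^sub>F x in at_top. x ^ k / exp x = flat k (inverse x)"
      using eventually_gt_at_top[of "0::real"]
      by eventually_elim (simp add: flat_def exp_minus divide_inverse)
  qed
  then have "(flat k \<longlongrightarrow> 0) (at_right 0)"
    by (simp add: filterlim_at_right_to_top)
  moreover have "(flat k \<longlongrightarrow> 0) (at_left 0)"
  proof (rule Lim_transform_eventually[OF tendsto_const])
    have "\<forall>\<^sub>F x in at_left 0. x < (0::real)" by (simp add: eventually_at_filter)
    then show "\<forall>\<^sub>F x in at_left 0. 0 = flat k x" by eventually_elim (simp add: flat_def)
  qed
  ultimately show ?thesis by (simp add: filterlim_split_at)
qed

lemma flat_has_derivative:
  "(flat k has_real_derivative (flat (k + 2) x - real k * flat (k + 1) x)) (at x)"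
proof -
  consider "x > 0" | "x < 0" | "x = 0" by linarith
  then show ?thesis
  proof cases
    case 1
    have "((\<lambda>x. (1 / x) ^ k * exp (- (1 / x))) has_real_derivative
        (flat (k + 2) x - real k * flat (k + 1) x)) (at x)"
      using 1 by (cases k) (auto intro!: derivative_eq_intros simp: flat_def field_simps power2_eq_square,
          metis One_nat_def gr0I power_eq_if)
    then show ?thesis
      by (rule has_field_derivative_transform_within_open[of _ _ _ "{0<..}"]) (use 1 in \<open>auto simp: flat_def\<close>)
  next
    case 2
    have "((\<lambda>x. 0) has_real_derivative (flat (k + 2) x - real k * flat (k + 1) x)) (at x)"
      using 2 by (simp add: flat_def)
    then show ?thesis
      by (rule has_field_derivative_transform_within_open[of _ _ _ "{..<0}"]) (use 2 in \<open>auto simp: flat_def\<close>)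
  next
    case 3
    \<comment> \<open>At the origin the difference quotient is itself a member of the family, so its
      limit is already known.\<close>
    have "(\<lambda>h. (flat k (0 + h) - flat k 0) / h) = flat (k + 1)"
      by (auto simp: flat_def fun_eq_iff)
    then show ?thesis
      using flat_tendsto_0[of "k + 1"] 3 by (simp add: DERIV_def flat_def)
  qed
qed

lemma Ck_flat: "Ck n (flat k)"
proof (induction n arbitrary: k)
  case 0
  show ?case
    using DERIV_isCont[OF flat_has_derivative] by (simp add: continuous_at_imp_continuous_on)
next
  case (Suc n)
  have "Ck n (\<lambda>x. flat (k + 2) x + (- real k) *\<^sub>R flat (k + 1) x)"
    by (intro Ck_add Suc.IH Ck_linear[OF bounded_linear_scaleR_right])
  then have "Ck n (\<lambda>x. flat (k + 2) x - real k * flat (k + 1) x)" by simp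
  then show ?case
    by (rule Ck_Suc_realI[OF flat_has_derivative[unfolded has_real_derivative_iff_has_vector_derivative]])
qed

text \<open>The factor \<open>exp 1\<close> makes the value at 0 equal to 1, so that the path built
  in \<open>special_curve\<close> hits the given loops exactly.\<close>

definition bump :: "real \<Rightarrow> real" where
  "bump x = exp 1 * flat 0 (1 - x * x)"

lemma C_inf_bump: "C_inf bump"
proof -
  have "C_inf (flat 0)" by (simp add: C_inf_def Ck_flat)
  then have "C_inf (\<lambda>x. flat 0 (1 - x * x))"
    by (rule C_inf_compose) (intro C_inf_intros)
  then have "C_inf (\<lambda>x. exp 1 * flat 0 (1 - x * x))"
    by (intro C_inf_intros)
  then show ?thesis by (simp add: bump_def[abs_def])
qed

lemma bump_0: "bump 0 = 1"
  by (simp add: bump_def flat_def exp_minus)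

lemma bump_nonneg: "bump x \<ge> 0"
  by (simp add: bump_def flat_def)

lemma bump_le_1: "bump x \<le> 1"
proof (cases "1 - x * x > 0")
  case True
  then have "1 / (1 - x * x) \<ge> 1" by (simp add: field_simps)
  then have "exp (1 - 1 / (1 - x * x)) \<le> exp 0" by (subst exp_le_cancel_iff) linarith
  then show ?thesis
    using True by (simp add: bump_def flat_def exp_diff exp_minus divide_inverse)
qed (simp add: bump_def flat_def)

lemma bump_eq_0: "\<bar>x\<bar> \<ge> 1 \<Longrightarrow> bump x = 0"
  using abs_square_less_1[of x] by (auto simp: bump_def flat_def power2_eq_square)

lemma bounded_funpow_D_theta:
  fixes f :: "real \<Rightarrow> 'a::real_normed_vector"
  assumes "C_inf f" and "\<And>x. x \<notin> {a..b} \<Longrightarrow> f x = 0"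
  shows "\<exists>M\<ge>0. \<forall>x. norm ((D_theta ^^ i) f x) \<le> M"
proof -
  have 0: "(D_theta ^^ i) f x = 0" if "x \<notin> {a..b}" for x
    using that
  proof (induction i arbitrary: x)
    case 0
    then show ?case using assms(2) by simp
  next
    case (Suc i)
    have "((\<lambda>x. 0) has_vector_derivative 0) (at x)" by simp
    then have "((D_theta ^^ i) f has_vector_derivative 0) (at x)"
      by (rule has_vector_derivative_transform_within_open[of _ _ _ "- {a..b}"])
        (use Suc in \<open>auto simp: open_Compl\<close>)
    then show ?case by (simp add: D_theta_eqI)
  qed
  have "compact ((D_theta ^^ i) f ` {a..b})"
    by (intro compact_continuous_image C_inf_continuous_on C_inf_funpow_D_theta assms(1)) simp
  then have "bounded ((D_theta ^^ i) f ` {a..b})" by (rule compact_imp_bounded)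
  then obtain M where M: "\<And>x. x \<in> {a..b} \<Longrightarrow> norm ((D_theta ^^ i) f x) \<le> M"
    unfolding bounded_iff ball_simps by blast
  have "norm ((D_theta ^^ i) f x) \<le> max M 0" for x
    using M[of x] 0[of x] by (cases "x \<in> {a..b}") auto
  then show ?thesis by (meson max.cobounded2)
qed

text \<open>All termwise differentiated series converge uniformly by comparison with a geometric
  series, so the series may be differentiated term by term. The sums \<open>S i j\<close> are closed
  under partial differentiation, and smoothness follows by induction on the order for all
  \<open>i\<close> and \<open>j\<close> at once.\<close>

lemma C_inf_series:
  fixes \<psi> :: "nat \<Rightarrow> real \<Rightarrow> real" and e :: "nat \<Rightarrow> real \<Rightarrow> 'a::banach"
  assumes \<psi>: "\<And>k. C_inf (\<psi> k)" and e: "\<And>k. C_inf (e k)"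
    and bound: "\<And>i j k t \<theta>. i \<le> k \<Longrightarrow> j \<le> k \<Longrightarrow>
      norm ((D_theta ^^ i) (\<psi> k) t *\<^sub>R (D_theta ^^ j) (e k) \<theta>) \<le> (1 / 2) ^ k"
  shows "C_inf (\<lambda>p. \<Sum>k. \<psi> k (fst p) *\<^sub>R e k (snd p))"
proof -
  define T where "T i j k p = (D_theta ^^ i) (\<psi> k) (fst p) *\<^sub>R (D_theta ^^ j) (e k) (snd p)" for i j k p
  define S where "S i j p = (\<Sum>k. T i j k p)" for i j p
  have lim: "uniform_limit UNIV (\<lambda>n p. \<Sum>k<n. T i j k p) (S i j) sequentially" for i j
  proof -
    \<comment> \<open>The bound is assumed only for i, j up to k. For fixed i and j this leaves out
      finitely many terms, which the Weierstrass test tolerates.\<close>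
    have "\<forall>\<^sub>F k in sequentially. \<forall>p\<in>UNIV. norm (T i j k p) \<le> (1 / 2) ^ k"
      using eventually_ge_at_top[of "max i j"] by eventually_elim (auto simp: T_def intro!: bound simp del: norm_scaleR)
    from Weierstrass_m_test_ev[OF this] show ?thesis
      by (simp add: S_def[abs_def] summable_geometric)
  qed
  have dT: "(T i j k has_derivative
      (\<lambda>h. fst h *\<^sub>R T (Suc i) j k p + snd h *\<^sub>R T i (Suc j) k p)) (at p)" for i j k p
  proof -
    have "((\<lambda>p. (D_theta ^^ i) (\<psi> k) (fst p)) has_derivative
        (\<lambda>h. fst h *\<^sub>R D_theta ((D_theta ^^ i) (\<psi> k)) (fst p))) (at p)"
      by (rule has_derivative_compose[OF bounded_linear_imp_has_derivative[OF bounded_linear_fst]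
            C_inf_has_vector_derivative[OF C_inf_funpow_D_theta[OF \<psi>], unfolded has_vector_derivative_def]])
    moreover have "((\<lambda>p. (D_theta ^^ j) (e k) (snd p)) has_derivative
        (\<lambda>h. snd h *\<^sub>R D_theta ((D_theta ^^ j) (e k)) (snd p))) (at p)"
      by (rule has_derivative_compose[OF bounded_linear_imp_has_derivative[OF bounded_linear_snd]
            C_inf_has_vector_derivative[OF C_inf_funpow_D_theta[OF e], unfolded has_vector_derivative_def]])
    ultimately show ?thesis
      unfolding T_def[abs_def] by (rule has_derivative_eq_rhs[OF has_derivative_scaleR])
        (simp add: fun_eq_iff algebra_simps)
  qed
  have dS: "(S i j has_derivative
      (\<lambda>h. fst h *\<^sub>R S (Suc i) j p + snd h *\<^sub>R S i (Suc j) p)) (at p)" for i j p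
  proof -
    have sums: "(\<lambda>k. T i j k p) sums S i j p" for i j p
      using tendsto_uniform_limitI[OF lim, of p] by (simp add: sums_def)
    have "\<exists>g. \<forall>x\<in>UNIV. (\<lambda>n. T i j n x) sums g x \<and>
        (g has_derivative (\<lambda>h. fst h *\<^sub>R S (Suc i) j x + snd h *\<^sub>R S i (Suc j) x)) (at x within UNIV)"
    proof (rule has_derivative_series[OF convex_UNIV _ _ UNIV_I sums])
      show "(T i j k has_derivative (\<lambda>h. fst h *\<^sub>R T (Suc i) j k x + snd h *\<^sub>R T i (Suc j) k x))
          (at x within UNIV)" for k x
        using dT by simp
      fix \<epsilon> :: real assume \<epsilon>: "\<epsilon> > 0"
      have "\<forall>\<^sub>F n in sequentially. \<forall>x\<in>UNIV. dist (\<Sum>k<n. T (Suc i) j k x) (S (Suc i) j x) < \<epsilon> / 2"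
        and "\<forall>\<^sub>F n in sequentially. \<forall>x\<in>UNIV. dist (\<Sum>k<n. T i (Suc j) k x) (S i (Suc j) x) < \<epsilon> / 2"
        using uniform_limitD[OF lim half_gt_zero[OF \<epsilon>]] by blast+
      then show "\<forall>\<^sub>F n in sequentially. \<forall>x\<in>UNIV. \<forall>h.
          norm ((\<Sum>k<n. fst h *\<^sub>R T (Suc i) j k x + snd h *\<^sub>R T i (Suc j) k x)
            - (fst h *\<^sub>R S (Suc i) j x + snd h *\<^sub>R S i (Suc j) x)) \<le> \<epsilon> * norm h"
      proof eventually_elim
        case (elim n)
        show ?case
        proof (intro ballI allI)
          fix x :: "real \<times> real" and h :: "real \<times> real"
          let ?A = "(\<Sum>k<n. T (Suc i) j k x) - S (Suc i) j x"
          let ?B = "(\<Sum>k<n. T i (Suc j) k x) - S i (Suc j) x"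
          have "(\<Sum>k<n. fst h *\<^sub>R T (Suc i) j k x + snd h *\<^sub>R T i (Suc j) k x)
              - (fst h *\<^sub>R S (Suc i) j x + snd h *\<^sub>R S i (Suc j) x) = fst h *\<^sub>R ?A + snd h *\<^sub>R ?B"
            by (simp add: sum.distrib scaleR_sum_right algebra_simps)
          also have "norm \<dots> \<le> \<bar>fst h\<bar> * norm ?A + \<bar>snd h\<bar> * norm ?B"
            by (metis norm_triangle_ineq norm_scaleR)
          also have "\<dots> \<le> norm h * (\<epsilon> / 2) + norm h * (\<epsilon> / 2)"
            using elim[THEN bspec[of _ _ x]] norm_fst_le[of "fst h" "snd h"] norm_snd_le[of "snd h" "fst h"]
            by (intro add_mono mult_mono) (auto simp: dist_norm less_imp_le)
          finally show "norm ((\<Sum>k<n. fst h *\<^sub>R T (Suc i) j k x + snd h *\<^sub>R T i (Suc j) k x)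
            - (fst h *\<^sub>R S (Suc i) j x + snd h *\<^sub>R S i (Suc j) x)) \<le> \<epsilon> * norm h" by (simp add: algebra_simps)
        qed
      qed
    qed
    then obtain g where g: "\<And>x. (\<lambda>n. T i j n x) sums g x"
      "\<And>x. (g has_derivative (\<lambda>h. fst h *\<^sub>R S (Suc i) j x + snd h *\<^sub>R S i (Suc j) x)) (at x)"
      by auto
    have "g = S i j" using sums_unique2[OF g(1) sums] by blast
    with g(2) show ?thesis by simp
  qed
  have "Ck n (S i j)" for n i j
  proof (induction n arbitrary: i j)
    case 0
    show ?case using has_derivative_continuous[OF dS] by (simp add: continuous_at_imp_continuous_on)
  next
    case (Suc n)
    show ?case
      by (intro Ck_SucI[OF dS] Ck_add Ck_linear[OF bounded_linear_scaleR_right] Suc.IH)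
  qed
  then have "C_inf (S 0 0)" by (simp add: C_inf_def)
  then show ?thesis by (simp add: S_def[abs_def] T_def)
qed

definition loop_tendsto :: "(nat \<Rightarrow> curve) \<Rightarrow> curve \<Rightarrow> bool" where
  "loop_tendsto d c \<longleftrightarrow> (\<forall>j. \<forall>\<epsilon>>0. \<forall>\<^sub>F n in sequentially. \<forall>\<theta>.
     norm ((D_theta ^^ j) (d n) \<theta> - (D_theta ^^ j) c \<theta>) < \<epsilon>)"

text \<open>The path is c plus a sum of bumps in time, the k-th one concentrated near 2^-k and
  multiplied by the small loop \<open>d (r k) - c\<close>. Squeezing a bump makes its time
  derivatives large; passing to a subsequence \<open>r\<close> makes the loops small enough to
  compensate. Disjoint supports leave at most one term at each time, and bump values in [0, 1] keep
  the path in a neighbourhood of c inside V.\<close>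

lemma special_curve:
  assumes V: "loop_open V" and c: "c \<in> V" and d: "\<And>n. d n \<in> loops" and lim: "loop_tendsto d c"
  obtains \<gamma> r where "smooth_path \<gamma>" and "\<And>t. \<gamma> t \<in> V" and "\<gamma> 0 = c"
    and "\<And>k. r k \<ge> k" and "\<And>k. \<gamma> ((1 / 2) ^ k) = d (r k)"
proof -
  \<comment> \<open>The factor 4 confines 2^k t to the interval (3/4, 5/4). Passing to a larger k at
    least doubles this number, to more than 3/2, so different bumps have disjoint supports.\<close>
  define \<psi> :: "nat \<Rightarrow> real \<Rightarrow> real" where "\<psi> k t = bump (4 * (2 ^ k * t - 1))" for k t
  define e where "e m \<theta> = d m \<theta> - c \<theta>" for m \<theta>
  have cl: "c \<in> loops" using V c by (auto simp: loop_open_def)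
  have el: "e m \<in> loops" for m using d cl by (simp add: e_def[abs_def])
  have De: "(D_theta ^^ j) (e m) = (\<lambda>\<theta>. (D_theta ^^ j) (d m) \<theta> - (D_theta ^^ j) c \<theta>)" for j m
    using funpow_D_theta_lincomb[OF loops_C_inf[OF d] loops_C_inf[OF cl], of j m "-1"]
    by (simp add: e_def[abs_def])
  have C\<psi>: "C_inf (\<psi> k)" for k
    unfolding \<psi>_def[abs_def] by (rule C_inf_compose[OF C_inf_bump]) (intro C_inf_intros)
  have supp: "3 / 4 < 2 ^ k * t \<and> 2 ^ k * t < 5 / 4" if "\<psi> k t \<noteq> 0" for k t
    using that bump_eq_0[of "4 * (2 ^ k * t - 1)"] by (force simp: \<psi>_def)
  have mult: "i = k" if "\<psi> i t \<noteq> 0" "\<psi> k t \<noteq> 0" for i k t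
  proof -
    have *: "\<not> i < k" if "\<psi> i t \<noteq> 0" "\<psi> k t \<noteq> 0" for i k
    proof
      assume "i < k"
      then have "(2::real) ^ k = 2 ^ i * 2 ^ (k - i)" by (simp flip: power_add)
      moreover have "(2::real) \<le> 2 ^ (k - i)" using \<open>i < k\<close> self_le_power[of "2::real" "k - i"] by simp
      moreover have "2 ^ i * t > 0" using supp[OF that(1)] by linarith
      ultimately have "2 ^ k * t \<ge> 2 * (2 ^ i * t)"
        using mult_right_mono[of 2 "2 ^ (k - i)" "2 ^ i * t"] by (simp add: mult_ac)
      then show False using supp[OF that(1)] supp[OF that(2)] by linarith
    qed
    show ?thesis using *[OF that] *[OF that(2,1)] by linarith
  qed
  have "\<exists>M\<ge>0. \<forall>x. norm ((D_theta ^^ i) (\<psi> k) x) \<le> M" for i k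
  proof (rule bounded_funpow_D_theta[OF C\<psi>])
    fix t :: real assume t: "t \<notin> {0..2}"
    show "\<psi> k t = 0"
    proof (rule ccontr)
      assume "\<psi> k t \<noteq> 0"
      note s = supp[OF this]
      have "t > 0" using s zero_less_mult_pos[of "2 ^ k" t] by simp
      moreover have "1 * t \<le> 2 ^ k * t" using \<open>t > 0\<close> by (intro mult_right_mono) simp_all
      ultimately show False using s t unfolding atLeastAtMost_iff by linarith
    qed
  qed
  then obtain M where M0: "\<And>i k. M i k \<ge> 0" and M: "\<And>i k x. norm ((D_theta ^^ i) (\<psi> k) x) \<le> M i k"
    by metis
  obtain n0 \<epsilon>0 where \<epsilon>0: "\<epsilon>0 > 0" and V': "\<And>b. b \<in> loops \<Longrightarrow>
      (\<forall>j\<le>n0. \<forall>\<theta>. norm ((D_theta ^^ j) b \<theta> - (D_theta ^^ j) c \<theta>) < \<epsilon>0) \<Longrightarrow> b \<in> V"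
    using V c unfolding loop_open_def by blast
  \<comment> \<open>Choice of \<open>r k\<close>: beyond k, small against the derivative bounds
    \<open>M i k\<close> of the k-th bump up to order k, and inside the neighbourhood of c contained
    in V. Each of these holds for all large m, and there are only finitely many of them.\<close>
  have "\<exists>m\<ge>k. (\<forall>i\<le>k. \<forall>j\<le>k. \<forall>\<theta>. M i k * norm ((D_theta ^^ j) (e m) \<theta>) \<le> (1 / 2) ^ k) \<and>
      (\<forall>j\<le>n0. \<forall>\<theta>. norm ((D_theta ^^ j) (e m) \<theta>) < \<epsilon>0)" for k
  proof -
    have 1: "\<forall>\<^sub>F m in sequentially. \<forall>\<theta>. M i k * norm ((D_theta ^^ j) (e m) \<theta>) \<le> (1 / 2) ^ k" for i j
    proof -
      have "(1 / 2) ^ k / (M i k + 1) > 0" using M0[of i k] by simp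
      with lim have "\<forall>\<^sub>F m in sequentially. \<forall>\<theta>. norm ((D_theta ^^ j) (e m) \<theta>) < (1 / 2) ^ k / (M i k + 1)"
        unfolding loop_tendsto_def De by blast
      then show ?thesis
      proof eventually_elim
        case (elim m)
        show ?case
        proof
          fix \<theta>
          have "M i k * norm ((D_theta ^^ j) (e m) \<theta>) \<le> (M i k + 1) * ((1 / 2) ^ k / (M i k + 1))"
            using elim M0[of i k] by (intro mult_mono) (auto intro: less_imp_le)
          then show "M i k * norm ((D_theta ^^ j) (e m) \<theta>) \<le> (1 / 2) ^ k"
            using M0[of i k] by simp
        qed
      qed
    qed
    have 2: "\<forall>\<^sub>F m in sequentially. \<forall>\<theta>. norm ((D_theta ^^ j) (e m) \<theta>) < \<epsilon>0" for j
      using lim \<epsilon>0 unfolding loop_tendsto_def De by blast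
    have "\<forall>\<^sub>F m in sequentially. m \<ge> k \<and>
      (\<forall>i\<in>{..k}. \<forall>j\<in>{..k}. \<forall>\<theta>. M i k * norm ((D_theta ^^ j) (e m) \<theta>) \<le> (1 / 2) ^ k) \<and>
      (\<forall>j\<in>{..n0}. \<forall>\<theta>. norm ((D_theta ^^ j) (e m) \<theta>) < \<epsilon>0)"
      by (intro eventually_conj eventually_ge_at_top eventually_ball_finite ballI 1 2) auto
    then show ?thesis
      unfolding eventually_sequentially by (meson atMost_iff order_refl)
  qed
  then obtain r where r: "\<And>k. r k \<ge> k"
    "\<And>i j k \<theta>. i \<le> k \<Longrightarrow> j \<le> k \<Longrightarrow> M i k * norm ((D_theta ^^ j) (e (r k)) \<theta>) \<le> (1 / 2) ^ k"
    "\<And>j k \<theta>. j \<le> n0 \<Longrightarrow> norm ((D_theta ^^ j) (e (r k)) \<theta>) < \<epsilon>0"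
    by metis
  define \<gamma> where "\<gamma> t \<theta> = c \<theta> + (\<Sum>k. \<psi> k t *\<^sub>R e (r k) \<theta>)" for t \<theta>
  have \<gamma>_single: "\<gamma> t \<theta> = c \<theta> + \<psi> k t *\<^sub>R e (r k) \<theta>" if "\<And>i. i \<noteq> k \<Longrightarrow> \<psi> i t = 0" for t k \<theta>
    using suminf_finite[of "{k}" "\<lambda>k. \<psi> k t *\<^sub>R e (r k) \<theta>"] that by (simp add: \<gamma>_def)
  have \<gamma>: "\<exists>k. \<forall>i. i \<noteq> k \<longrightarrow> \<psi> i t = 0" for t
    using mult by metis
  show thesis
  proof
    have "C_inf (\<lambda>p. \<Sum>k. \<psi> k (fst p) *\<^sub>R e (r k) (snd p))"
    proof (rule C_inf_series[OF C\<psi> loops_C_inf[OF el]])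
      fix i j k :: nat and t \<theta> :: real assume "i \<le> k" "j \<le> k"
      have "norm ((D_theta ^^ i) (\<psi> k) t *\<^sub>R (D_theta ^^ j) (e (r k)) \<theta>) \<le> M i k * norm ((D_theta ^^ j) (e (r k)) \<theta>)"
        using M[of i k t] by (simp add: mult_right_mono)
      also have "\<dots> \<le> (1 / 2) ^ k" using r(2) \<open>i \<le> k\<close> \<open>j \<le> k\<close> .
      finally show "norm ((D_theta ^^ i) (\<psi> k) t *\<^sub>R (D_theta ^^ j) (e (r k)) \<theta>) \<le> (1 / 2) ^ k" .
    qed
    then show path: "smooth_path \<gamma>"
      unfolding \<gamma>_def[abs_def] using cl el
      by (intro smooth_pathI C_inf_add C_inf_snd_compose loops_C_inf) (simp_all add: loops_periodic)
    show "\<gamma> t \<in> V" for t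
    proof (rule V'[OF smooth_path_loops[OF path]], intro allI impI)
      fix j \<theta> assume j: "j \<le> n0"
      obtain k where "\<And>i. i \<noteq> k \<Longrightarrow> \<psi> i t = 0" using \<gamma> by blast
      then have "\<gamma> t = (\<lambda>\<theta>. c \<theta> + \<psi> k t *\<^sub>R e (r k) \<theta>)" using \<gamma>_single by blast
      then have "norm ((D_theta ^^ j) (\<gamma> t) \<theta> - (D_theta ^^ j) c \<theta>) = \<bar>\<psi> k t\<bar> * norm ((D_theta ^^ j) (e (r k)) \<theta>)"
        by (simp add: funpow_D_theta_lincomb loops_C_inf cl el)
      also have "\<dots> \<le> 1 * norm ((D_theta ^^ j) (e (r k)) \<theta>)"
        by (intro mult_right_mono) (simp_all add: \<psi>_def bump_nonneg bump_le_1)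
      also have "\<dots> < \<epsilon>0" using r(3)[OF j] by simp
      finally show "norm ((D_theta ^^ j) (\<gamma> t) \<theta> - (D_theta ^^ j) c \<theta>) < \<epsilon>0" .
    qed
    show "\<gamma> 0 = c"
      by (simp add: fun_eq_iff \<gamma>_def \<psi>_def bump_eq_0)
    show "r k \<ge> k" for k by (rule r(1))
    show "\<gamma> ((1 / 2) ^ k) = d (r k)" for k
    proof
      fix \<theta>
      have 1: "\<psi> k ((1 / 2) ^ k) = 1" by (simp add: \<psi>_def bump_0 flip: power_mult_distrib)
      then have "\<And>i. i \<noteq> k \<Longrightarrow> \<psi> i ((1 / 2) ^ k) = 0" using mult[of _ "(1 / 2) ^ k" k] by auto
      from \<gamma>_single[OF this] 1 show "\<gamma> ((1 / 2) ^ k) \<theta> = d (r k) \<theta>" by (simp add: e_def)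
    qed
  qed
qed

section \<open>Derivatives of functionals\<close>

lemma loops_bounded:
  assumes "h \<in> loops"
  obtains B where "B > 0" and "\<And>\<theta>. norm (h \<theta>) \<le> B"
proof -
  have "bounded (h ` {0..2 * pi})"
    by (intro compact_imp_bounded compact_continuous_image C_inf_continuous_on loops_C_inf assms) simp
  then obtain B where B: "B > 0" "\<And>\<theta>. \<theta> \<in> {0..2 * pi} \<Longrightarrow> norm (h \<theta>) \<le> B"
    unfolding bounded_pos ball_simps by blast
  have "norm (h \<theta>) \<le> B" for \<theta>
    using periodic_representative[of h \<theta>, OF loops_periodic[OF assms]] B(2) by metis
  with B(1) show thesis by (rule that)
qed

lemma Imm_speed_bounded_below:
  assumes "c \<in> Imm"
  obtains m where "m > 0" and "\<And>\<theta>. m \<le> norm (D_theta c \<theta>)"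
proof -
  have "\<exists>x\<in>{0..2 * pi}. \<forall>y\<in>{0..2 * pi}. norm (D_theta c x) \<le> norm (D_theta c y)"
    by (rule continuous_attains_inf)
      (use assms in \<open>simp_all add: C_inf_continuous_on loops_C_inf\<close>)
  then obtain x where x: "\<And>y. y \<in> {0..2 * pi} \<Longrightarrow> norm (D_theta c x) \<le> norm (D_theta c y)"
    by blast
  show thesis
  proof
    show "norm (D_theta c x) > 0" using assms by simp
    show "norm (D_theta c x) \<le> norm (D_theta c \<theta>)" for \<theta>
      using periodic_representative[of "D_theta c" \<theta>, OF loops_periodic] assms x
      by (metis D_theta_loops Imm_loops)
  qed
qed

lemma loop_open_Imm: "loop_open Imm"
  unfolding loop_open_def
proof (intro conjI ballI)
  show "Imm \<subseteq> loops" using Imm_loops by blast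
  fix c assume "c \<in> Imm"
  then obtain m where m: "m > 0" "\<And>\<theta>. m \<le> norm (D_theta c \<theta>)"
    by (rule Imm_speed_bounded_below) blast
  show "\<exists>n. \<exists>\<epsilon>>0. \<forall>d\<in>loops.
      (\<forall>j\<le>n. \<forall>\<theta>. norm ((D_theta ^^ j) d \<theta> - (D_theta ^^ j) c \<theta>) < \<epsilon>) \<longrightarrow> d \<in> Imm"
  proof (intro exI conjI ballI impI)
    show "m > 0" by (rule m)
    fix d assume d: "d \<in> loops"
      "\<forall>j\<le>1. \<forall>\<theta>. norm ((D_theta ^^ j) d \<theta> - (D_theta ^^ j) c \<theta>) < m"
    have "D_theta d \<theta> \<noteq> 0" for \<theta>
    proof
      assume "D_theta d \<theta> = 0"
      then have "norm (D_theta c \<theta>) < m" using d(2)[rule_format, of 1 \<theta>] by simp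
      then show False using m(2)[of \<theta>] by simp
    qed
    then show "d \<in> Imm" using d(1) by (rule ImmI[rotated])
  qed
qed

lemma Imm_line:
  assumes c: "c \<in> Imm" and h: "h \<in> loops"
  obtains \<epsilon> where "\<epsilon> > 0" and "\<And>t. \<bar>t\<bar> \<le> \<epsilon> \<Longrightarrow> (\<lambda>\<theta>. c \<theta> + t *\<^sub>R h \<theta>) \<in> Imm"
proof -
  obtain m where m: "m > 0" "\<And>\<theta>. m \<le> norm (D_theta c \<theta>)"
    using Imm_speed_bounded_below[OF c] by blast
  obtain B where B: "B > 0" "\<And>\<theta>. norm (D_theta h \<theta>) \<le> B"
    using loops_bounded[OF D_theta_loops[OF h]] by blast
  show thesis
  proof
    \<comment> \<open>For such t the perturbation changes the velocity by at most m/2, half of the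
      minimal speed.\<close>
    show "m / (2 * B) > 0" using m B by simp
    fix t assume t: "\<bar>t\<bar> \<le> m / (2 * B)"
    have "D_theta c \<theta> + t *\<^sub>R D_theta h \<theta> \<noteq> 0" for \<theta>
    proof
      assume "D_theta c \<theta> + t *\<^sub>R D_theta h \<theta> = 0"
      then have "norm (D_theta c \<theta>) = norm (t *\<^sub>R D_theta h \<theta>)"
        by (metis add.inverse_unique norm_minus_cancel)
      also have "\<dots> \<le> m / (2 * B) * B"
        unfolding norm_scaleR using t B m(1) by (intro mult_mono) auto
      also have "\<dots> < m" using B m by simp
      finally show False using m(2)[of \<theta>] by simp
    qed
    moreover have "(\<lambda>\<theta>. c \<theta> + t *\<^sub>R h \<theta>) \<in> loops" using c h by simp
    ultimately show "(\<lambda>\<theta>. c \<theta> + t *\<^sub>R h \<theta>) \<in> Imm"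
      using c h by (intro ImmI) (simp_all add: D_theta_lincomb loops_C_inf)
  qed
qed

lemma C_inf_sin: "C_inf (sin :: real \<Rightarrow> real)"
proof -
  have "Ck n (sin :: real \<Rightarrow> real) \<and> Ck n (cos :: real \<Rightarrow> real)" for n
  proof (induction n)
    case 0
    show ?case by (simp add: continuous_on_sin continuous_on_cos)
  next
    case (Suc n)
    have "Ck n (\<lambda>x::real. - sin x)"
      using Suc by (intro Ck_linear[OF bounded_linear_minus[OF bounded_linear_ident]]) simp
    moreover have "(sin has_vector_derivative cos x) (at x)" "(cos has_vector_derivative - sin x) (at x)" for x :: real
      by (simp_all flip: has_real_derivative_iff_has_vector_derivative add: DERIV_sin DERIV_cos)
    ultimately show ?case
      using Suc Ck_Suc_realI[of sin cos] Ck_Suc_realI[of cos "\<lambda>x. - sin x"] by blast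
  qed
  then show ?thesis by (simp add: C_inf_def)
qed

text \<open>Smoothness only concerns paths that stay in \<open>Imm\<close> for all times, hence the
  reparametrization of the line by the sine.\<close>

lemma smooth_functional_has_derivative_0:
  assumes f: "smooth_functional Imm f" and c: "c \<in> Imm" and h: "h \<in> loops"
  shows "((\<lambda>t. f (\<lambda>\<theta>. c \<theta> + t *\<^sub>R h \<theta>)) has_real_derivative dir_deriv f c h) (at 0)"
proof -
  obtain \<epsilon> where \<epsilon>: "\<epsilon> > 0" "\<And>t. \<bar>t\<bar> \<le> \<epsilon> \<Longrightarrow> (\<lambda>\<theta>. c \<theta> + t *\<^sub>R h \<theta>) \<in> Imm"
    using Imm_line[OF c h] by blast
  define \<gamma> where "\<gamma> t \<theta> = c \<theta> + (\<epsilon> * sin t) *\<^sub>R h \<theta>" for t \<theta>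
  have "smooth_path \<gamma>"
    unfolding \<gamma>_def[abs_def] using c h
    by (intro smooth_path_add smooth_path_const smooth_path_scaleR C_inf_mult C_inf_const C_inf_sin) simp_all
  moreover have "\<gamma> t \<in> Imm" for t
    unfolding \<gamma>_def[abs_def] using \<epsilon>(1) by (intro \<epsilon>(2)) (simp add: abs_mult mult_left_le)
  ultimately have "C_inf (\<lambda>t. f (\<gamma> t))"
    using f by (simp add: smooth_functional_def)
  from C_inf_has_vector_derivative[OF this, of "arcsin (0 / \<epsilon>)"]
  have d: "((\<lambda>t. f (\<gamma> t)) has_real_derivative D_theta (\<lambda>t. f (\<gamma> t)) 0) (at (arcsin (0 / \<epsilon>)))"
    by (simp add: has_real_derivative_iff_has_vector_derivative)
  \<comment> \<open>This inverts the time change \<epsilon> sin t near 0, so the derivative along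
    \<gamma> becomes the derivative along the straight line.\<close>
  have "((\<lambda>t. arcsin (t / \<epsilon>)) has_real_derivative 1 / \<epsilon>) (at 0)"
    using \<epsilon>(1) by (auto intro!: derivative_eq_intros)
  from DERIV_chain2[OF d this]
  have "((\<lambda>t. f (\<gamma> (arcsin (t / \<epsilon>)))) has_real_derivative D_theta (\<lambda>t. f (\<gamma> t)) 0 * (1 / \<epsilon>)) (at 0)" .
  then have "((\<lambda>t. f (\<lambda>\<theta>. c \<theta> + t *\<^sub>R h \<theta>)) has_real_derivative D_theta (\<lambda>t. f (\<gamma> t)) 0 * (1 / \<epsilon>)) (at 0)"
    by (rule has_field_derivative_transform_within_open[of _ _ _ "{- \<epsilon><..<\<epsilon>}"])
      (use \<epsilon>(1) in \<open>auto simp: \<gamma>_def[abs_def] field_simps\<close>)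
  then show ?thesis
    unfolding dir_deriv_def by (simp add: DERIV_imp_deriv)
qed

lemma smooth_functional_has_derivative:
  assumes f: "smooth_functional Imm f" and c: "(\<lambda>\<theta>. c \<theta> + s *\<^sub>R h \<theta>) \<in> Imm" and h: "h \<in> loops"
  shows "((\<lambda>t. f (\<lambda>\<theta>. c \<theta> + t *\<^sub>R h \<theta>)) has_real_derivative
    dir_deriv f (\<lambda>\<theta>. c \<theta> + s *\<^sub>R h \<theta>) h) (at s)"
proof -
  have "((\<lambda>t. f (\<lambda>\<theta>. c \<theta> + (t + s) *\<^sub>R h \<theta>)) has_real_derivative
      dir_deriv f (\<lambda>\<theta>. c \<theta> + s *\<^sub>R h \<theta>) h) (at 0)"
    using smooth_functional_has_derivative_0[OF f c h] by (simp add: scaleR_add_left add_ac)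
  then show ?thesis
    using DERIV_shift[of "\<lambda>t. f (\<lambda>\<theta>. c \<theta> + t *\<^sub>R h \<theta>)" _ 0 s] by simp
qed

section \<open>Functionals that are constant along a smooth path\<close>

lemma smooth_path_tendsto:
  assumes \<gamma>: "smooth_path \<gamma>" and "\<epsilon> > 0"
  obtains \<delta> where "\<delta> > 0"
    and "\<And>t \<theta>. \<bar>t\<bar> < \<delta> \<Longrightarrow> norm ((D_theta ^^ j) (\<gamma> t) \<theta> - (D_theta ^^ j) (\<gamma> 0) \<theta>) < \<epsilon>"
proof -
  let ?g = "\<lambda>p. (D_theta ^^ j) (\<gamma> (fst p)) (snd p)"
  \<comment> \<open>Joint smoothness gives uniform continuity on a compact rectangle, and
    periodicity extends the estimate to all \<theta>.\<close>
  have "uniformly_continuous_on (SIGMA t:{-1..1}. {0..2 * pi}) ?g"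
    by (intro compact_uniformly_continuous C_inf_continuous_on smooth_path_C_inf
        smooth_path_funpow_D_theta \<gamma> compact_Times) simp_all
  then obtain \<delta> where \<delta>: "\<delta> > 0" "\<And>p q. p \<in> (SIGMA t:{-1..1}. {0..2 * pi}) \<Longrightarrow>
      q \<in> (SIGMA t:{-1..1}. {0..2 * pi}) \<Longrightarrow> dist p q < \<delta> \<Longrightarrow> dist (?g p) (?g q) < \<epsilon>"
    using \<open>\<epsilon> > 0\<close> unfolding uniformly_continuous_on_def by metis
  show thesis
  proof
    show "min \<delta> 1 > 0" using \<delta>(1) by simp
    fix t \<theta> :: real assume t: "\<bar>t\<bar> < min \<delta> 1"
    let ?f = "\<lambda>\<theta>. norm ((D_theta ^^ j) (\<gamma> t) \<theta> - (D_theta ^^ j) (\<gamma> 0) \<theta>)"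
    obtain \<theta>' where \<theta>': "\<theta>' \<in> {0..2 * pi}" "?f \<theta> = ?f \<theta>'"
      using periodic_representative[of ?f \<theta>] smooth_path_periodic[OF smooth_path_funpow_D_theta[OF \<gamma>]]
      by metis
    have "dist (?g (t, \<theta>')) (?g (0, \<theta>')) < \<epsilon>"
      using t \<theta>'(1) by (intro \<delta>(2)) (auto simp: dist_Pair_Pair)
    then show "?f \<theta> < \<epsilon>" using \<theta>'(2) by (simp add: dist_norm)
  qed
qed

text \<open>The chain rule is not immediate, as smoothness is only tested on paths: the mean value theorem
  on the segments from \<open>\<gamma> 0\<close> to \<open>\<gamma> t\<close> gives zeros \<open>c\<^sub>n \<rightarrow> \<gamma> 0\<close> of a difference quotient, and by
  \<open>special_curve\<close> a subsequence of them lies on a smooth path, along which the gradient is continuous.\<close>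

lemma grad_constant_along_path:
  assumes f: "smooth_functional Imm f" and g: "is_grad f g"
    and \<gamma>: "smooth_path \<gamma>" "\<gamma> 0 \<in> Imm"
    and \<epsilon>: "\<epsilon> > 0" "\<And>t. \<bar>t\<bar> < \<epsilon> \<Longrightarrow> f (\<gamma> t) = f (\<gamma> 0)"
  shows "G_id (\<gamma> 0) (g (\<gamma> 0)) (\<lambda>\<theta>. D_theta (\<lambda>t. \<gamma> t \<theta>) 0) = 0"
proof -
  define c where "c = \<gamma> 0"
  define p where "p t \<theta> = \<gamma> t \<theta> - c \<theta>" for t \<theta>
  define \<gamma>' where "\<gamma>' q = D_theta (\<lambda>t. \<gamma> t (snd q)) (fst q)" for q
  \<comment> \<open>Hadamard's quotient: p t = t Q t, but \<open>Q\<close> is continuous also at t =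
    0, where it is the velocity of \<gamma>.\<close>
  define Q where "Q t \<theta> = integral {0..1} (\<lambda>u. \<gamma>' (u * t, \<theta>))" for t \<theta>
  have cI: "c \<in> Imm" using \<gamma>(2) by (simp add: c_def)
  have pl: "p t \<in> loops" for t
    using cI smooth_path_loops[OF \<gamma>(1)] by (simp add: p_def[abs_def])
  have cont\<gamma>': "continuous_on A \<gamma>'" for A
    using C_inf_partial_fst(1)[OF smooth_path_C_inf[OF \<gamma>(1)]]
    unfolding \<gamma>'_def[abs_def] by (simp add: C_inf_continuous_on)
  have pQ: "p t \<theta> = t *\<^sub>R Q t \<theta>" for t \<theta>
  proof -
    have "((\<lambda>u. \<gamma> (u * t) \<theta>) has_vector_derivative t *\<^sub>R \<gamma>' (u * t, \<theta>)) (at u within {0..1})" for u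
    proof -
      have "((\<lambda>u. u * t) has_vector_derivative t) (at u)" by (auto intro!: derivative_eq_intros)
      from vector_diff_chain_at[OF this, of "\<lambda>s. \<gamma> s \<theta>"]
      show ?thesis
        using C_inf_partial_fst(2)[OF smooth_path_C_inf[OF \<gamma>(1)], of \<theta> "u * t"]
        by (simp add: \<gamma>'_def o_def has_vector_derivative_at_within)
    qed
    then have "((\<lambda>u. t *\<^sub>R \<gamma>' (u * t, \<theta>)) has_integral \<gamma> (1 * t) \<theta> - \<gamma> (0 * t) \<theta>) {0..1}"
      by (intro fundamental_theorem_of_calculus) simp_all
    from integral_unique[OF this] show ?thesis
      by (simp add: p_def c_def Q_def)
  qed
  have contQ: "continuous_on UNIV (\<lambda>q. Q (fst q) (snd q))"
  proof -
    have "continuous_on (SIGMA q:UNIV. cbox 0 1) (\<lambda>(q, u). \<gamma>' (u * fst q, snd q))"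
      unfolding case_prod_unfold
      by (rule continuous_on_compose2[OF cont\<gamma>'[of UNIV]]) (auto intro!: continuous_intros)
    from integral_continuous_on_param[OF this] show ?thesis by (simp add: Q_def)
  qed
  \<comment> \<open>The basic neighbourhoods of c are convex: shrinking the increment by s at most 1
    shrinks every derivative of it.\<close>
  have seg: "\<exists>\<delta>>0. \<forall>t s. \<bar>t\<bar> < \<delta> \<longrightarrow> 0 \<le> s \<longrightarrow> s \<le> 1 \<longrightarrow> (\<lambda>\<theta>. c \<theta> + s *\<^sub>R p t \<theta>) \<in> Imm"
  proof -
    obtain n e where e: "e > 0" "\<And>d. d \<in> loops \<Longrightarrow>
        (\<forall>j\<le>n. \<forall>\<theta>. norm ((D_theta ^^ j) d \<theta> - (D_theta ^^ j) c \<theta>) < e) \<Longrightarrow> d \<in> Imm"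
      using loop_open_Imm cI unfolding loop_open_def by blast
    have "\<exists>\<delta>>0. \<forall>t \<theta>. \<bar>t\<bar> < \<delta> \<longrightarrow> norm ((D_theta ^^ j) (\<gamma> t) \<theta> - (D_theta ^^ j) c \<theta>) < e" for j
      using smooth_path_tendsto[OF \<gamma>(1) e(1), of j] unfolding c_def by metis
    then obtain \<delta> where \<delta>: "\<And>j. \<delta> j > 0"
      "\<And>j t \<theta>. \<bar>t\<bar> < \<delta> j \<Longrightarrow> norm ((D_theta ^^ j) (\<gamma> t) \<theta> - (D_theta ^^ j) c \<theta>) < e" by metis
    show ?thesis
    proof (intro exI conjI allI impI)
      show "Min (\<delta> ` {..n}) > 0" using \<delta>(1) by simp
      fix t s :: real assume t: "\<bar>t\<bar> < Min (\<delta> ` {..n})" and s: "0 \<le> s" "s \<le> 1"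
      show "(\<lambda>\<theta>. c \<theta> + s *\<^sub>R p t \<theta>) \<in> Imm"
      proof (rule e(2), use cI pl in simp, intro allI impI)
        fix j \<theta> assume "j \<le> n"
        then have "\<bar>t\<bar> < \<delta> j" using t by simp
        have "(D_theta ^^ j) (p t) = (\<lambda>\<theta>. (D_theta ^^ j) (\<gamma> t) \<theta> - (D_theta ^^ j) c \<theta>)"
          using funpow_D_theta_lincomb[of "\<gamma> t" c j "-1"] cI smooth_path_loops[OF \<gamma>(1)]
          by (simp add: p_def[abs_def] loops_C_inf)
        then have "norm ((D_theta ^^ j) (\<lambda>\<theta>. c \<theta> + s *\<^sub>R p t \<theta>) \<theta> - (D_theta ^^ j) c \<theta>)
            = s * norm ((D_theta ^^ j) (\<gamma> t) \<theta> - (D_theta ^^ j) c \<theta>)"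
          using s cI pl by (simp add: funpow_D_theta_lincomb loops_C_inf)
        also have "\<dots> \<le> norm ((D_theta ^^ j) (\<gamma> t) \<theta> - (D_theta ^^ j) c \<theta>)"
          using s by (simp add: mult_left_le_one_le)
        also have "\<dots> < e" using \<delta>(2)[OF \<open>\<bar>t\<bar> < \<delta> j\<close>] .
        finally show "norm ((D_theta ^^ j) (\<lambda>\<theta>. c \<theta> + s *\<^sub>R p t \<theta>) \<theta> - (D_theta ^^ j) c \<theta>) < e" .
      qed
    qed
  qed
  then obtain \<delta> where \<delta>: "\<delta> > 0"
    "\<And>t s. \<bar>t\<bar> < \<delta> \<Longrightarrow> 0 \<le> s \<Longrightarrow> s \<le> 1 \<Longrightarrow> (\<lambda>\<theta>. c \<theta> + s *\<^sub>R p t \<theta>) \<in> Imm" by blast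
  \<comment> \<open>The values of f at both ends of the segment agree, so by the mean value theorem
    the derivative in direction p t = t Q t vanishes somewhere in between; dividing by t leaves the
    pairing with \<open>Q t\<close>.\<close>
  have mvt: "\<exists>s. 0 < s \<and> s < 1 \<and>
      G_id (\<lambda>\<theta>. c \<theta> + s *\<^sub>R p t \<theta>) (g (\<lambda>\<theta>. c \<theta> + s *\<^sub>R p t \<theta>)) (Q t) = 0"
    if t: "\<bar>t\<bar> < \<delta>" "\<bar>t\<bar> < \<epsilon>" "t \<noteq> 0" for t
  proof -
    let ?F = "\<lambda>s. f (\<lambda>\<theta>. c \<theta> + s *\<^sub>R p t \<theta>)"
    have "\<exists>z. 0 < z \<and> z < 1 \<and> ?F 1 - ?F 0 = (1 - 0) * dir_deriv f (\<lambda>\<theta>. c \<theta> + z *\<^sub>R p t \<theta>) (p t)"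
      using \<delta>(2)[OF t(1)] by (intro MVT2 smooth_functional_has_derivative[OF f _ pl]) simp_all
    moreover have "?F 1 = ?F 0" using \<epsilon>(2)[OF t(2)] by (simp add: p_def c_def)
    ultimately obtain z where z: "0 < z" "z < 1" "dir_deriv f (\<lambda>\<theta>. c \<theta> + z *\<^sub>R p t \<theta>) (p t) = 0"
      by auto
    have "(\<lambda>\<theta>. c \<theta> + z *\<^sub>R p t \<theta>) \<in> Imm" using \<delta>(2)[OF t(1)] z by simp
    then have "G_id (\<lambda>\<theta>. c \<theta> + z *\<^sub>R p t \<theta>) (g (\<lambda>\<theta>. c \<theta> + z *\<^sub>R p t \<theta>)) (p t) = 0"
      using g pl z(3) by (simp add: is_grad_def)
    moreover have "p t = (\<lambda>\<theta>. t *\<^sub>R Q t \<theta>)" using pQ by blast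
    ultimately have "t * G_id (\<lambda>\<theta>. c \<theta> + z *\<^sub>R p t \<theta>) (g (\<lambda>\<theta>. c \<theta> + z *\<^sub>R p t \<theta>)) (Q t) = 0"
      using G_id_scaleR_right by metis
    then show ?thesis using z t(3) by auto
  qed
  \<comment> \<open>The shift by 2 keeps already the first term strictly below both bounds.\<close>
  define t where "t n = min \<delta> \<epsilon> / real (n + 2)" for n
  have t: "\<bar>t n\<bar> < \<delta>" "\<bar>t n\<bar> < \<epsilon>" "t n \<noteq> 0" for n
  proof -
    have "t n > 0" using \<delta>(1) \<epsilon>(1) by (simp add: t_def)
    moreover have "t n < min \<delta> \<epsilon> / 1"
      unfolding t_def using \<delta>(1) \<epsilon>(1) by (intro divide_strict_left_mono) simp_all
    ultimately show "\<bar>t n\<bar> < \<delta>" "\<bar>t n\<bar> < \<epsilon>" "t n \<noteq> 0" by auto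
  qed
  have t0: "t \<longlonglongrightarrow> 0"
    unfolding t_def[abs_def] by (rule LIMSEQ_ignore_initial_segment[OF lim_const_over_n])
  have "\<forall>n. \<exists>s. 0 < s \<and> s < 1 \<and>
      G_id (\<lambda>\<theta>. c \<theta> + s *\<^sub>R p (t n) \<theta>) (g (\<lambda>\<theta>. c \<theta> + s *\<^sub>R p (t n) \<theta>)) (Q (t n)) = 0"
    using mvt[OF t] by (rule allI)
  then obtain s where "\<forall>n. 0 < s n \<and> s n < 1 \<and>
      G_id (\<lambda>\<theta>. c \<theta> + s n *\<^sub>R p (t n) \<theta>) (g (\<lambda>\<theta>. c \<theta> + s n *\<^sub>R p (t n) \<theta>)) (Q (t n)) = 0"
    by (rule choice[THEN exE])
  then have s: "0 < s n" "s n < 1"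
    "G_id (\<lambda>\<theta>. c \<theta> + s n *\<^sub>R p (t n) \<theta>) (g (\<lambda>\<theta>. c \<theta> + s n *\<^sub>R p (t n) \<theta>)) (Q (t n)) = 0" for n
    by simp_all
  define d where "d n = (\<lambda>\<theta>. c \<theta> + s n *\<^sub>R p (t n) \<theta>)" for n
  have lim: "loop_tendsto d c"
    unfolding loop_tendsto_def
  proof (intro allI impI)
    fix j and e :: real assume "e > 0"
    obtain \<eta> where \<eta>: "\<eta> > 0"
      "\<And>t \<theta>. \<bar>t\<bar> < \<eta> \<Longrightarrow> norm ((D_theta ^^ j) (\<gamma> t) \<theta> - (D_theta ^^ j) c \<theta>) < e"
      using smooth_path_tendsto[OF \<gamma>(1) \<open>e > 0\<close>, of j] unfolding c_def by metis
    have "\<forall>\<^sub>F n in sequentially. \<bar>t n\<bar> < \<eta>"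
      using tendstoD[OF t0 \<eta>(1)] by simp
    then show "\<forall>\<^sub>F n in sequentially. \<forall>\<theta>. norm ((D_theta ^^ j) (d n) \<theta> - (D_theta ^^ j) c \<theta>) < e"
    proof eventually_elim
      case (elim n)
      have "(D_theta ^^ j) (p (t n)) = (\<lambda>\<theta>. (D_theta ^^ j) (\<gamma> (t n)) \<theta> - (D_theta ^^ j) c \<theta>)"
        using funpow_D_theta_lincomb[of "\<gamma> (t n)" c j "-1"] cI smooth_path_loops[OF \<gamma>(1)]
        by (simp add: p_def[abs_def] loops_C_inf)
      then have eq: "norm ((D_theta ^^ j) (d n) \<theta> - (D_theta ^^ j) c \<theta>)
          = s n * norm ((D_theta ^^ j) (\<gamma> (t n)) \<theta> - (D_theta ^^ j) c \<theta>)" for \<theta>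
        using s(1)[of n] cI pl by (simp add: d_def funpow_D_theta_lincomb loops_C_inf)
      have "s n * norm ((D_theta ^^ j) (\<gamma> (t n)) \<theta> - (D_theta ^^ j) c \<theta>)
          \<le> norm ((D_theta ^^ j) (\<gamma> (t n)) \<theta> - (D_theta ^^ j) c \<theta>)" for \<theta>
        using s(1,2)[of n] by (intro mult_left_le_one_le) simp_all
      then show ?case unfolding eq using \<eta>(2)[OF elim] by (blast intro: le_less_trans)
    qed
  qed
  have dl: "d n \<in> loops" for n using cI pl by (simp add: d_def)
  obtain \<sigma> r where \<sigma>: "smooth_path \<sigma>" "\<And>\<tau>. \<sigma> \<tau> \<in> Imm" "\<sigma> 0 = c"
    and r: "\<And>k. r k \<ge> k" "\<And>k. \<sigma> ((1 / 2) ^ k) = d (r k)"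
    using special_curve[OF loop_open_Imm cI dl lim] by metis
  \<comment> \<open>Two clocks run here: the time on \<sigma>, which reaches the intermediate point
    \<open>d (r k)\<close> at 2^-k, and the original time \<open>t (r k)\<close> in the quotient.
    Joint continuity lets both tend to 0, and A is 0 along the sequence.\<close>
  define A where "A q = G_id (\<sigma> (fst q)) (g (\<sigma> (fst q))) (Q (snd q))" for q
  have "continuous_on UNIV A"
  proof -
    have path: "smooth_path (\<lambda>\<tau>. g (\<sigma> \<tau>))"
      using g \<sigma> by (auto simp: is_grad_def intro: smooth_field_path)
    have *: "continuous_on B (\<lambda>x. F (fst (fst x)) (snd x))"
      if "C_inf (\<lambda>p. F (fst p) (snd p))" for B :: "((real \<times> real) \<times> real) set" and F :: "real \<Rightarrow> real \<Rightarrow> 'z::real_normed_vector"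
    proof -
      have "continuous_on B (\<lambda>x. (fst (fst x), snd x))" by (intro continuous_intros)
      from continuous_on_compose2[OF C_inf_continuous_on[OF that, of UNIV] this] show ?thesis by simp
    qed
    have **: "continuous_on B (\<lambda>x. Q (snd (fst x)) (snd x))" for B :: "((real \<times> real) \<times> real) set"
    proof -
      have "continuous_on B (\<lambda>x. (snd (fst x), snd x))" by (intro continuous_intros)
      from continuous_on_compose2[OF contQ this] show ?thesis by simp
    qed
    have "continuous_on (SIGMA q:UNIV. cbox 0 (2 * pi))
      (\<lambda>(q, \<theta>). (g (\<sigma> (fst q)) \<theta> \<bullet> Q (snd q) \<theta>) * norm (D_theta (\<sigma> (fst q)) \<theta>))"
      unfolding case_prod_unfold
      by (intro continuous_on_mult continuous_on_inner *[OF smooth_path_C_inf[OF path]] **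
          *[OF C_inf_speed[OF \<sigma>(1,2)]])
    from integral_continuous_on_param[OF this] show ?thesis
      by (simp add: A_def[abs_def] G_id_def)
  qed
  then have "isCont A (0, 0)" by (simp add: continuous_on_eq_continuous_at)
  moreover have "(\<lambda>k. ((1 / 2 :: real) ^ k, t (r k))) \<longlonglongrightarrow> (0, 0)"
  proof (rule tendsto_Pair)
    show "(\<lambda>k. (1 / 2 :: real) ^ k) \<longlonglongrightarrow> 0" by (rule LIMSEQ_power_zero) simp
    have "filterlim r at_top sequentially"
      using r(1) by (intro filterlim_at_top_mono[OF filterlim_ident]) simp
    with t0 show "(\<lambda>k. t (r k)) \<longlonglongrightarrow> 0" by (rule filterlim_compose)
  qed
  ultimately have "(\<lambda>k. A ((1 / 2) ^ k, t (r k))) \<longlonglongrightarrow> A (0, 0)"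
    by (rule isCont_tendsto_compose)
  moreover have "A ((1 / 2) ^ k, t (r k)) = 0" for k
    using s(3)[of "r k"] by (simp add: A_def r(2) d_def)
  ultimately have "A (0, 0) = 0" by (simp add: LIMSEQ_const_iff)
  moreover have "Q 0 = (\<lambda>\<theta>. D_theta (\<lambda>t. \<gamma> t \<theta>) 0)"
    by (simp add: Q_def[abs_def] \<gamma>'_def)
  ultimately show ?thesis by (simp add: A_def \<sigma>(3) c_def)
qed

section \<open>Gradients of invariant functionals\<close>

lemma grad_flow_invariant:
  assumes f: "smooth_functional Imm f" and g: "is_grad f g" and X: "flow_invariant X f" and c: "c \<in> Imm"
  shows "G_id c (g c) (X c) = 0"
proof -
  obtain \<gamma> \<epsilon> where \<gamma>: "smooth_path \<gamma>" "\<gamma> 0 = c" and \<epsilon>: "\<epsilon> > 0"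
    "\<And>t \<theta>. \<bar>t\<bar> < \<epsilon> \<Longrightarrow> ((\<lambda>s. \<gamma> s \<theta>) has_vector_derivative X (\<gamma> t) \<theta>) (at t) \<and> f (\<gamma> t) = f c"
    using X c unfolding flow_invariant_def by meson
  have "(\<lambda>\<theta>. D_theta (\<lambda>t. \<gamma> t \<theta>) 0) = X c"
    using \<epsilon>(2)[of 0] \<epsilon>(1) \<gamma>(2) D_theta_eqI by fastforce
  then show ?thesis
    using grad_constant_along_path[OF f g \<gamma>(1) _ \<epsilon>(1)] \<epsilon>(2) \<gamma>(2) c by auto
qed

text \<open>Differentiates the invariance along the diffeomorphisms \<open>\<theta> \<mapsto> \<theta> + s a(\<theta>)\<close>
  for \<open>a = \<langle>grad f, c\<^sub>\<theta>\<rangle>\<close>.\<close>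

lemma grad_Diff_invariant:
  assumes f: "smooth_functional Imm f" and g: "is_grad f g" and inv: "Diff_invariant f" and c: "c \<in> Imm"
  shows "g c \<theta> \<bullet> D_s c c \<theta> = 0"
proof -
  have gl: "g c \<in> loops" using g c by (auto simp: is_grad_def smooth_field_loops)
  define a where "a \<theta> = g c \<theta> \<bullet> D_theta c \<theta>" for \<theta>
  have al: "a \<in> loops" using gl c by (simp add: a_def[abs_def])
  obtain B where B: "B > 0" "\<And>\<theta>. norm (D_theta a \<theta>) \<le> B"
    using loops_bounded[OF D_theta_loops[OF al]] by blast
  \<comment> \<open>With this bound the derivative of every \<open>\<phi> t\<close> stays at least
    1/2, so \<open>\<phi> t\<close> is in \<open>Diff_plus\<close> for all times.\<close>
  define \<epsilon> where "\<epsilon> = 1 / (2 * B)"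
  define \<phi> where "\<phi> t \<theta> = \<theta> + (\<epsilon> * sin t) * a \<theta>" for t \<theta>
  define \<gamma> where "\<gamma> t \<theta> = c (\<phi> t \<theta>)" for t \<theta>
  have \<epsilon>: "\<epsilon> > 0" using B by (simp add: \<epsilon>_def)
  have \<phi>': "(\<phi> t has_real_derivative 1 + (\<epsilon> * sin t) * D_theta a \<theta>) (at \<theta>)" for t \<theta>
    unfolding \<phi>_def[abs_def]
    using C_inf_has_vector_derivative[OF loops_C_inf[OF al], of \<theta>]
    by (auto intro!: derivative_eq_intros simp: has_real_derivative_iff_has_vector_derivative[symmetric])
  have pos: "1 + (\<epsilon> * sin t) * D_theta a \<theta> > 0" for t \<theta>
  proof -
    have "\<bar>(\<epsilon> * sin t) * D_theta a \<theta>\<bar> \<le> (\<epsilon> * 1) * B"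
      unfolding abs_mult using \<epsilon> B by (intro mult_mono) simp_all
    moreover have "(\<epsilon> * 1) * B < 1" using B(1) by (simp add: \<epsilon>_def)
    ultimately show ?thesis by linarith
  qed
  have C\<phi>: "C_inf (\<lambda>p. \<phi> (fst p) (snd p))"
    unfolding \<phi>_def by (intro C_inf_intros C_inf_snd_compose C_inf_fst_compose C_inf_sin loops_C_inf[OF al])
  have \<phi>p: "\<phi> t (\<theta> + 2 * pi) = \<phi> t \<theta> + 2 * pi" for t \<theta>
    using loops_periodic[OF al] by (simp add: \<phi>_def)
  have \<phi>D: "\<phi> t \<in> Diff_plus" for t
  proof -
    have "C_inf (\<phi> t)"
      unfolding \<phi>_def[abs_def] by (intro C_inf_intros loops_C_inf[OF al])
    then show ?thesis
      using \<phi>p pos DERIV_imp_deriv[OF \<phi>'] by (simp add: Diff_plus_def)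
  qed
  have path: "smooth_path \<gamma>"
    unfolding \<gamma>_def[abs_def] using c
    by (intro smooth_pathI C_inf_compose[OF _ C\<phi>]) (simp_all add: \<phi>p loops_C_inf loops_periodic)
  have "\<gamma> 0 = c" by (simp add: \<gamma>_def[abs_def] \<phi>_def)
  moreover have "f (\<gamma> t) = f c" for t
  proof -
    have "\<gamma> t = c \<circ> \<phi> t" by (simp add: \<gamma>_def fun_eq_iff)
    then show ?thesis using inv c \<phi>D by (simp add: Diff_invariant_def)
  qed
  moreover have "D_theta (\<lambda>t. \<gamma> t \<theta>) 0 = \<epsilon> *\<^sub>R (a \<theta> *\<^sub>R D_theta c \<theta>)" for \<theta>
  proof (rule D_theta_eqI)
    have "((\<lambda>t. \<phi> t \<theta>) has_vector_derivative \<epsilon> * a \<theta>) (at 0)"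
      unfolding \<phi>_def has_real_derivative_iff_has_vector_derivative[symmetric]
      by (auto intro!: derivative_eq_intros)
    from vector_diff_chain_at[OF this C_inf_has_vector_derivative[OF loops_C_inf[of c]]]
    show "((\<lambda>t. \<gamma> t \<theta>) has_vector_derivative \<epsilon> *\<^sub>R (a \<theta> *\<^sub>R D_theta c \<theta>)) (at 0)"
      using c by (simp add: \<gamma>_def o_def \<phi>_def)
  qed
  ultimately have "G_id c (g c) (\<lambda>\<theta>. \<epsilon> *\<^sub>R (a \<theta> *\<^sub>R D_theta c \<theta>)) = 0"
    using grad_constant_along_path[OF f g path _ zero_less_one] c by simp
  then have "G_id c (g c) (\<lambda>\<theta>. a \<theta> *\<^sub>R D_theta c \<theta>) = 0"
    using \<epsilon> unfolding G_id_scaleR_right by simp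
  \<comment> \<open>The left side integrates the square of a. Multiplying a by a fixed unit vector
    presents this as the squared length of a loop, so that definiteness of the metric forces a =
    0.\<close>
  moreover have "G_id c (g c) (\<lambda>\<theta>. a \<theta> *\<^sub>R D_theta c \<theta>)
      = G_id c (\<lambda>\<theta>. a \<theta> *\<^sub>R axis 1 1) (\<lambda>\<theta>. a \<theta> *\<^sub>R axis 1 1)"
    by (rule G_id_cong) (simp add: a_def inner_axis_axis)
  ultimately have "a \<theta> *\<^sub>R (axis 1 1 :: real ^ 3) = 0"
    using al c by (intro G_id_self_eq_0[of c "\<lambda>\<theta>. a \<theta> *\<^sub>R axis 1 1"]) simp_all
  then show ?thesis by (simp add: a_def D_s_def)
qed

section \<open>The two-form in terms of gradients\<close>

lemma Theta_id_eq: "Theta_id c h = integral {0..2 * pi} (\<lambda>\<theta>. (c \<theta> \<times> D_theta c \<theta>) \<bullet> h \<theta>)"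
proof -
  have "((c \<theta> \<times> D_s c c \<theta>) \<bullet> h \<theta>) * norm (D_theta c \<theta>) = (c \<theta> \<times> D_theta c \<theta>) \<bullet> h \<theta>" for \<theta>
    by (subst (2) norm_scaleR_D_s[symmetric]) (simp add: cross_mult_right)
  then show ?thesis by (simp add: Theta_id_def G_id_def)
qed

lemma loops_integrable:
  fixes f :: "real \<Rightarrow> 'a::euclidean_space"
  shows "f \<in> loops \<Longrightarrow> f integrable_on {0..2 * pi}"
  by (simp add: integrable_continuous_interval C_inf_continuous_on loops_C_inf)

text \<open>Along a line \<Theta> is exactly a quadratic polynomial in t, so no remainder has to be
  estimated and the derivative at 0 is the linear coefficient.\<close>

lemma Theta_id_line:
  assumes c: "c \<in> loops" and h: "h \<in> loops" and k: "k \<in> loops"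
  shows "((\<lambda>t. Theta_id (\<lambda>\<theta>. c \<theta> + t *\<^sub>R h \<theta>) k) has_real_derivative
    integral {0..2 * pi} (\<lambda>\<theta>. (h \<theta> \<times> D_theta c \<theta> + c \<theta> \<times> D_theta h \<theta>) \<bullet> k \<theta>)) (at 0)"
proof -
  let ?A = "\<lambda>\<theta>. (c \<theta> \<times> D_theta c \<theta>) \<bullet> k \<theta>"
  let ?B = "\<lambda>\<theta>. (h \<theta> \<times> D_theta c \<theta> + c \<theta> \<times> D_theta h \<theta>) \<bullet> k \<theta>"
  let ?C = "\<lambda>\<theta>. (h \<theta> \<times> D_theta h \<theta>) \<bullet> k \<theta>"
  have int: "?A integrable_on {0..2 * pi}" "?B integrable_on {0..2 * pi}" "?C integrable_on {0..2 * pi}"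
    using c h k by (simp_all add: loops_integrable)
  have "Theta_id (\<lambda>\<theta>. c \<theta> + t *\<^sub>R h \<theta>) k
      = integral {0..2 * pi} ?A + t * integral {0..2 * pi} ?B + t\<^sup>2 * integral {0..2 * pi} ?C" for t
  proof -
    have "Theta_id (\<lambda>\<theta>. c \<theta> + t *\<^sub>R h \<theta>) k
        = integral {0..2 * pi} (\<lambda>\<theta>. ?A \<theta> + t * ?B \<theta> + t\<^sup>2 * ?C \<theta>)"
      unfolding Theta_id_eq using c h
      by (simp add: D_theta_lincomb loops_C_inf cross_add_left cross_add_right cross_mult_left
          cross_mult_right inner_add_left power2_eq_square algebra_simps)
    also have "\<dots> = integral {0..2 * pi} ?A + t * integral {0..2 * pi} ?B + t\<^sup>2 * integral {0..2 * pi} ?C"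
      using int by (simp only: Henstock_Kurzweil_Integration.integral_add integrable_add
          integrable_on_mult_right integral_mult_right)
    finally show ?thesis .
  qed
  then show ?thesis by (auto intro!: derivative_eq_intros)
qed

lemma integral_loop_derivative:
  fixes f :: "real \<Rightarrow> 'a::euclidean_space"
  assumes f: "f \<in> loops"
  shows "integral {0..2 * pi} (D_theta f) = 0"
proof -
  have "(D_theta f has_integral f (2 * pi) - f 0) {0..2 * pi}"
    by (rule fundamental_theorem_of_calculus) (simp_all add: has_vector_derivative_at_within
        C_inf_has_vector_derivative[OF loops_C_inf[OF f]])
  from integral_unique[OF this] show ?thesis using loops_periodic[OF f, of 0] by simp
qed

text \<open>The difference of the integrands is a total derivative minus three times the triple
  product of the velocity, h and k. Two of the three copies come from the terms without derivatives
  of h and k, the third from completing the other two terms to the derivative of \<open>?f\<close>;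
  the total derivative integrates to 0 over the circle.\<close>

lemma Theta_id_antisymmetric_part:
  assumes c: "c \<in> Imm" and h: "h \<in> loops" and k: "k \<in> loops"
  shows "integral {0..2 * pi} (\<lambda>\<theta>. (h \<theta> \<times> D_theta c \<theta> + c \<theta> \<times> D_theta h \<theta>) \<bullet> k \<theta>)
    - integral {0..2 * pi} (\<lambda>\<theta>. (k \<theta> \<times> D_theta c \<theta> + c \<theta> \<times> D_theta k \<theta>) \<bullet> h \<theta>)
    = - 3 * G_id c (tcross c h) k"
proof -
  let ?f = "\<lambda>\<theta>. (c \<theta> \<times> h \<theta>) \<bullet> k \<theta>"
  let ?g = "\<lambda>\<theta>. (D_theta c \<theta> \<times> h \<theta>) \<bullet> k \<theta>"
  have f: "?f \<in> loops" and g: "?g \<in> loops" using c h k by simp_all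
  have D: "D_theta ?f \<theta> = (D_theta c \<theta> \<times> h \<theta>) \<bullet> k \<theta> + (c \<theta> \<times> D_theta h \<theta>) \<bullet> k \<theta> + (c \<theta> \<times> h \<theta>) \<bullet> D_theta k \<theta>" for \<theta>
  proof (rule D_theta_eqI)
    have d: "(c has_vector_derivative D_theta c \<theta>) (at \<theta>)" "(h has_vector_derivative D_theta h \<theta>) (at \<theta>)"
      "(k has_vector_derivative D_theta k \<theta>) (at \<theta>)"
      using c h k by (simp_all add: C_inf_has_vector_derivative loops_C_inf)
    from bounded_bilinear.has_vector_derivative[OF bounded_bilinear_inner
        bounded_bilinear.has_vector_derivative[OF bounded_bilinear_cross3 d(1,2)] d(3)]
    show "(?f has_vector_derivative (D_theta c \<theta> \<times> h \<theta>) \<bullet> k \<theta> + (c \<theta> \<times> D_theta h \<theta>) \<bullet> k \<theta>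
        + (c \<theta> \<times> h \<theta>) \<bullet> D_theta k \<theta>) (at \<theta>)"
      by (simp add: inner_add_left add_ac)
  qed
  have "(h \<theta> \<times> D_theta c \<theta> + c \<theta> \<times> D_theta h \<theta>) \<bullet> k \<theta> - (k \<theta> \<times> D_theta c \<theta> + c \<theta> \<times> D_theta k \<theta>) \<bullet> h \<theta>
      = D_theta ?f \<theta> + - 3 * ?g \<theta>" for \<theta>
    unfolding D by (simp add: cross3_def inner_vec_def sum_3 algebra_simps)
  then have "integral {0..2 * pi} (\<lambda>\<theta>. (h \<theta> \<times> D_theta c \<theta> + c \<theta> \<times> D_theta h \<theta>) \<bullet> k \<theta>
      - (k \<theta> \<times> D_theta c \<theta> + c \<theta> \<times> D_theta k \<theta>) \<bullet> h \<theta>)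
      = integral {0..2 * pi} (\<lambda>\<theta>. D_theta ?f \<theta> + - 3 * ?g \<theta>)" by presburger
  also have "\<dots> = integral {0..2 * pi} (D_theta ?f) + integral {0..2 * pi} (\<lambda>\<theta>. - 3 * ?g \<theta>)"
    using f g by (intro Henstock_Kurzweil_Integration.integral_add loops_integrable) simp_all
  also have "\<dots> = - 3 * integral {0..2 * pi} ?g"
    unfolding integral_loop_derivative[OF f] integral_mult_right by simp
  also have "integral {0..2 * pi} ?g = G_id c (tcross c h) k"
  proof -
    have "?g \<theta> = ((D_s c c \<theta> \<times> h \<theta>) \<bullet> k \<theta>) * norm (D_theta c \<theta>)" for \<theta>
      by (subst norm_scaleR_D_s[symmetric]) (simp add: cross_mult_left)
    then show ?thesis by (simp add: G_id_def tcross_def)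
  qed
  finally show ?thesis
    using c h k by (subst Henstock_Kurzweil_Integration.integral_diff[symmetric]) (simp_all add: loops_integrable)
qed

lemma Omega_eq:
  assumes l: "smooth_functional Imm l" and g: "is_grad l g"
    and c: "c \<in> Imm" and h: "h \<in> loops" and k: "k \<in> loops"
  shows "Omega l c h k = 3 * l c * G_id c (tcross c h) k
    + Theta_id c h * G_id c (g c) k - G_id c (g c) h * Theta_id c k"
proof -
  have *: "dir_deriv (\<lambda>c. l c * Theta_id c k) c h = G_id c (g c) h * Theta_id c k
      + l c * integral {0..2 * pi} (\<lambda>\<theta>. (h \<theta> \<times> D_theta c \<theta> + c \<theta> \<times> D_theta h \<theta>) \<bullet> k \<theta>)"
    if h: "h \<in> loops" and k: "k \<in> loops" for h k
    using DERIV_mult[OF smooth_functional_has_derivative_0[OF l c h] Theta_id_line[OF Imm_loops[OF c] h k]]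
      g c h unfolding dir_deriv_def[of "\<lambda>c. l c * Theta_id c k"]
    by (intro DERIV_imp_deriv) (simp add: is_grad_def mult.commute)
  have **: "- (dh * Tk + L * I1 - (dk * Th + L * I2)) = 3 * L * G + Th * dk - dh * Tk"
    if "I1 - I2 = - 3 * G" for dh dk Th Tk L I1 I2 G :: real
  proof -
    have I1: "I1 = I2 - 3 * G" using that by simp
    show ?thesis unfolding I1 by (simp add: algebra_simps)
  qed
  show ?thesis
    unfolding Omega_def ext_deriv_def *[OF h k] *[OF k h]
    by (rule **[OF Theta_id_antisymmetric_part[OF c h k]])
qed

lemma dir_deriv_const: "dir_deriv (\<lambda>c. a) c h = 0"
  by (simp add: dir_deriv_def)

text \<open>The constant weight 1 with gradient 0, in the formula for general weights.\<close>

lemma Omega_id_eq: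
  assumes c: "c \<in> Imm" and h: "h \<in> loops" and k: "k \<in> loops"
  shows "Omega_id c h k = 3 * G_id c (tcross c h) k"
proof -
  have "smooth_field Imm (\<lambda>c \<theta>. 0)"
    by (intro smooth_fieldI smooth_path_const) simp_all
  then have "is_grad (\<lambda>c. 1) (\<lambda>c \<theta>. 0)"
    by (simp add: is_grad_def dir_deriv_const G_id_def)
  from Omega_eq[OF smooth_functional_const this c h k]
  show ?thesis by (simp add: Omega_def Omega_id_def G_id_def)
qed

section \<open>Rotation of the normal plane\<close>

lemma tcross_add: "tcross c (\<lambda>\<theta>. h \<theta> + k \<theta>) = (\<lambda>\<theta>. tcross c h \<theta> + tcross c k \<theta>)"
  by (simp add: tcross_def fun_eq_iff cross_add_right)

lemma tcross_scaleR: "tcross c (\<lambda>\<theta>. a *\<^sub>R h \<theta>) = (\<lambda>\<theta>. a *\<^sub>R tcross c h \<theta>)"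
  by (simp add: tcross_def fun_eq_iff cross_mult_right)

lemma tcross_minus: "tcross c (\<lambda>\<theta>. - h \<theta>) = (\<lambda>\<theta>. - tcross c h \<theta>)"
  by (simp add: tcross_def fun_eq_iff)

lemma tcross_diff: "tcross c (\<lambda>\<theta>. h \<theta> - k \<theta>) = (\<lambda>\<theta>. tcross c h \<theta> - tcross c k \<theta>)"
  by (simp add: tcross_def fun_eq_iff Cross3.right_diff_distrib)

lemma tcross_tangential: "tcross c (\<lambda>\<theta>. a \<theta> *\<^sub>R D_s c c \<theta>) = (\<lambda>\<theta>. 0)"
  by (simp add: tcross_def fun_eq_iff cross_mult_right)

lemmas tcross_simps = tcross_add tcross_scaleR tcross_minus tcross_diff tcross_tangential

lemma inner_tcross_D_s [simp]: "tcross c h \<theta> \<bullet> D_s c c \<theta> = 0" "D_s c c \<theta> \<bullet> tcross c h \<theta> = 0"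
  by (simp_all add: tcross_def dot_cross_self)

lemma tcross_tcross:
  "c \<in> Imm \<Longrightarrow> tcross c (tcross c h) = (\<lambda>\<theta>. (D_s c c \<theta> \<bullet> h \<theta>) *\<^sub>R D_s c c \<theta> - h \<theta>)"
  by (simp add: tcross_def fun_eq_iff Lagrange)

lemma tcross_tcross_normal:
  assumes "c \<in> Imm" and "\<And>\<theta>. h \<theta> \<bullet> D_s c c \<theta> = 0"
  shows "tcross c (tcross c h) = (\<lambda>\<theta>. - h \<theta>)"
  using assms by (simp add: tcross_tcross inner_commute[of "D_s c c _"])

lemma G_id_tcross: "G_id c h (tcross c k) = - G_id c (tcross c h) k"
proof -
  have "G_id c h (tcross c k) = G_id c (\<lambda>\<theta>. - tcross c h \<theta>) k"
    by (rule G_id_cong) (simp add: tcross_def cross3_def inner_vec_def sum_3 algebra_simps)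
  then show ?thesis by (simp add: G_id_minus_left)
qed

lemma G_id_tcross_self [simp]: "G_id c (tcross c h) h = 0" "G_id c h (tcross c h) = 0"
  by (simp_all add: G_id_def tcross_def dot_cross_self)

lemma G_id_tangential:
  assumes "\<And>\<theta>. h \<theta> \<bullet> D_s c c \<theta> = 0"
  shows "G_id c h (\<lambda>\<theta>. a \<theta> *\<^sub>R D_s c c \<theta>) = 0"
  using assms by (simp add: G_id_def)

text \<open>A cyclic shift of the triple product; it makes \<Theta>(h) accessible to the skewness of
  J = \<open>tcross c\<close>.\<close>

lemma Theta_id_tcross: "Theta_id c h = G_id c (tcross c h) c"
  unfolding Theta_id_def by (rule G_id_cong) (simp add: tcross_def cross_triple[of "c _"])

text \<open>The projection to the normal part is - J J, and J preserves smooth fields.\<close>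

lemma smooth_field_proj:
  assumes U: "U \<subseteq> Imm" and X: "smooth_field U X"
  shows "smooth_field U (\<lambda>c \<theta>. X c \<theta> - pr c (X c) \<theta>)"
proof (rule smooth_field_cong)
  show "smooth_field U (\<lambda>c \<theta>. - tcross c (tcross c (X c)) \<theta>)"
    by (intro smooth_field_minus smooth_field_tcross U X)
  fix c assume "c \<in> U"
  with U have "c \<in> Imm" by blast
  then show "(\<lambda>\<theta>. - tcross c (tcross c (X c)) \<theta>) = (\<lambda>\<theta>. X c \<theta> - pr c (X c) \<theta>)"
    by (simp add: tcross_tcross pr_def)
qed

section \<open>Density\<close>

text \<open>Points satisfying \<open>P\<close> are picked from a shrinking sequence of
  neighbourhoods of c. By \<open>special_curve\<close> some of them, arbitrarily late in the
  sequence, lie on a smooth path through c, and along it both fields are continuous at each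
  \<theta>.\<close>

lemma smooth_fields_eq_on_closure:
  assumes V: "loop_open V" and c: "c \<in> V"
    and dense: "\<And>W. loop_open W \<Longrightarrow> W \<subseteq> V \<Longrightarrow> W \<noteq> {} \<Longrightarrow> \<exists>d\<in>W. P d"
    and X: "smooth_field V X" and Y: "smooth_field V Y"
    and eq: "\<And>d. d \<in> V \<Longrightarrow> P d \<Longrightarrow> X d = Y d"
  shows "X c = Y c"
proof -
  have cl: "c \<in> loops" using V c by (auto simp: loop_open_def)
  \<comment> \<open>Bounding the deviation by some \<rho> strictly below the radius leaves slack
    uniform in \<theta> and j, which is what openness of \<open>N n\<close> needs.\<close>
  define N where "N n = {d \<in> loops. \<exists>\<rho><1 / real (Suc n). \<forall>j\<le>n. \<forall>\<theta>.
    norm ((D_theta ^^ j) d \<theta> - (D_theta ^^ j) c \<theta>) \<le> \<rho>}" for n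
  have "loop_open (N n)" for n
    unfolding loop_open_def
  proof (intro conjI ballI)
    show "N n \<subseteq> loops" by (auto simp: N_def)
    fix d assume "d \<in> N n"
    then obtain \<rho> where \<rho>: "\<rho> < 1 / real (Suc n)"
      "\<And>j \<theta>. j \<le> n \<Longrightarrow> norm ((D_theta ^^ j) d \<theta> - (D_theta ^^ j) c \<theta>) \<le> \<rho>" by (auto simp: N_def)
    define \<epsilon> where "\<epsilon> = (1 / real (Suc n) - \<rho>) / 2"
    show "\<exists>m. \<exists>\<epsilon>>0. \<forall>b\<in>loops.
        (\<forall>j\<le>m. \<forall>\<theta>. norm ((D_theta ^^ j) b \<theta> - (D_theta ^^ j) d \<theta>) < \<epsilon>) \<longrightarrow> b \<in> N n"
    proof (intro exI conjI ballI impI)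
      show "\<epsilon> > 0" using \<rho>(1) by (simp add: \<epsilon>_def)
      fix b assume b: "b \<in> loops" "\<forall>j\<le>n. \<forall>\<theta>. norm ((D_theta ^^ j) b \<theta> - (D_theta ^^ j) d \<theta>) < \<epsilon>"
      have "norm ((D_theta ^^ j) b \<theta> - (D_theta ^^ j) c \<theta>) \<le> \<rho> + \<epsilon>" if "j \<le> n" for j \<theta>
        using norm_triangle_ineq[of "(D_theta ^^ j) b \<theta> - (D_theta ^^ j) d \<theta>" "(D_theta ^^ j) d \<theta> - (D_theta ^^ j) c \<theta>"]
          b(2)[rule_format, OF that, of \<theta>] \<rho>(2)[OF that, of \<theta>] by simp
      moreover have "\<rho> + \<epsilon> < 1 / real (Suc n)" using \<rho>(1) unfolding \<epsilon>_def by argo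
      ultimately show "b \<in> N n" unfolding N_def using b(1) by blast
    qed
  qed
  then have "loop_open (V \<inter> N n)" for n
    using V istopology_loop_open by (simp add: istopology_def)
  moreover have "c \<in> V \<inter> N n" for n
    using c cl by (auto simp: N_def intro!: exI[of _ 0])
  ultimately have "\<exists>d. d \<in> V \<inter> N n \<and> P d" for n
    using dense[of "V \<inter> N n"] by blast
  then obtain d where d: "\<And>n. d n \<in> V" "\<And>n. d n \<in> N n" "\<And>n. P (d n)" by (metis IntD1 IntD2)
  have lim: "loop_tendsto d c"
    unfolding loop_tendsto_def
  proof (intro allI impI)
    fix j and \<epsilon> :: real assume "\<epsilon> > 0"
    then obtain m where "1 / real (Suc m) < \<epsilon>" using nat_approx_posE by blast
    then have m: "1 / real (Suc n) < \<epsilon>" if "n \<ge> m" for n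
      using that by (smt (verit) Suc_le_mono frac_le of_nat_0_less_iff of_nat_le_iff zero_less_Suc)
    show "\<forall>\<^sub>F n in sequentially. \<forall>\<theta>. norm ((D_theta ^^ j) (d n) \<theta> - (D_theta ^^ j) c \<theta>) < \<epsilon>"
      using eventually_ge_at_top[of "max m j"]
    proof eventually_elim
      case (elim n)
      then obtain \<rho> where "\<rho> < 1 / real (Suc n)"
        "\<And>\<theta>. norm ((D_theta ^^ j) (d n) \<theta> - (D_theta ^^ j) c \<theta>) \<le> \<rho>" using d(2)[of n] by (auto simp: N_def)
      then show ?case using m[of n] elim by (meson le_less_trans less_trans max.bounded_iff)
    qed
  qed
  have "d n \<in> loops" for n using d(1) V by (auto simp: loop_open_def)
  from special_curve[OF V c this lim] obtain \<sigma> r where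
    \<sigma>: "smooth_path \<sigma>" "\<And>t. \<sigma> t \<in> V" "\<sigma> 0 = c" and r: "\<And>k. \<sigma> ((1 / 2) ^ k) = d (r k)"
    by metis
  show ?thesis
  proof
    fix \<theta>
    have *: "(\<lambda>k. Z (d (r k)) \<theta>) \<longlonglongrightarrow> Z c \<theta>" if Z: "smooth_field V Z" for Z
    proof -
      have "C_inf (\<lambda>t. Z (\<sigma> t) \<theta>)"
        using C_inf_compose[OF smooth_path_C_inf[OF smooth_field_path[OF Z \<sigma>(1,2)]]
            C_inf_Pair[OF C_inf_ident C_inf_const]] by simp
      from C_inf_continuous_on[OF this, of UNIV] have "isCont (\<lambda>t. Z (\<sigma> t) \<theta>) 0"
        by (simp add: continuous_on_eq_continuous_at)
      moreover have "(\<lambda>k. (1 / 2 :: real) ^ k) \<longlonglongrightarrow> 0" by (rule LIMSEQ_power_zero) simp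
      ultimately have "(\<lambda>k. Z (\<sigma> ((1 / 2) ^ k)) \<theta>) \<longlonglongrightarrow> Z (\<sigma> 0) \<theta>"
        by (rule isCont_tendsto_compose)
      then show ?thesis by (simp add: r \<sigma>(3))
    qed
    have "(\<lambda>k. X (d (r k)) \<theta>) \<longlonglongrightarrow> Y c \<theta>"
      using *[OF Y] eq[OF d(1,3)] by simp
    then show "X c \<theta> = Y c \<theta>" by (rule LIMSEQ_unique[OF *[OF X]])
  qed
qed

section \<open>Linear algebra at a fixed immersion\<close>

text \<open>The \<open>G_id c\<close>-representative of the one-form \<open>Omega l c h\<close>, where \<open>L = l c\<close> and \<open>p\<close> is the
  gradient of \<open>l\<close> at \<open>c\<close>.\<close>

definition rep :: "curve \<Rightarrow> real \<Rightarrow> curve \<Rightarrow> curve \<Rightarrow> curve" where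
  "rep c L p h = (\<lambda>\<theta>. (3 * L) *\<^sub>R tcross c h \<theta> + G_id c (tcross c h) c *\<^sub>R p \<theta>
     + G_id c p h *\<^sub>R tcross c c \<theta>)"

lemma rep_loops [simp]: "c \<in> Imm \<Longrightarrow> p \<in> loops \<Longrightarrow> h \<in> loops \<Longrightarrow> rep c L p h \<in> loops"
  by (simp add: rep_def)

lemma G_id_rep:
  assumes "c \<in> Imm" "p \<in> loops" "h \<in> loops" "k \<in> loops"
  shows "G_id c (rep c L p h) k = 3 * L * G_id c (tcross c h) k + G_id c (tcross c h) c * G_id c p k
    + G_id c p h * G_id c (tcross c c) k"
  unfolding rep_def using assms by (simp add: G_id_simps)

lemma Omega_rep:
  assumes l: "smooth_functional Imm l" and g: "is_grad l g"
    and c: "c \<in> Imm" and h: "h \<in> loops" and k: "k \<in> loops"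
  shows "Omega l c h k = G_id c (rep c (l c) (g c) h) k"
proof -
  have gl: "g c \<in> loops" using g c by (auto simp: is_grad_def smooth_field_loops)
  have "G_id c (tcross c k) c = - G_id c (tcross c c) k"
    using G_id_tcross[of c c k] by (simp add: G_id_commute[of c c])
  then show ?thesis
    unfolding Omega_eq[OF l g c h k] Theta_id_tcross G_id_rep[OF c gl h k] by simp
qed

text \<open>Definiteness of the metric turns the equation of one-forms, tested on all k, into an
  equation between two loops.\<close>

lemma hamiltonian_at_iff_rep:
  assumes l: "smooth_functional Imm l" and gl: "is_grad l gl" and gH: "is_grad H gH"
    and c: "c \<in> Imm" and h: "h \<in> loops"
  shows "(\<forall>k\<in>loops. Omega l c h k = dir_deriv H c k) \<longleftrightarrow> rep c (l c) (gl c) h = gH c"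
proof -
  have loops: "gl c \<in> loops" "gH c \<in> loops"
    using gl gH c by (auto simp: is_grad_def smooth_field_loops)
  have *: "Omega l c h k = G_id c (rep c (l c) (gl c) h) k" "dir_deriv H c k = G_id c (gH c) k"
    if "k \<in> loops" for k
    using Omega_rep[OF l gl c h that] gH c that by (simp_all add: is_grad_def)
  show ?thesis
    using G_id_eqI[OF c rep_loops[OF c loops(1) h] loops(2)] * by auto
qed

lemma rep_diff:
  assumes "c \<in> Imm" "p \<in> loops" "h \<in> loops" "k \<in> loops"
  shows "rep c L p (\<lambda>\<theta>. h \<theta> - k \<theta>) = (\<lambda>\<theta>. rep c L p h \<theta> - rep c L p k \<theta>)"
  unfolding rep_def tcross_simps using assms by (simp add: G_id_simps algebra_simps)

text \<open>On normal fields J squares to -1, so its inverse is - J; normality of \<open>h\<close>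
  fixes the tangential part, which J does not see.\<close>

lemma tcross_eq_normal_iff:
  assumes c: "c \<in> Imm" and q: "\<And>\<theta>. q \<theta> \<bullet> D_s c c \<theta> = 0" and a: "a \<noteq> 0"
  shows "(\<lambda>\<theta>. a *\<^sub>R tcross c h \<theta>) = q \<and> (\<forall>\<theta>. h \<theta> \<bullet> D_s c c \<theta> = 0) \<longleftrightarrow>
    h = (\<lambda>\<theta>. - ((1 / a) *\<^sub>R tcross c q \<theta>))"
proof (intro iffI conjI allI)
  assume h: "(\<lambda>\<theta>. a *\<^sub>R tcross c h \<theta>) = q \<and> (\<forall>\<theta>. h \<theta> \<bullet> D_s c c \<theta> = 0)"
  then have "tcross c q = (\<lambda>\<theta>. a *\<^sub>R tcross c (tcross c h) \<theta>)" using tcross_scaleR by metis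
  also have "\<dots> = (\<lambda>\<theta>. - (a *\<^sub>R h \<theta>))" using tcross_tcross_normal[OF c, of h] h by simp
  finally show "h = (\<lambda>\<theta>. - ((1 / a) *\<^sub>R tcross c q \<theta>))" using a by simp
next
  assume h: "h = (\<lambda>\<theta>. - ((1 / a) *\<^sub>R tcross c q \<theta>))"
  show "(\<lambda>\<theta>. a *\<^sub>R tcross c h \<theta>) = q"
    unfolding h tcross_simps tcross_tcross_normal[OF c q] using a by simp
  show "h \<theta> \<bullet> D_s c c \<theta> = 0" for \<theta> by (simp add: h)
qed

context
  fixes c p q :: curve and L :: real
  assumes c: "c \<in> Imm" and L: "L > 0" and p: "p \<in> loops" and q: "q \<in> loops"
    and pn: "\<And>\<theta>. p \<theta> \<bullet> D_s c c \<theta> = 0" and qn: "\<And>\<theta>. q \<theta> \<bullet> D_s c c \<theta> = 0"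
begin

text \<open>J = \<open>tcross c\<close> is skew and squares to -1 on the normal fields
  \<open>p\<close> and \<open>q\<close>, which stand for the gradients of \<open>l\<close> and
  H.\<close>

lemma pairings:
  "G_id c p (tcross c (tcross c c)) = - G_id c p c"
  "G_id c (tcross c c) (tcross c p) = G_id c p c"
  "G_id c q (tcross c p) = - G_id c p (tcross c q)"
proof -
  have 1: "G_id c (tcross c p) (tcross c c) = G_id c p c"
    unfolding G_id_tcross[of c "tcross c p"] tcross_tcross_normal[OF c pn] G_id_minus_left by simp
  then show "G_id c p (tcross c (tcross c c)) = - G_id c p c"
    unfolding G_id_tcross[of c p] by simp
  show "G_id c (tcross c c) (tcross c p) = G_id c p c"
    unfolding G_id_commute[of c "tcross c c"] by (rule 1)
  show "G_id c q (tcross c p) = - G_id c p (tcross c q)"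
    unfolding G_id_commute[of c p] by (rule G_id_tcross)
qed

text \<open>Each pairing isolates one unknown: with c the dl(X) term drops out because J c is
  orthogonal to c, and with J p the \<Theta>(X) term drops out because J p is orthogonal to p. Once
  both numbers are known, applying J recovers X. The converse is substitution.\<close>

lemma rep_eq_iff_regular:
  assumes \<mu>: "3 * L + G_id c p c \<noteq> 0" and X: "X \<in> loops"
  shows "rep c L p X = q \<and> (\<forall>\<theta>. X \<theta> \<bullet> D_s c c \<theta> = 0) \<longleftrightarrow>
    X = (\<lambda>\<theta>. - (1 / (3 * L)) *\<^sub>R (tcross c q \<theta> + (1 / (3 * L + G_id c p c)) *\<^sub>R
      (G_id c p (tcross c q) *\<^sub>R tcross c (tcross c c) \<theta> - G_id c c q *\<^sub>R tcross c p \<theta>)))"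
    (is "_ \<longleftrightarrow> X = ?F")
proof -
  define \<mu> where "\<mu> = 3 * L + G_id c p c"
  define \<alpha> where "\<alpha> = - 1 / (3 * L)"
  define \<beta> where "\<beta> = - G_id c p (tcross c q) / (3 * L * \<mu>)"
  define \<gamma> where "\<gamma> = G_id c c q / (3 * L * \<mu>)"
  have \<mu>0: "\<mu> \<noteq> 0" using \<mu> by (simp add: \<mu>_def)
  have F: "?F = (\<lambda>\<theta>. \<alpha> *\<^sub>R tcross c q \<theta> + \<beta> *\<^sub>R tcross c (tcross c c) \<theta> + \<gamma> *\<^sub>R tcross c p \<theta>)"
    unfolding \<mu>_def[symmetric] using L \<mu>0
    by (simp add: fun_eq_iff \<alpha>_def \<beta>_def \<gamma>_def scaleR_add_right scaleR_diff_right)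
  show ?thesis
  proof (intro iffI conjI allI)
    assume X': "rep c L p X = q \<and> (\<forall>\<theta>. X \<theta> \<bullet> D_s c c \<theta> = 0)"
    then have JJX: "tcross c (tcross c X) = (\<lambda>\<theta>. - X \<theta>)" using tcross_tcross_normal[OF c] by blast
    \<comment> \<open>The pairing with c, giving \<Theta>(X).\<close>
    have "G_id c q c = G_id c (tcross c X) c * \<mu>"
      using G_id_rep[OF c p X, of c L] X' c by (simp add: \<mu>_def algebra_simps)
    then have Q: "G_id c (tcross c X) c = G_id c c q / \<mu>"
      using \<mu>0 by (simp add: G_id_commute[of c q])
    \<comment> \<open>The pairing with J p, giving dl(X).\<close>
    have "G_id c q (tcross c p) = G_id c p X * \<mu>"
      using G_id_rep[OF c p X, of "tcross c p" L] X' c p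
      by (simp add: \<mu>_def pairings(2) G_id_tcross[of c "tcross c X"] JJX G_id_minus_left
          G_id_commute[of c X] algebra_simps)
    then have P: "G_id c p X = - G_id c p (tcross c q) / \<mu>"
      using \<mu>0 pairings(3) by (simp add: field_simps)
    have "tcross c (rep c L p X) = tcross c q" using X' by simp
    then have *: "(\<lambda>\<theta>. - ((3 * L) *\<^sub>R X \<theta>) + (G_id c c q / \<mu>) *\<^sub>R tcross c p \<theta>
        + (- G_id c p (tcross c q) / \<mu>) *\<^sub>R tcross c (tcross c c) \<theta>) = tcross c q"
      unfolding rep_def tcross_simps JJX Q P by simp
    show "X = ?F"
      unfolding F
    proof
      fix \<theta>
      have "(3 * L) *\<^sub>R X \<theta> = (G_id c c q / \<mu>) *\<^sub>R tcross c p \<theta>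
          + (- G_id c p (tcross c q) / \<mu>) *\<^sub>R tcross c (tcross c c) \<theta> - tcross c q \<theta>"
        using fun_cong[OF *, of \<theta>] by (simp add: algebra_simps)
      then have "(1 / (3 * L)) *\<^sub>R ((3 * L) *\<^sub>R X \<theta>) = (1 / (3 * L)) *\<^sub>R ((G_id c c q / \<mu>) *\<^sub>R tcross c p \<theta>
          + (- G_id c p (tcross c q) / \<mu>) *\<^sub>R tcross c (tcross c c) \<theta> - tcross c q \<theta>)" by simp
      then show "X \<theta> = \<alpha> *\<^sub>R tcross c q \<theta> + \<beta> *\<^sub>R tcross c (tcross c c) \<theta> + \<gamma> *\<^sub>R tcross c p \<theta>"
        using L \<mu>0 by (simp add: \<alpha>_def \<beta>_def \<gamma>_def scaleR_add_right scaleR_diff_right)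
    qed
  next
    assume XF: "X = ?F"
    have JJJ: "tcross c (tcross c (tcross c c)) = (\<lambda>\<theta>. - tcross c c \<theta>)"
      by (rule tcross_tcross_normal[OF c]) simp
    have JF: "tcross c ?F = (\<lambda>\<theta>. - (\<alpha> *\<^sub>R q \<theta>) - \<beta> *\<^sub>R tcross c c \<theta> - \<gamma> *\<^sub>R p \<theta>)"
      unfolding F tcross_simps JJJ tcross_tcross_normal[OF c pn] tcross_tcross_normal[OF c qn] by simp
    have Q: "G_id c (tcross c ?F) c = - (\<alpha> * G_id c c q) - \<gamma> * G_id c p c"
      unfolding JF using c p q by (simp add: G_id_simps G_id_commute[of c q])
    have P: "G_id c p ?F = \<alpha> * G_id c p (tcross c q) - \<beta> * G_id c p c"
      unfolding F using c p q by (simp add: G_id_simps pairings(1))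
    \<comment> \<open>The next three identities are the coefficients of q, p and J c in
      \<open>rep c L p X\<close>: they have to be 1, 0 and 0.\<close>
    have 1: "- (3 * L * \<alpha>) = 1" using L by (simp add: \<alpha>_def)
    have 2: "- (3 * L * \<gamma>) + (- (\<alpha> * G_id c c q) - \<gamma> * G_id c p c) = 0"
    proof -
      have "\<gamma> * \<mu> = - \<alpha> * G_id c c q" using L \<mu>0 by (simp add: \<alpha>_def \<gamma>_def)
      then show ?thesis by (simp add: \<mu>_def algebra_simps)
    qed
    have 3: "- (3 * L * \<beta>) + (\<alpha> * G_id c p (tcross c q) - \<beta> * G_id c p c) = 0"
    proof -
      have "\<beta> * \<mu> = \<alpha> * G_id c p (tcross c q)" using L \<mu>0 by (simp add: \<alpha>_def \<beta>_def)
      then show ?thesis by (simp add: \<mu>_def algebra_simps)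
    qed
    show "rep c L p X = q"
    proof
      fix \<theta>
      have "rep c L p X \<theta> = (- (3 * L * \<alpha>)) *\<^sub>R q \<theta>
          + (- (3 * L * \<gamma>) + (- (\<alpha> * G_id c c q) - \<gamma> * G_id c p c)) *\<^sub>R p \<theta>
          + (- (3 * L * \<beta>) + (\<alpha> * G_id c p (tcross c q) - \<beta> * G_id c p c)) *\<^sub>R tcross c c \<theta>"
        unfolding rep_def XF P Q unfolding JF by (simp add: algebra_simps)
      then show "rep c L p X \<theta> = q \<theta>" unfolding 1 2 3 by simp
    qed
    show "X \<theta> \<bullet> D_s c c \<theta> = 0" for \<theta>
      unfolding XF F by (simp add: inner_add_left)
  qed
qed

section \<open>The degenerate equation: kernel and a particular solution\<close>

context
  assumes \<mu>: "G_id c p c = - (3 * L)" and qc: "G_id c q c = 0" and qp: "G_id c q (tcross c p) = 0"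
begin

text \<open>Applying J to \<open>rep c L p h\<close> = 0 solves for h, with the numbers dl(h) and
  \<Theta>(h) as coefficients up to the factor - 1/(3 L). Conversely J h = x J c + y p, and the
  hypothesis on the pairing of p with c makes these numbers - 3 L x and - 3 L y, which cancels the
  term 3 L J h for every x and y.\<close>

lemma rep_eq_0_iff:
  assumes h: "h \<in> loops"
  shows "rep c L p h = (\<lambda>\<theta>. 0) \<longleftrightarrow>
    (\<exists>x y a. a \<in> loops \<and> h = (\<lambda>\<theta>. x *\<^sub>R c \<theta> + y *\<^sub>R - tcross c p \<theta> + a \<theta> *\<^sub>R D_s c c \<theta>))"
proof
  assume 0: "rep c L p h = (\<lambda>\<theta>. 0)"
  let ?x = "- (G_id c p h / (3 * L))" and ?y = "- (G_id c (tcross c h) c / (3 * L))"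
  \<comment> \<open>The tangential part of h that is left after subtracting the one of x c.\<close>
  let ?a = "\<lambda>\<theta>. D_s c c \<theta> \<bullet> h \<theta> - ?x * (D_s c c \<theta> \<bullet> c \<theta>)"
  have "tcross c (rep c L p h) = (\<lambda>\<theta>. 0)" unfolding 0 by (simp add: fun_eq_iff tcross_def)
  then have *: "(\<lambda>\<theta>. (3 * L) *\<^sub>R ((D_s c c \<theta> \<bullet> h \<theta>) *\<^sub>R D_s c c \<theta> - h \<theta>) + G_id c (tcross c h) c *\<^sub>R tcross c p \<theta>
      + G_id c p h *\<^sub>R ((D_s c c \<theta> \<bullet> c \<theta>) *\<^sub>R D_s c c \<theta> - c \<theta>)) = (\<lambda>\<theta>. 0)"
    unfolding rep_def tcross_simps tcross_tcross[OF c] .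
  have "h \<theta> = ?x *\<^sub>R c \<theta> + ?y *\<^sub>R - tcross c p \<theta> + ?a \<theta> *\<^sub>R D_s c c \<theta>" for \<theta>
  proof -
    have "(3 * L) *\<^sub>R h \<theta> = (3 * L) *\<^sub>R ((D_s c c \<theta> \<bullet> h \<theta>) *\<^sub>R D_s c c \<theta>) + G_id c (tcross c h) c *\<^sub>R tcross c p \<theta>
        + G_id c p h *\<^sub>R ((D_s c c \<theta> \<bullet> c \<theta>) *\<^sub>R D_s c c \<theta> - c \<theta>)"
      using fun_cong[OF *, of \<theta>] by (simp add: algebra_simps)
    then have "(1 / (3 * L)) *\<^sub>R ((3 * L) *\<^sub>R h \<theta>) = (1 / (3 * L)) *\<^sub>R ((3 * L) *\<^sub>R ((D_s c c \<theta> \<bullet> h \<theta>) *\<^sub>R D_s c c \<theta>)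
        + G_id c (tcross c h) c *\<^sub>R tcross c p \<theta> + G_id c p h *\<^sub>R ((D_s c c \<theta> \<bullet> c \<theta>) *\<^sub>R D_s c c \<theta> - c \<theta>))" by simp
    then have "h \<theta> = (D_s c c \<theta> \<bullet> h \<theta>) *\<^sub>R D_s c c \<theta> + (G_id c (tcross c h) c / (3 * L)) *\<^sub>R tcross c p \<theta>
        + ((G_id c p h * (D_s c c \<theta> \<bullet> c \<theta>) / (3 * L)) *\<^sub>R D_s c c \<theta> - (G_id c p h / (3 * L)) *\<^sub>R c \<theta>)"
      using L by (simp add: scaleR_add_right scaleR_diff_right)
    then show ?thesis
      by (rule trans) (simp add: scaleR_add_left scaleR_diff_left)
  qed
  moreover have "?a \<in> loops" using c h by (intro loops_diff loops_mult loops_inner) simp_all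
  ultimately show "\<exists>x y a. a \<in> loops \<and> h = (\<lambda>\<theta>. x *\<^sub>R c \<theta> + y *\<^sub>R - tcross c p \<theta> + a \<theta> *\<^sub>R D_s c c \<theta>)"
    by blast
next
  assume "\<exists>x y a. a \<in> loops \<and> h = (\<lambda>\<theta>. x *\<^sub>R c \<theta> + y *\<^sub>R - tcross c p \<theta> + a \<theta> *\<^sub>R D_s c c \<theta>)"
  then obtain x y a where a: "a \<in> loops"
    and h: "h = (\<lambda>\<theta>. x *\<^sub>R c \<theta> + y *\<^sub>R - tcross c p \<theta> + a \<theta> *\<^sub>R D_s c c \<theta>)" by blast
  have Jh: "tcross c h = (\<lambda>\<theta>. x *\<^sub>R tcross c c \<theta> + y *\<^sub>R p \<theta>)"
    unfolding h tcross_simps tcross_tcross_normal[OF c pn] by simp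
  have "G_id c (tcross c h) c = y * - (3 * L)"
    unfolding Jh using c p \<mu> by (simp add: G_id_simps)
  moreover have "G_id c p h = x * - (3 * L)"
    unfolding h using c p a \<mu> G_id_tangential[OF pn, of a] by (simp add: G_id_simps)
  ultimately show "rep c L p h = (\<lambda>\<theta>. 0)"
    unfolding rep_def Jh by (simp add: fun_eq_iff algebra_simps)
qed

text \<open>Pairing with p detects x, since J p is orthogonal to p while the pairing of p with c is
  - 3 L, hence nonzero. After that J leaves only y p, and pairing with c detects y.\<close>

lemma normal_kernel_independent:
  assumes "\<And>\<theta>. x *\<^sub>R (c \<theta> - pr c c \<theta>) + y *\<^sub>R - tcross c p \<theta> = 0"
  shows "x = 0 \<and> y = 0"
proof -
  have v: "(\<lambda>\<theta>. c \<theta> - pr c c \<theta>) = (\<lambda>\<theta>. - tcross c (tcross c c) \<theta>)"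
    using c by (simp add: tcross_tcross pr_def)
  define s where "s = (\<lambda>\<theta>. x *\<^sub>R - tcross c (tcross c c) \<theta> + y *\<^sub>R - tcross c p \<theta>)"
  have s: "s = (\<lambda>\<theta>. 0)" using assms v unfolding s_def by metis
  have "G_id c p s = x * G_id c p c"
    unfolding s_def using c p by (simp add: G_id_simps pairings(1))
  moreover have "G_id c p s = 0" unfolding s by (simp add: G_id_def)
  ultimately have x: "x = 0" using \<mu> L by simp
  have "tcross c s = (\<lambda>\<theta>. y *\<^sub>R p \<theta>)"
    unfolding s_def x tcross_simps tcross_tcross_normal[OF c pn] by simp
  then have "G_id c (tcross c s) c = y * - (3 * L)" using \<mu> by (simp add: G_id_scaleR_left)
  moreover have "G_id c (tcross c s) c = 0" unfolding s by (simp add: G_id_def tcross_def)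
  ultimately show ?thesis using x L by simp
qed

text \<open>Orthogonality of q to c and to J p makes both \<Theta> and dl vanish on J q, so only the
  term 3 L J h of \<open>rep\<close> is left to match.\<close>

lemma rep_particular: "rep c L p (\<lambda>\<theta>. - (1 / (3 * L)) *\<^sub>R tcross c q \<theta>) = q"
proof -
  have "G_id c p (tcross c q) = 0" using pairings(3) qp by simp
  then show ?thesis
    unfolding rep_def tcross_simps tcross_tcross_normal[OF c qn]
    using L qc by (simp add: G_id_simps)
qed

end

end

section \<open>Gram matrices\<close>

lemma gram2_components:
  "gram2 c v w $ 1 $ 1 = G_id c v v" "gram2 c v w $ 1 $ 2 = G_id c v w"
  "gram2 c v w $ 2 $ 1 = G_id c v w" "gram2 c v w $ 2 $ 2 = G_id c w w"
  by (simp_all add: gram2_def)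

lemma det_gram2: "det (gram2 c v w) = G_id c v v * G_id c w w - G_id c v w * G_id c v w"
  by (simp add: det_2 gram2_components)

text \<open>The vector \<open>?s\<close> is the part of v orthogonal to w, cleared of its
  denominator; its squared length is the squared length of w times the determinant. A zero
  determinant would make \<open>?s\<close> a vanishing combination, forcing w = 0.\<close>

lemma det_gram2_nonzero:
  assumes c: "c \<in> Imm" and v: "v \<in> loops" and w: "w \<in> loops"
    and indep: "\<And>x y. (\<And>\<theta>. x *\<^sub>R v \<theta> + y *\<^sub>R w \<theta> = 0) \<Longrightarrow> x = 0 \<and> y = 0"
  shows "det (gram2 c v w) \<noteq> 0"
proof
  assume 0: "det (gram2 c v w) = 0"
  let ?x = "G_id c w w" and ?y = "- G_id c v w"
  let ?s = "\<lambda>\<theta>. ?x *\<^sub>R v \<theta> + ?y *\<^sub>R w \<theta>"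
  have "?s \<in> loops" using v w by simp
  moreover have "G_id c ?s ?s = G_id c w w * det (gram2 c v w)"
    unfolding det_gram2 using c v w
    by (simp add: G_id_simps G_id_commute[of c w v] algebra_simps)
  ultimately have "?s \<theta> = 0" for \<theta> using G_id_self_eq_0[OF c, of ?s] 0 by simp
  then have "G_id c w w = 0" using indep[of ?x ?y] by blast
  then have "w \<theta> = 0" for \<theta> using G_id_self_eq_0[OF c w] by blast
  then show False using indep[of 0 1] by simp
qed

text \<open>The linear equations express orthogonality. Cramer's formulas are for smoothness:
  \<open>matrix_inv\<close> is a choice operator, but as quotients of metric pairings the
  coefficients visibly depend smoothly on c.\<close>

lemma gram2_solution:
  fixes b1 b2 :: real
  assumes "det (gram2 c v w) \<noteq> 0"
  defines "x \<equiv> matrix_inv (gram2 c v w) *v (vector [b1, b2] :: real ^ 2)"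
  shows "G_id c v v * x $ 1 + G_id c v w * x $ 2 = b1"
    and "G_id c v w * x $ 1 + G_id c w w * x $ 2 = b2"
    and "x $ 1 = (G_id c w w * b1 - G_id c v w * b2) / (G_id c v v * G_id c w w - G_id c v w * G_id c v w)"
    and "x $ 2 = (G_id c v v * b2 - G_id c v w * b1) / (G_id c v v * G_id c w w - G_id c v w * G_id c v w)"
proof -
  have "invertible (gram2 c v w)" using assms(1) by (simp add: invertible_det_nz)
  then have "gram2 c v w ** matrix_inv (gram2 c v w) = mat 1"
    unfolding invertible_def matrix_inv_def by (rule someI2_ex) simp
  then have "gram2 c v w *v x = vector [b1, b2]"
    unfolding x_def by (simp add: matrix_vector_mul_assoc)
  then have eq: "(gram2 c v w *v x) $ i = (vector [b1, b2] :: real ^ 2) $ i" for i by simp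
  show 1: "G_id c v v * x $ 1 + G_id c v w * x $ 2 = b1"
    and 2: "G_id c v w * x $ 1 + G_id c w w * x $ 2 = b2"
    using eq[of 1] eq[of 2] by (simp_all add: matrix_vector_mult_def sum_2 gram2_components)
  show "x $ 1 = (G_id c w w * b1 - G_id c v w * b2) / (G_id c v v * G_id c w w - G_id c v w * G_id c v w)"
    and "x $ 2 = (G_id c v v * b2 - G_id c v w * b1) / (G_id c v v * G_id c w w - G_id c v w * G_id c v w)"
    using assms(1) unfolding det_gram2 1[symmetric] 2[symmetric] by (simp_all add: field_simps)
qed

section \<open>Hamiltonian vector fields\<close>

text \<open>Reduces a field equation to linear algebra at each c. Smoothness of the explicit
  solution gives existence.\<close>

lemma is_hgrad_iff_eq:
  assumes F: "smooth_field U F"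
    and iff: "\<And>c h. c \<in> U \<Longrightarrow> h \<in> loops \<Longrightarrow>
      (\<forall>k\<in>loops. \<omega> c h k = dir_deriv H c k) \<and> (\<forall>\<theta>. h \<theta> \<bullet> D_s c c \<theta> = 0) \<longleftrightarrow> h = F c"
  shows "is_hgrad U \<omega> H X \<longleftrightarrow> (\<forall>c\<in>U. X c = F c)"
proof
  assume X: "is_hgrad U \<omega> H X"
  show "\<forall>c\<in>U. X c = F c"
  proof
    fix c assume c: "c \<in> U"
    then have h: "X c \<in> loops" using X by (auto simp: is_hgrad_def is_hamiltonian_field_def smooth_field_loops)
    have "(\<forall>k\<in>loops. \<omega> c (X c) k = dir_deriv H c k) \<and> (\<forall>\<theta>. X c \<theta> \<bullet> D_s c c \<theta> = 0)"
      using X c by (simp add: is_hgrad_def is_hamiltonian_field_def)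
    then show "X c = F c" using iff[OF c h] by simp
  qed
next
  assume X: "\<forall>c\<in>U. X c = F c"
  then have "smooth_field U X" using smooth_field_cong[OF F, of X] by simp
  moreover have "(\<forall>k\<in>loops. \<omega> c (X c) k = dir_deriv H c k) \<and> (\<forall>\<theta>. X c \<theta> \<bullet> D_s c c \<theta> = 0)" if "c \<in> U" for c
    using iff[OF that smooth_field_loops[OF F that]] X that by simp
  ultimately show "is_hgrad U \<omega> H X" by (simp add: is_hgrad_def is_hamiltonian_field_def)
qed

lemma is_hgrad_perp_iff_eq:
  assumes F: "smooth_field U F"
    and iff: "\<And>c h. c \<in> U \<Longrightarrow> h \<in> loops \<Longrightarrow>
      (\<forall>k\<in>loops. \<omega> c h k = dir_deriv H c k) \<and> (\<forall>k\<in>form_kernel \<omega> c. G_id c h k = 0) \<longleftrightarrow> h = F c"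
  shows "is_hgrad_perp U \<omega> H X \<longleftrightarrow> (\<forall>c\<in>U. X c = F c)"
proof
  assume X: "is_hgrad_perp U \<omega> H X"
  show "\<forall>c\<in>U. X c = F c"
  proof
    fix c assume c: "c \<in> U"
    then have h: "X c \<in> loops" using X by (auto simp: is_hgrad_perp_def is_hamiltonian_field_def smooth_field_loops)
    have "(\<forall>k\<in>loops. \<omega> c (X c) k = dir_deriv H c k) \<and> (\<forall>k\<in>form_kernel \<omega> c. G_id c (X c) k = 0)"
      using X c by (simp add: is_hgrad_perp_def is_hamiltonian_field_def)
    then show "X c = F c" using iff[OF c h] by simp
  qed
next
  assume X: "\<forall>c\<in>U. X c = F c"
  then have "smooth_field U X" using smooth_field_cong[OF F, of X] by simp
  moreover have "(\<forall>k\<in>loops. \<omega> c (X c) k = dir_deriv H c k) \<and> (\<forall>k\<in>form_kernel \<omega> c. G_id c (X c) k = 0)"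
    if "c \<in> U" for c
    using iff[OF that smooth_field_loops[OF F that]] X that by simp
  ultimately show "is_hgrad_perp U \<omega> H X" by (simp add: is_hgrad_perp_def is_hamiltonian_field_def)
qed

text \<open>Serves \<open>Omega_id\<close> with a = 1 and \<open>Omega_MW\<close> with a =
  1/3.\<close>

lemma is_hgrad_multiple_Omega_id:
  assumes H: "smooth_functional Imm H" "Diff_invariant H" and g: "is_grad H gH" and a: "a \<noteq> 0"
  shows "is_hgrad Imm (\<lambda>c h k. a * Omega_id c h k) H X \<longleftrightarrow>
    (\<forall>c\<in>Imm. X c = (\<lambda>\<theta>. - ((1 / (3 * a)) *\<^sub>R tcross c (gH c) \<theta>)))"
proof (rule is_hgrad_iff_eq)
  have "smooth_field Imm gH" using g by (simp add: is_grad_def)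
  then show "smooth_field Imm (\<lambda>c \<theta>. - ((1 / (3 * a)) *\<^sub>R tcross c (gH c) \<theta>))"
    by (intro smooth_field_minus smooth_field_scaleR smooth_functional_const smooth_field_tcross order_refl)
  fix c h :: curve assume c: "c \<in> Imm" and h: "h \<in> loops"
  have gl: "gH c \<in> loops" using g c by (auto simp: is_grad_def smooth_field_loops)
  have gn: "gH c \<theta> \<bullet> D_s c c \<theta> = 0" for \<theta> by (rule grad_Diff_invariant[OF H(1) g H(2) c])
  have *: "a * Omega_id c h k = G_id c (\<lambda>\<theta>. (3 * a) *\<^sub>R tcross c h \<theta>) k" "dir_deriv H c k = G_id c (gH c) k"
    if "k \<in> loops" for k
    using Omega_id_eq[OF c h that] g c that by (simp_all add: G_id_scaleR_left is_grad_def)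
  have "(\<forall>k\<in>loops. a * Omega_id c h k = dir_deriv H c k) \<longleftrightarrow> (\<lambda>\<theta>. (3 * a) *\<^sub>R tcross c h \<theta>) = gH c"
    using G_id_eqI[OF c _ gl, of "\<lambda>\<theta>. (3 * a) *\<^sub>R tcross c h \<theta>"] c h * by auto
  then show "(\<forall>k\<in>loops. a * Omega_id c h k = dir_deriv H c k) \<and> (\<forall>\<theta>. h \<theta> \<bullet> D_s c c \<theta> = 0) \<longleftrightarrow>
      h = (\<lambda>\<theta>. - ((1 / (3 * a)) *\<^sub>R tcross c (gH c) \<theta>))"
    using tcross_eq_normal_iff[OF c gn, of "3 * a" h] a by simp
qed

definition regular_field :: "(curve \<Rightarrow> real) \<Rightarrow> (curve \<Rightarrow> curve) \<Rightarrow> (curve \<Rightarrow> curve) \<Rightarrow> curve \<Rightarrow> curve" where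
  "regular_field l gl gH c = (\<lambda>\<theta>. - (1 / (3 * l c)) *\<^sub>R
     (tcross c (gH c) \<theta> +
      (1 / (3 * l c + dir_deriv l c c)) *\<^sub>R
        (G_id c (gl c) (tcross c (gH c)) *\<^sub>R tcross c (tcross c c) \<theta>
         - G_id c c (gH c) *\<^sub>R tcross c (gl c) \<theta>)))"

text \<open>In terms of u, v and w = - J grad l this is (u - a v - b w) / (3 l). Since (a, b) are
  the coefficients of the projection of u to the span of v and w, both corrections are subtracted;
  the plus sign in the last line comes from the minus sign in w.\<close>

definition singular_field ::
    "(curve \<Rightarrow> real) \<Rightarrow> (curve \<Rightarrow> curve) \<Rightarrow> (curve \<Rightarrow> curve) \<Rightarrow> (curve \<Rightarrow> real ^ 2) \<Rightarrow> curve \<Rightarrow> curve" where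
  "singular_field l gl gH ab c = (\<lambda>\<theta>. (1 / (3 * l c)) *\<^sub>R
     (- tcross c (gH c) \<theta>
      - (ab c $ 1) *\<^sub>R (scaling c \<theta> - pr c (scaling c) \<theta>)
      + (ab c $ 2) *\<^sub>R tcross c (gl c) \<theta>))"

context
  fixes l H :: "curve \<Rightarrow> real" and gl gH :: "curve \<Rightarrow> curve"
  assumes l_pos: "\<And>c. c \<in> Imm \<Longrightarrow> l c > 0"
    and l_smooth: "smooth_functional Imm l"
    and l_inv: "Diff_invariant l"
    and l_grad: "is_grad l gl"
    and H_smooth: "smooth_functional Imm H"
    and H_inv: "Diff_invariant H"
    and H_grad: "is_grad H gH"
begin

lemma grads_smooth: "smooth_field Imm gl" "smooth_field Imm gH"
  using l_grad H_grad by (simp_all add: is_grad_def)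

lemma grads_loops: "c \<in> Imm \<Longrightarrow> gl c \<in> loops" "c \<in> Imm \<Longrightarrow> gH c \<in> loops"
  using grads_smooth by (simp_all add: smooth_field_loops)

lemma grads_normal: "c \<in> Imm \<Longrightarrow> gl c \<theta> \<bullet> D_s c c \<theta> = 0" "c \<in> Imm \<Longrightarrow> gH c \<theta> \<bullet> D_s c c \<theta> = 0"
  by (rule grad_Diff_invariant[OF l_smooth l_grad l_inv] grad_Diff_invariant[OF H_smooth H_grad H_inv], assumption)+

lemma dir_deriv_self: "c \<in> Imm \<Longrightarrow> dir_deriv l c c = G_id c (gl c) c"
  using l_grad by (simp add: is_grad_def)

section \<open>Case (a): the factor 3 l + dl(c) is nonzero on a dense set\<close>

lemma regular_at:
  assumes c: "c \<in> Imm" and \<mu>: "3 * l c + lie_deriv scaling l c \<noteq> 0" and h: "h \<in> loops"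
  shows "(\<forall>k\<in>loops. Omega l c h k = dir_deriv H c k) \<and> (\<forall>\<theta>. h \<theta> \<bullet> D_s c c \<theta> = 0) \<longleftrightarrow>
    h = regular_field l gl gH c"
  unfolding hamiltonian_at_iff_rep[OF l_smooth l_grad H_grad c h] regular_field_def dir_deriv_self[OF c]
  using \<mu> by (intro rep_eq_iff_regular[OF c l_pos[OF c] grads_loops[OF c] grads_normal[OF c] _ h])
    (simp add: lie_deriv_def scaling_def dir_deriv_self[OF c])

lemma smooth_regular_field:
  assumes U: "U \<subseteq> Imm" and \<mu>: "\<And>c. c \<in> U \<Longrightarrow> 3 * l c + lie_deriv scaling l c \<noteq> 0"
  shows "smooth_field U (regular_field l gl gH)"
proof -
  note g = grads_smooth[THEN smooth_field_subset, OF U]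
  note l = smooth_functional_subset[OF l_smooth U]
  have l0: "3 * l c \<noteq> 0" if "c \<in> U" for c using l_pos[of c] that U by auto
  have 3: "smooth_functional U (\<lambda>c. 3 * l c)"
    by (intro smooth_functional_mult smooth_functional_const l)
  have "smooth_functional U (\<lambda>c. 3 * l c + dir_deriv l c c)"
  proof (rule smooth_functional_cong)
    show "smooth_functional U (\<lambda>c. 3 * l c + G_id c (gl c) c)"
      by (intro smooth_functional_add 3 smooth_functional_G_id U g smooth_field_ident)
  qed (use U dir_deriv_self in auto)
  then have 4: "smooth_functional U (\<lambda>c. 1 / (3 * l c + dir_deriv l c c))"
    using \<mu> by (intro smooth_functional_divide smooth_functional_const) (simp_all add: lie_deriv_def scaling_def)
  note J = smooth_field_tcross[OF U]
  have "smooth_field U (\<lambda>c \<theta>. - (1 / (3 * l c)) *\<^sub>R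
     (tcross c (gH c) \<theta> +
      (1 / (3 * l c + dir_deriv l c c)) *\<^sub>R
        (G_id c (gl c) (tcross c (gH c)) *\<^sub>R tcross c (tcross c c) \<theta>
         - G_id c c (gH c) *\<^sub>R tcross c (gl c) \<theta>)))"
    by (rule smooth_field_scaleR[OF U smooth_functional_minus[OF smooth_functional_divide[OF smooth_functional_const 3 l0]]
          smooth_field_add[OF U J[OF g(2)] smooth_field_scaleR[OF U 4
            smooth_field_diff[OF U
              smooth_field_scaleR[OF U smooth_functional_G_id[OF U g(1) J[OF g(2)]] J[OF J[OF smooth_field_ident[OF U]]]]
              smooth_field_scaleR[OF U smooth_functional_G_id[OF U smooth_field_ident[OF U] g(2)] J[OF g(1)]]]]]])
  then show ?thesis by (simp add: regular_field_def[abs_def])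
qed

text \<open>The formula makes sense only on \<open>U\<close>. A Hamiltonian field on a larger open
  set is pinned down on the part in \<open>U\<close> by the formula, and at the remaining points by
  continuity, because \<open>U\<close> is dense.\<close>

lemma hgrad_regular:
  fixes U defines "U \<equiv> {c \<in> Imm. 3 * l c + lie_deriv scaling l c \<noteq> 0}"
  assumes dense: "\<forall>V. openin loop_topology V \<and> V \<subseteq> Imm \<and> V \<noteq> {} \<longrightarrow>
         (\<exists>c\<in>V. 3 * l c + lie_deriv scaling l c \<noteq> 0)"
  shows "is_hgrad U (Omega l) H X \<longleftrightarrow> (\<forall>c\<in>U. X c = regular_field l gl gH c)"
    and "V \<subseteq> Imm \<Longrightarrow> is_hgrad V (Omega l) H X \<Longrightarrow> c \<in> V \<inter> U \<Longrightarrow> X c = regular_field l gl gH c"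
    and "openin loop_topology V \<Longrightarrow> V \<subseteq> Imm \<Longrightarrow> is_hgrad V (Omega l) H X \<Longrightarrow> is_hgrad V (Omega l) H Y \<Longrightarrow>
      c \<in> V \<Longrightarrow> X c = Y c"
proof -
  have U: "c \<in> Imm" "3 * l c + lie_deriv scaling l c \<noteq> 0" if "c \<in> U" for c
    using that by (simp_all add: U_def)
  show "is_hgrad U (Omega l) H X \<longleftrightarrow> (\<forall>c\<in>U. X c = regular_field l gl gH c)"
    using U by (intro is_hgrad_iff_eq smooth_regular_field regular_at) auto
  show *: "X c = regular_field l gl gH c"
    if "V \<subseteq> Imm" "is_hgrad V (Omega l) H X" "c \<in> V \<inter> U" for V X c
  proof -
    have "X c \<in> loops"
      using that by (auto simp: is_hgrad_def is_hamiltonian_field_def smooth_field_loops)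
    moreover have "(\<forall>k\<in>loops. Omega l c (X c) k = dir_deriv H c k) \<and> (\<forall>\<theta>. X c \<theta> \<bullet> D_s c c \<theta> = 0)"
      using that by (simp add: is_hgrad_def is_hamiltonian_field_def)
    moreover have "c \<in> U" using that by simp
    ultimately show ?thesis using regular_at[OF U] by blast
  qed
  assume V: "openin loop_topology V" "V \<subseteq> Imm" and X: "is_hgrad V (Omega l) H X" and Y: "is_hgrad V (Omega l) H Y"
    and c: "c \<in> V"
  show "X c = Y c"
  proof (rule smooth_fields_eq_on_closure[OF _ c])
    show "loop_open V" using V by (simp add: openin_loop_topology)
    show "smooth_field V X" "smooth_field V Y"
      using X Y by (simp_all add: is_hgrad_def is_hamiltonian_field_def)
    show "\<exists>d\<in>W. 3 * l d + lie_deriv scaling l d \<noteq> 0" if "loop_open W" "W \<subseteq> V" "W \<noteq> {}" for W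
      using dense that V(2) by (simp add: openin_loop_topology)
    fix d assume "d \<in> V" "3 * l d + lie_deriv scaling l d \<noteq> 0"
    then have "d \<in> V \<inter> U" using V(2) by (auto simp: U_def)
    then show "X d = Y d" using *[OF V(2) X] *[OF V(2) Y] by simp
  qed
qed

section \<open>Case (b): the kernel of the form and the projection to its complement\<close>

lemma form_kernel_iff_rep:
  assumes c: "c \<in> Imm"
  shows "h \<in> form_kernel (Omega l) c \<longleftrightarrow> h \<in> loops \<and> rep c (l c) (gl c) h = (\<lambda>\<theta>. 0)"
proof -
  have "(\<forall>k\<in>loops. Omega l c h k = 0) \<longleftrightarrow> rep c (l c) (gl c) h = (\<lambda>\<theta>. 0)" if h: "h \<in> loops"
  proof -
    have r: "rep c (l c) (gl c) h \<in> loops" using c h grads_loops by simp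
    have 0: "G_id c (\<lambda>\<theta>. 0) k = 0" for k by (simp add: G_id_def)
    show ?thesis
      using G_id_eqI[OF c r loops_const[of 0]] Omega_rep[OF l_smooth l_grad c h] 0 by auto
  qed
  then show ?thesis by (auto simp: form_kernel_def)
qed

lemma form_kernel_diff:
  assumes c: "c \<in> Imm" and h: "h \<in> form_kernel (Omega l) c" and k: "k \<in> form_kernel (Omega l) c"
  shows "(\<lambda>\<theta>. h \<theta> - k \<theta>) \<in> form_kernel (Omega l) c"
  using assms rep_diff[OF c grads_loops(1)[OF c], of h k "l c"] by (simp add: form_kernel_iff_rep)

context
  assumes \<mu>0: "\<forall>c\<in>Imm. 3 * l c + lie_deriv scaling l c = 0"
    and scaling_inv: "flow_invariant scaling H"
    and MW_inv: "flow_invariant (\<lambda>c \<theta>. - tcross c (gl c) \<theta>) H"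
begin

text \<open>These are the vanishing factor and the two flow invariances of H, each read through a
  gradient.\<close>

lemma singular_pairings:
  assumes c: "c \<in> Imm"
  shows "G_id c (gl c) c = - (3 * l c)" "G_id c (gH c) c = 0" "G_id c (gH c) (tcross c (gl c)) = 0"
proof -
  show "G_id c (gl c) c = - (3 * l c)"
    using \<mu>0[rule_format, OF c] dir_deriv_self[OF c] by (simp add: lie_deriv_def scaling_def)
  show "G_id c (gH c) c = 0"
    using grad_flow_invariant[OF H_smooth H_grad scaling_inv c] by (simp add: scaling_def)
  show "G_id c (gH c) (tcross c (gl c)) = 0"
    using grad_flow_invariant[OF H_smooth H_grad MW_inv c] by (simp add: G_id_minus_right)
qed

lemma form_kernel_eq:
  assumes c: "c \<in> Imm"
  shows "form_kernel (Omega l) c =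
    {\<lambda>\<theta>. x *\<^sub>R scaling c \<theta> + y *\<^sub>R - tcross c (gl c) \<theta> + a \<theta> *\<^sub>R D_s c c \<theta> | x y a. a \<in> loops}"
proof -
  note iff = rep_eq_0_iff[OF c l_pos[OF c] grads_loops[OF c] grads_normal[OF c] singular_pairings[OF c]]
  have "(\<lambda>\<theta>. x *\<^sub>R c \<theta> + y *\<^sub>R - tcross c (gl c) \<theta> + a \<theta> *\<^sub>R D_s c c \<theta>) \<in> loops" if "a \<in> loops" for x y a
    using that c grads_loops[OF c] by simp
  then show ?thesis
    unfolding set_eq_iff form_kernel_iff_rep[OF c] mem_Collect_eq scaling_def using iff by blast
qed

abbreviation (input) "u_field \<equiv> \<lambda>c \<theta>. - tcross c (gH c) \<theta>"
abbreviation (input) "v_field \<equiv> \<lambda>c \<theta>. scaling c \<theta> - pr c (scaling c) \<theta>"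
abbreviation (input) "w_field \<equiv> \<lambda>c \<theta>. - tcross c (gl c) \<theta>"
abbreviation (input) "proj_coeffs \<equiv> \<lambda>c. matrix_inv (gram2 c (v_field c) (w_field c)) *v
  (vector [G_id c (u_field c) (v_field c), G_id c (u_field c) (w_field c)] :: real ^ 2)"
abbreviation (input) "X_field \<equiv> \<lambda>c \<theta>. - (1 / (3 * l c)) *\<^sub>R tcross c (gH c) \<theta>"

lemma normal_fields_smooth: "smooth_field Imm u_field" "smooth_field Imm v_field" "smooth_field Imm w_field"
proof -
  show "smooth_field Imm u_field" "smooth_field Imm w_field"
    by (intro smooth_field_minus smooth_field_tcross grads_smooth order_refl)+
  show "smooth_field Imm v_field"
    unfolding scaling_def by (intro smooth_field_proj smooth_field_ident order_refl)
qed

lemma normal_fields_loops: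
  assumes "c \<in> Imm"
  shows "u_field c \<in> loops" "v_field c \<in> loops" "w_field c \<in> loops"
  using assms normal_fields_smooth[THEN smooth_field_loops] by blast+

lemma v_w_independent:
  assumes c: "c \<in> Imm" and 0: "\<And>\<theta>. x *\<^sub>R v_field c \<theta> + y *\<^sub>R w_field c \<theta> = 0"
  shows "x = 0 \<and> y = 0"
  by (rule normal_kernel_independent[OF c l_pos[OF c] grads_loops[OF c] grads_normal[OF c]
        singular_pairings[OF c] 0[unfolded scaling_def]])

lemma det_gram2_v_w: "c \<in> Imm \<Longrightarrow> det (gram2 c (v_field c) (w_field c)) \<noteq> 0"
  by (intro det_gram2_nonzero normal_fields_loops) (use v_w_independent in blast)+

lemma smooth_singular_field: "smooth_field Imm (singular_field l gl gH proj_coeffs)"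
proof -
  note G = smooth_functional_G_id[OF order_refl]
  note n = normal_fields_smooth
  have det: "G_id c (v_field c) (v_field c) * G_id c (w_field c) (w_field c) - G_id c (v_field c) (w_field c) * G_id c (v_field c) (w_field c) \<noteq> 0"
    if "c \<in> Imm" for c using det_gram2_v_w[OF that] by (simp add: det_gram2)
  have 1: "smooth_functional Imm (\<lambda>c. proj_coeffs c $ 1)"
  proof (rule smooth_functional_cong)
    show "smooth_functional Imm (\<lambda>c. (G_id c (w_field c) (w_field c) * G_id c (u_field c) (v_field c) - G_id c (v_field c) (w_field c) * G_id c (u_field c) (w_field c))
        / (G_id c (v_field c) (v_field c) * G_id c (w_field c) (w_field c) - G_id c (v_field c) (w_field c) * G_id c (v_field c) (w_field c)))"
      by (rule smooth_functional_divide[OF _ _ det])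
        (intro smooth_functional_diff smooth_functional_mult G n)+
  qed (simp only: gram2_solution(3)[OF det_gram2_v_w])
  have 2: "smooth_functional Imm (\<lambda>c. proj_coeffs c $ 2)"
  proof (rule smooth_functional_cong)
    show "smooth_functional Imm (\<lambda>c. (G_id c (v_field c) (v_field c) * G_id c (u_field c) (w_field c) - G_id c (v_field c) (w_field c) * G_id c (u_field c) (v_field c))
        / (G_id c (v_field c) (v_field c) * G_id c (w_field c) (w_field c) - G_id c (v_field c) (w_field c) * G_id c (v_field c) (w_field c)))"
      by (rule smooth_functional_divide[OF _ _ det])
        (intro smooth_functional_diff smooth_functional_mult G n)+
  qed (simp only: gram2_solution(4)[OF det_gram2_v_w])
  have l0: "3 * l c \<noteq> 0" if "c \<in> Imm" for c using l_pos[OF that] by simp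
  have 3: "smooth_functional Imm (\<lambda>c. 3 * l c)"
    by (intro smooth_functional_mult smooth_functional_const l_smooth)
  note s = smooth_field_scaleR[OF order_refl]
  have "smooth_field Imm (\<lambda>c \<theta>. (1 / (3 * l c)) *\<^sub>R
     (u_field c \<theta> - (proj_coeffs c $ 1) *\<^sub>R v_field c \<theta> + (proj_coeffs c $ 2) *\<^sub>R tcross c (gl c) \<theta>))"
    by (rule s[OF smooth_functional_divide[OF smooth_functional_const 3 l0]
          smooth_field_add[OF order_refl smooth_field_diff[OF order_refl n(1) s[OF 1 n(2)]]
            s[OF 2 smooth_field_tcross[OF order_refl grads_smooth(1)]]]])
  then show ?thesis by (simp add: singular_field_def[abs_def])
qed

context
  fixes c u v w X F :: curve and A B :: real
  assumes c: "c \<in> Imm"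
    and u: "u = u_field c" and v: "v = v_field c" and w: "w = w_field c" and X: "X = X_field c"
    and A: "A = proj_coeffs c $ 1" and B: "B = proj_coeffs c $ 2"
    and F: "F = singular_field l gl gH proj_coeffs c"
begin

lemma F_eq: "F = (\<lambda>\<theta>. (1 / (3 * l c)) *\<^sub>R (u \<theta> - A *\<^sub>R v \<theta> - B *\<^sub>R w \<theta>))"
  by (simp add: F singular_field_def u v w A B)


lemma X_loops: "X \<in> loops"
  using c grads_loops by (simp add: X)

text \<open>X is a particular solution, and the equation is affine in \<open>h\<close>.\<close>

lemma hamiltonian_at_iff_kernel:
  assumes h: "h \<in> loops"
  shows "(\<forall>k\<in>loops. Omega l c h k = dir_deriv H c k) \<longleftrightarrow> (\<lambda>\<theta>. h \<theta> - X \<theta>) \<in> form_kernel (Omega l) c"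
proof -
  have "rep c (l c) (gl c) X = gH c"
    unfolding X by (rule rep_particular[OF c l_pos[OF c] grads_loops[OF c] grads_normal[OF c] singular_pairings[OF c]])
  then have "rep c (l c) (gl c) (\<lambda>\<theta>. h \<theta> - X \<theta>) = (\<lambda>\<theta>. rep c (l c) (gl c) h \<theta> - gH c \<theta>)"
    using rep_diff[OF c grads_loops(1)[OF c] h X_loops] by metis
  moreover have "(\<lambda>\<theta>. h \<theta> - X \<theta>) \<in> loops" using h X_loops by (rule loops_diff)
  ultimately show ?thesis
    unfolding hamiltonian_at_iff_rep[OF l_smooth l_grad H_grad c h] form_kernel_iff_rep[OF c]
    by (simp add: fun_eq_iff)
qed

lemma F_loops: "F \<in> loops"
  unfolding F using smooth_singular_field c by (rule smooth_field_loops)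

lemma F_X_kernel: "(\<lambda>\<theta>. F \<theta> - X \<theta>) \<in> form_kernel (Omega l) c"
proof -
  let ?x = "- (A / (3 * l c))" and ?y = "- (B / (3 * l c))"
  \<comment> \<open>F - X is - (A v + B w) / (3 l); this coefficient accounts for v being c minus
    its tangential part.\<close>
  let ?a = "\<lambda>\<theta>. (A / (3 * l c)) * (D_s c c \<theta> \<bullet> c \<theta>)"
  have "(\<lambda>\<theta>. F \<theta> - X \<theta>) = (\<lambda>\<theta>. ?x *\<^sub>R scaling c \<theta> + ?y *\<^sub>R - tcross c (gl c) \<theta> + ?a \<theta> *\<^sub>R D_s c c \<theta>)"
    unfolding F_eq X u v w scaling_def pr_def
    by (simp add: fun_eq_iff scaleR_add_right scaleR_diff_right)
  moreover have "?a \<in> loops" using c by (intro loops_mult loops_const loops_inner) simp_all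
  ultimately have "\<exists>x y a. (\<lambda>\<theta>. F \<theta> - X \<theta>) =
      (\<lambda>\<theta>. x *\<^sub>R scaling c \<theta> + y *\<^sub>R - tcross c (gl c) \<theta> + a \<theta> *\<^sub>R D_s c c \<theta>) \<and> a \<in> loops"
    by (intro exI conjI)
  then show ?thesis unfolding form_kernel_eq[OF c] mem_Collect_eq .
qed

text \<open>The Gram equations say precisely that F is orthogonal to v and w, and F is normal. Every
  kernel element is a combination of v, w and a tangential field.\<close>

lemma F_orthogonal:
  assumes k: "k \<in> form_kernel (Omega l) c"
  shows "G_id c F k = 0"
proof -
  note n = normal_fields_loops[OF c, folded u v w]
  have G: "G_id c F k = (1 / (3 * l c)) * (G_id c u k - A * G_id c v k - B * G_id c w k)"
    if "k \<in> loops" for k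
    unfolding F_eq using c n that by (simp add: G_id_simps)
  have sol: "G_id c v v * A + G_id c v w * B = G_id c u v" "G_id c v w * A + G_id c w w * B = G_id c u w"
    unfolding A B using gram2_solution(1,2)[OF det_gram2_v_w[OF c]] by (simp_all add: u v w)
  have Fv: "G_id c F v = 0"
    unfolding G[OF n(2)] G_id_commute[of c w v] sol(1)[symmetric] by simp
  have Fw: "G_id c F w = 0"
    unfolding G[OF n(3)] sol(2)[symmetric] by simp
  have FT: "G_id c F (\<lambda>\<theta>. a \<theta> *\<^sub>R D_s c c \<theta>) = 0" for a
    by (rule G_id_tangential)
      (use c in \<open>simp add: F_eq u v w scaling_def pr_def inner_diff_left inner_add_left inner_commute[of "c _"]\<close>)
  have "\<exists>x y a. k = (\<lambda>\<theta>. x *\<^sub>R c \<theta> + y *\<^sub>R w \<theta> + a \<theta> *\<^sub>R D_s c c \<theta>) \<and> a \<in> loops"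
    using k unfolding form_kernel_eq[OF c] mem_Collect_eq scaling_def w .
  then obtain x y a where a: "a \<in> loops"
    and k: "k = (\<lambda>\<theta>. x *\<^sub>R c \<theta> + y *\<^sub>R w \<theta> + a \<theta> *\<^sub>R D_s c c \<theta>)" by blast
  \<comment> \<open>Replacing c by v moves the tangential part of x c into the tangential
    coefficient.\<close>
  let ?b = "\<lambda>\<theta>. x * (D_s c c \<theta> \<bullet> c \<theta>) + a \<theta>"
  have b: "?b \<in> loops" using a c by (intro loops_add loops_mult loops_const loops_inner) simp_all
  have k': "k = (\<lambda>\<theta>. x *\<^sub>R v \<theta> + y *\<^sub>R w \<theta> + ?b \<theta> *\<^sub>R D_s c c \<theta>)"
    unfolding k v scaling_def pr_def by (simp add: fun_eq_iff algebra_simps)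
  note l = loops_scaleR[OF loops_const n(2), of x] loops_scaleR[OF loops_const n(3), of y]
    loops_scaleR[OF b D_s_loops[OF c Imm_loops[OF c]]]
  show ?thesis
    unfolding k' G_id_add_right[OF c F_loops loops_add[OF l(1,2)] l(3)] G_id_add_right[OF c F_loops l(1,2)]
      G_id_scaleR_right Fv Fw FT by simp
qed

text \<open>Two solutions orthogonal to the kernel differ by a kernel element that is orthogonal to
  itself, hence zero.\<close>

lemma singular_at:
  assumes h: "h \<in> loops"
  shows "(\<forall>k\<in>loops. Omega l c h k = dir_deriv H c k) \<and> (\<forall>k\<in>form_kernel (Omega l) c. G_id c h k = 0) \<longleftrightarrow> h = F"
proof (intro iffI)
  assume h': "(\<forall>k\<in>loops. Omega l c h k = dir_deriv H c k) \<and> (\<forall>k\<in>form_kernel (Omega l) c. G_id c h k = 0)"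
  let ?d = "\<lambda>\<theta>. h \<theta> - F \<theta>"
  have "(\<lambda>\<theta>. (h \<theta> - X \<theta>) - (F \<theta> - X \<theta>)) \<in> form_kernel (Omega l) c"
    by (rule form_kernel_diff[OF c _ F_X_kernel]) (use h' hamiltonian_at_iff_kernel[OF h] in blast)
  then have d: "?d \<in> form_kernel (Omega l) c" by simp
  have dl: "?d \<in> loops" using h F_loops by (rule loops_diff)
  have "G_id c ?d ?d = 0"
    unfolding G_id_diff_left[OF c h F_loops dl] using h' d F_orthogonal[OF d] by simp
  from G_id_self_eq_0[OF c dl this] show "h = F" by (simp add: fun_eq_iff)
next
  assume "h = F"
  then show "(\<forall>k\<in>loops. Omega l c h k = dir_deriv H c k) \<and> (\<forall>k\<in>form_kernel (Omega l) c. G_id c h k = 0)"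
    using hamiltonian_at_iff_kernel[OF F_loops] F_X_kernel F_orthogonal by blast
qed

text \<open>F lies in the complement and F - X in the kernel, so F is a projection of X;
  definiteness of the metric makes it the only one.\<close>

lemma orth_proj_iff:
  "is_orth_proj c (orth_compl c (form_kernel (Omega l) c)) X h \<longleftrightarrow> h = F"
proof
  assume p: "is_orth_proj c (orth_compl c (form_kernel (Omega l) c)) X h"
  let ?d = "\<lambda>\<theta>. h \<theta> - F \<theta>"
  have h: "h \<in> loops" and ho: "\<And>k. k \<in> form_kernel (Omega l) c \<Longrightarrow> G_id c h k = 0"
    using p by (auto simp: is_orth_proj_def orth_compl_def)
  have dl: "?d \<in> loops" using h F_loops by (rule loops_diff)
  have "G_id c ?d k = 0" if k: "k \<in> form_kernel (Omega l) c" for k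
    using ho[OF k] F_orthogonal[OF k] k G_id_diff_left[OF c h F_loops, of k] by (simp add: form_kernel_def)
  then have d: "?d \<in> orth_compl c (form_kernel (Omega l) c)" using dl by (simp add: orth_compl_def)
  have "G_id c (\<lambda>\<theta>. X \<theta> - h \<theta>) ?d = 0" using p d unfolding is_orth_proj_def by blast
  moreover have "G_id c (\<lambda>\<theta>. F \<theta> - X \<theta>) ?d = 0"
    using d F_X_kernel G_id_commute[of c ?d] unfolding orth_compl_def by simp
  ultimately have "G_id c ?d ?d = 0"
    unfolding G_id_diff_left[OF c X_loops h dl] G_id_diff_left[OF c F_loops X_loops dl]
      G_id_diff_left[OF c h F_loops dl] by simp
  from G_id_self_eq_0[OF c dl this] show "h = F" by (simp add: fun_eq_iff)
next
  assume h: "h = F"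
  have "G_id c (\<lambda>\<theta>. X \<theta> - F \<theta>) k = 0" if k: "k \<in> orth_compl c (form_kernel (Omega l) c)" for k
  proof -
    have kl: "k \<in> loops" using k by (simp add: orth_compl_def)
    have "G_id c k (\<lambda>\<theta>. F \<theta> - X \<theta>) = 0" using k F_X_kernel unfolding orth_compl_def by blast
    then show ?thesis
      unfolding G_id_commute[of c k] G_id_diff_left[OF c F_loops X_loops kl] G_id_diff_left[OF c X_loops F_loops kl]
      by simp
  qed
  then show "is_orth_proj c (orth_compl c (form_kernel (Omega l) c)) X h"
    using h F_loops F_orthogonal by (simp add: is_orth_proj_def orth_compl_def)
qed

end

lemma hgrad_perp_iff:
  "is_hgrad_perp Imm (Omega l) H X \<longleftrightarrow> (\<forall>c\<in>Imm. X c = singular_field l gl gH proj_coeffs c)"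
  by (rule is_hgrad_perp_iff_eq[OF smooth_singular_field singular_at[OF _ refl refl refl refl refl refl refl]])

end

section \<open>Horizontal gradients for the unweighted forms\<close>

lemma Omega_MW_scaled: "Omega_MW = (\<lambda>c h k. 1 / 3 * Omega_id c h k)"
  by (simp add: fun_eq_iff Omega_MW_def)

lemma hgrad_MW_l: "is_hgrad Imm Omega_MW l X \<longleftrightarrow> (\<forall>c\<in>Imm. X c = (\<lambda>\<theta>. - tcross c (gl c) \<theta>))"
  using is_hgrad_multiple_Omega_id[OF l_smooth l_inv l_grad, of "1 / 3" X] unfolding Omega_MW_scaled by simp

lemma hgrad_MW_H: "is_hgrad Imm Omega_MW H X \<longleftrightarrow> (\<forall>c\<in>Imm. X c = (\<lambda>\<theta>. - tcross c (gH c) \<theta>))"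
  using is_hgrad_multiple_Omega_id[OF H_smooth H_inv H_grad, of "1 / 3" X] unfolding Omega_MW_scaled by simp

lemma hgrad_id_H: "is_hgrad Imm Omega_id H X \<longleftrightarrow>
    (\<forall>c\<in>Imm. \<forall>\<theta>. - (1 / (3 * l c)) *\<^sub>R tcross c (gH c) \<theta> = (1 / l c) *\<^sub>R X c \<theta>)"
proof -
  have "X c = (\<lambda>\<theta>. - ((1 / 3) *\<^sub>R tcross c (gH c) \<theta>)) \<longleftrightarrow>
      (\<forall>\<theta>. - (1 / (3 * l c)) *\<^sub>R tcross c (gH c) \<theta> = (1 / l c) *\<^sub>R X c \<theta>)" if c: "c \<in> Imm" for c
  proof -
    have "- (1 / (3 * l c)) *\<^sub>R tcross c (gH c) \<theta> = (1 / l c) *\<^sub>R - ((1 / 3) *\<^sub>R tcross c (gH c) \<theta>)" for \<theta>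
      by simp
    then show ?thesis
      using l_pos[OF c] unfolding fun_eq_iff by (simp only: scaleR_cancel_left) auto
  qed
  then show ?thesis
    using is_hgrad_multiple_Omega_id[OF H_smooth H_inv H_grad, of 1 X] by simp
qed

end


theorem proposition3p6:
  fixes l H :: "curve \<Rightarrow> real" and gl gH :: "curve \<Rightarrow> curve"
  assumes l_pos: "\<And>c. c \<in> Imm \<Longrightarrow> l c > 0"
    and l_smooth: "smooth_functional Imm l"
    and l_inv: "Diff_invariant l"
    and l_grad: "is_grad l gl"
    and H_smooth: "smooth_functional Imm H"
    and H_inv: "Diff_invariant H"
    and H_grad: "is_grad H gH"
  shows
    "((\<forall>V. openin loop_topology V \<and> V \<subseteq> Imm \<and> V \<noteq> {} \<longrightarrow>
         (\<exists>c\<in>V. 3 * l c + lie_deriv scaling l c \<noteq> 0)) \<longrightarrow>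
       (let U = {c \<in> Imm. 3 * l c + lie_deriv scaling l c \<noteq> 0};
            F = (\<lambda>c \<theta>. - (1 / (3 * l c)) *\<^sub>R
                  (tcross c (gH c) \<theta> +
                   (1 / (3 * l c + dir_deriv l c c)) *\<^sub>R
                     (G_id c (gl c) (tcross c (gH c)) *\<^sub>R tcross c (tcross c c) \<theta>
                      - G_id c c (gH c) *\<^sub>R tcross c (gl c) \<theta>)))
        in (\<forall>X. is_hgrad U (Omega l) H X \<longleftrightarrow> (\<forall>c\<in>U. X c = F c)) \<and>
           (\<forall>V X. openin loop_topology V \<and> V \<subseteq> Imm \<and> is_hgrad V (Omega l) H X \<longrightarrow>
              (\<forall>c\<in>V \<inter> U. X c = F c)) \<and>
           (\<forall>V X Y. openin loop_topology V \<and> V \<subseteq> Imm \<and>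
              is_hgrad V (Omega l) H X \<and> is_hgrad V (Omega l) H Y \<longrightarrow> (\<forall>c\<in>V. X c = Y c))))
     \<and>
     ((\<forall>c\<in>Imm. 3 * l c + lie_deriv scaling l c = 0) \<and>
       flow_invariant scaling H \<and>
       flow_invariant (\<lambda>c \<theta>. - tcross c (gl c) \<theta>) H \<longrightarrow>
       (let u = (\<lambda>c \<theta>. - tcross c (gH c) \<theta>);
            v = (\<lambda>c \<theta>. scaling c \<theta> - pr c (scaling c) \<theta>);
            w = (\<lambda>c \<theta>. - tcross c (gl c) \<theta>);
            XH = (\<lambda>c \<theta>. - (1 / (3 * l c)) *\<^sub>R tcross c (gH c) \<theta>);
            ab = (\<lambda>c. matrix_inv (gram2 c (v c) (w c)) *v
                        (vector [G_id c (u c) (v c), G_id c (u c) (w c)] :: real ^ 2));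
            F = (\<lambda>c \<theta>. (1 / (3 * l c)) *\<^sub>R
                  (- tcross c (gH c) \<theta>
                   - (ab c $ 1) *\<^sub>R (scaling c \<theta> - pr c (scaling c) \<theta>)
                   + (ab c $ 2) *\<^sub>R tcross c (gl c) \<theta>))
        in (\<forall>X. is_hgrad Imm Omega_MW l X \<longleftrightarrow> (\<forall>c\<in>Imm. X c = w c)) \<and>
           (\<forall>X. is_hgrad Imm Omega_MW H X \<longleftrightarrow> (\<forall>c\<in>Imm. X c = u c)) \<and>
           (\<forall>X. is_hgrad Imm Omega_id H X \<longleftrightarrow> (\<forall>c\<in>Imm. \<forall>\<theta>. XH c \<theta> = (1 / l c) *\<^sub>R X c \<theta>)) \<and>
           (\<forall>c\<in>Imm. form_kernel (Omega l) c =
              {\<lambda>\<theta>. x *\<^sub>R scaling c \<theta> + y *\<^sub>R w c \<theta> + a \<theta> *\<^sub>R D_s c c \<theta> | x y a. a \<in> loops}) \<and>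
           (\<forall>c\<in>Imm. (\<forall>x y. (\<forall>\<theta>. x *\<^sub>R v c \<theta> + y *\<^sub>R w c \<theta> = 0) \<longrightarrow> x = 0 \<and> y = 0) \<and>
              invertible (gram2 c (v c) (w c))) \<and>
           (\<forall>X. is_hgrad_perp Imm (Omega l) H X \<longleftrightarrow>
              (\<forall>c\<in>Imm. is_orth_proj c (orth_compl c (form_kernel (Omega l) c)) (XH c) (X c))) \<and>
           (\<forall>X. is_hgrad_perp Imm (Omega l) H X \<longleftrightarrow> (\<forall>c\<in>Imm. X c = F c))))"
proof (intro conjI impI, goal_cases)
  case 1
  note r = hgrad_regular[OF l_pos l_smooth l_inv l_grad H_smooth H_inv H_grad 1, unfolded regular_field_def]
  show ?case
    unfolding Let_def
    by (intro conjI allI r(1)) (use r(2,3) in blast)+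
next
  case 2
  note hyps = l_pos l_smooth l_inv l_grad H_smooth H_inv H_grad
  from 2 have b: "\<forall>c\<in>Imm. 3 * l c + lie_deriv scaling l c = 0" "flow_invariant scaling H"
    "flow_invariant (\<lambda>c \<theta>. - tcross c (gl c) \<theta>) H" by simp_all
  note perp = hgrad_perp_iff[OF hyps b, unfolded singular_field_def]
  note proj = orth_proj_iff[OF hyps b _ refl refl refl refl refl refl refl, unfolded singular_field_def]
  show ?case
    unfolding Let_def
  proof (intro conjI allI)
    fix X
    show "is_hgrad Imm Omega_MW l X \<longleftrightarrow> (\<forall>c\<in>Imm. X c = (\<lambda>\<theta>. - tcross c (gl c) \<theta>))"
      by (rule hgrad_MW_l[OF hyps])
    show "is_hgrad Imm Omega_MW H X \<longleftrightarrow> (\<forall>c\<in>Imm. X c = (\<lambda>\<theta>. - tcross c (gH c) \<theta>))"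
      by (rule hgrad_MW_H[OF hyps])
    show "is_hgrad Imm Omega_id H X \<longleftrightarrow>
        (\<forall>c\<in>Imm. \<forall>\<theta>. - (1 / (3 * l c)) *\<^sub>R tcross c (gH c) \<theta> = (1 / l c) *\<^sub>R X c \<theta>)"
      by (rule hgrad_id_H[OF hyps])
  next
    show "\<forall>c\<in>Imm. form_kernel (Omega l) c =
        {\<lambda>\<theta>. x *\<^sub>R scaling c \<theta> + y *\<^sub>R - tcross c (gl c) \<theta> + a \<theta> *\<^sub>R D_s c c \<theta> | x y a. a \<in> loops}"
      using form_kernel_eq[OF hyps b] by blast
  next
    show "\<forall>c\<in>Imm. (\<forall>x y. (\<forall>\<theta>. x *\<^sub>R (scaling c \<theta> - pr c (scaling c) \<theta>) + y *\<^sub>R - tcross c (gl c) \<theta> = 0) \<longrightarrow>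
          x = 0 \<and> y = 0) \<and>
        invertible (gram2 c (\<lambda>\<theta>. scaling c \<theta> - pr c (scaling c) \<theta>) (\<lambda>\<theta>. - tcross c (gl c) \<theta>))"
      using v_w_independent[OF hyps b] det_gram2_v_w[OF hyps b] unfolding invertible_det_nz by blast
  next
    fix X
    show "is_hgrad_perp Imm (Omega l) H X \<longleftrightarrow>
        (\<forall>c\<in>Imm. is_orth_proj c (orth_compl c (form_kernel (Omega l) c))
          (\<lambda>\<theta>. - (1 / (3 * l c)) *\<^sub>R tcross c (gH c) \<theta>) (X c))"
      \<comment> \<open>Both sides say that X equals the explicit smooth field on
        \<open>Imm\<close>; this is how a pointwise projection yields a smooth field.\<close>
      by (simp only: perp proj cong: ball_cong)
  qed (rule perp)
qed

end
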